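(* Fix $\sigma>0$ (independent of $M$). For $M\ge2$ let $f_M$ be the single-epoch DP-SGD random-shuffling trade-off function with $M$ rounds and noise multiplier $\sigma$, and let $\mu=\mu_M=\sqrt{(e^{1/\sigma^2}-1)/(M-1)}$. Then there exist sequences $\delta_M\ge0$ with $\delta_M=o(1/M)$ and $\gamma_M\ge0$ with $\gamma_M=O(\sqrt{\ln M}/M)$ such that: (1) for all $a\in[\delta_M,1-\delta_M]$, $$G_{\mu+\gamma_M}(a+\delta_M)-\delta_M\;\le\; f_M(a)\;\le\; G_{\mu-\gamma_M}(a-\delta_M)+\delta_M+s_M(a),$$ where $s_M(a)=\frac{e^{2/\sigma^2}}{\sqrt{8\pi e}\,(M-1)}$ if $a\ge 1/2+\delta_M$ and $s_M(a)=0$ otherwise; (2) for all $a\in[0,1]$, $f_M(a)\ge (G_{\mu+\gamma_M}\otimes f_{0,\hat\delta_M})(a)$, where $\hat\delta_M=\max\{\delta_M/a^*,\,(1-G_{\mu+\gamma_M}(\delta_M))+\delta_M\}$ and $a^*$ is the unique solution of $a^*=G_{\mu+\gamma_M}(a^* )$; (3) let $c\ge0$ and let $(E_M)$ be positive integers with $E_M=c_M^2 M$ where $c_M\to c$ as $M\to\infty$. Then $f_M^{\otimes E_M}(a)\ge G_{c\sqrt{e^{1/\sigma^2}-1}}(a)$ asymptotically uniformly in $a$, i.e. for every $\eta>0$ there is $M_0$ with $f_M^{\otimes E_M}(a)\ge G_{c\sqrt{e^{1/\sigma^2}-1}}(a)-\eta$ for all $M\ge M_0$ and all $a\in[0,1]$.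 In particular, if $c_M\to0$ then $f_M^{\otimes E_M}(a)\to 1-a$ uniformly in $a\in[0,1]$.
   Context: Fix a noise multiplier $\sigma>0$ and an integer $M\ge2$. Write $\mathrm{n}(x)=e^{-x^2/2}/\sqrt{2\pi}$ and $\Phi(x)=\int_{-\infty}^x\mathrm{n}(t)\,dt$. Let $P_0$ be the law on $\mathbb R^M$ of $(X_1,\dots,X_M)$ with i.i.d. $N(0,1)$ coordinates, and $P_1$ the law obtained by drawing $J$ uniformly from $\{1,\dots,M\}$ and then, independently, $X_J\sim N(1/\sigma,1)$ and $X_i\sim N(0,1)$ for $i\neq J$, all independent. For a (randomized) rejection rule $\phi:\mathbb R^M\to[0,1]$ let $\alpha(\phi)=\mathbb E_{P_0}[\phi]$, $\beta(\phi)=1-\mathbb E_{P_1}[\phi]$. For distributions $P,Q$ the trade-off function is $T(P,Q)(a)=\inf\{\beta(\phi):\alpha(\phi)\le a\}$, $a\in[0,1]$. The single-epoch DP-SGD random-shuffling trade-off function with $M$ rounds and noise multiplier $\sigma$ is $f=T(P_0,P_1)$. For trade-off functions $f=T(P,Q)$, $g=T(P',Q')$, the composition is $f\otimes g=T(P\times P',Q\times Q')$, and $f^{\otimes E}$ denotes the $E$-fold composition. The Gaussian trade-off function is $G_\mu(a)=\Phi(\Phi^{-1}(1-a)-\mu)$ (for real $\mu$), and $f_{0,\delta}(a)=\max\{1-a-\delta,0\}$ (the trade-off function of $U(0,1)$ versus $U(\delta,1+\delta)$). *)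

theory Defs
  imports "HOL-Probability.Probability" "HOL-Library.Landau_Symbols"
begin

definition normal1 :: "real \<Rightarrow> real measure" where
  "normal1 m = density lborel (normal_density m 1)"

definition Phi :: "real \<Rightarrow> real" where
  "Phi x = measure (normal1 0) {..x}"

definition Phi_inv :: "real \<Rightarrow> real" where
  "Phi_inv p = (THE x. Phi x = p)"

text \<open>Gaussian trade-off function G_mu(a) = Phi(Phi^{-1}(1-a) - mu), with the
  usual conventions Phi^{-1}(1) = +infinity, Phi^{-1}(0) = -infinity at the endpoints.\<close>
definition G :: "real \<Rightarrow> real \<Rightarrow> real" where
  "G mu a = (if a \<le> 0 then 1 else if a \<ge> 1 then 0 else Phi (Phi_inv (1 - a) - mu))"

definition tradeoff :: "'a measure \<Rightarrow> 'a measure \<Rightarrow> real \<Rightarrow> real" where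
  "tradeoff P Q a =
     (INF phi \<in> {phi. phi \<in> borel_measurable P \<and> (\<forall>x\<in>space P. 0 \<le> phi x \<and> phi x \<le> 1)
                    \<and> (\<integral>x. phi x \<partial>P) \<le> a}. 1 - (\<integral>x. phi x \<partial>Q))"

definition P0 :: "nat \<Rightarrow> (nat \<Rightarrow> real) measure" where
  "P0 M = PiM {..<M} (\<lambda>_. normal1 0)"

definition P1 :: "real \<Rightarrow> nat \<Rightarrow> (nat \<Rightarrow> real) measure" where
  "P1 \<sigma> M = measure_pmf (pmf_of_set {..<M}) \<bind>
      (\<lambda>J. PiM {..<M} (\<lambda>i. if i = J then normal1 (1 / \<sigma>) else normal1 0))"

definition f_shuffle :: "real \<Rightarrow> nat \<Rightarrow> real \<Rightarrow> real" where
  "f_shuffle \<sigma> M = tradeoff (P0 M) (P1 \<sigma> M)"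

definition f_shuffle_comp :: "real \<Rightarrow> nat \<Rightarrow> nat \<Rightarrow> real \<Rightarrow> real" where
  "f_shuffle_comp \<sigma> M E = tradeoff (PiM {..<E} (\<lambda>_. P0 M)) (PiM {..<E} (\<lambda>_. P1 \<sigma> M))"

text \<open>G_mu \<otimes> f_{0,delta} = T(N(0,1) x U(0,1), N(mu,1) x U(delta,1+delta)).\<close>
definition G_comp_f0 :: "real \<Rightarrow> real \<Rightarrow> real \<Rightarrow> real" where
  "G_comp_f0 mu d = tradeoff (normal1 0 \<Otimes>\<^sub>M uniform_measure lborel {0..1})
                             (normal1 mu \<Otimes>\<^sub>M uniform_measure lborel {d..1+d})"

end

theory Submission
  imports Defs "HOL-Real_Asymp.Real_Asymp"
begin

text \<open>By Neyman-Pearson duality a trade-off function \<open>T(P, Q)\<close> is determined by the hinge function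
  \<open>H t = E\<^sub>P (L - t)\<^sub>+\<close> of the likelihood ratio \<open>L = dQ/dP\<close>, and a uniform bound on the difference
  of two hinge functions becomes the same bound on the trade-off functions. For random shuffling,
  \<open>L = 1 + s W\<close> where \<open>s\<^sup>2 = (exp (\<tau>\<^sup>2) - 1) / M\<close>, \<open>\<tau> = 1 / \<sigma>\<close>, and \<open>W\<close> is a normalised sum of
  \<open>M\<close> i.i.d. lognormal variables. Stein's equation gives \<open>E (W - x)\<^sub>+ = E (Z - x)\<^sub>+ + O (1 / ((1 + |x|) sqrt M))\<close>
  for a standard normal \<open>Z\<close>. For bounded \<open>x\<close> the resulting error \<open>O(1/M)\<close> in \<open>H\<close> is absorbed by shifting the
  Gaussian parameter by \<open>\<gamma> = sqrt (ln M) / M\<close>, and for large \<open>|x|\<close> it is \<open>o(1/M)\<close>; the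
  remaining uniform error is \<open>\<delta>\<close>. Under composition hinge errors add up, because the other factors
  have mean \<open>1\<close>, so that \<open>n = O(M)\<close> epochs cost only \<open>n \<delta> = o(1)\<close>.\<close>

section \<open>Gaussian tails\<close>

text \<open>Why hinges and not distribution functions: a Berry-Esseen bound for \<open>W\<close>
  would leave an error of order \<open>1 / sqrt M\<close> in both error probabilities. The hinge of
  \<open>1 + s W\<close> at \<open>t\<close> is \<open>s * E (W - x)_+\<close> with
  \<open>x = (t - 1) / s\<close>, so the factor \<open>s\<close> gains a second
  \<open>1 / sqrt M\<close>. The resulting \<open>C / M\<close> would still add up to a constant
  over \<open>M\<close> epochs, and two effects are played against each other to beat it. Raising
  the Gaussian parameter by \<open>\<gamma>\<close> raises the hinge by about
  \<open>\<gamma> * \<phi> x\<close>, which exceeds \<open>C / M\<close> on every bounded range of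
  \<open>x\<close> because \<open>M * \<gamma> = sqrt (ln M)\<close> is unbounded. Beyond that range
  only decay of the error in \<open>x\<close> helps, so every estimate, including the one that
  replaces \<open>exp (m z - m^2 / 2)\<close> by \<open>1 + m z\<close>, must carry the weight
  \<open>1 / (1 + |x|)\<close>. No rate is extracted for \<open>\<delta>\<close>: it is the supremum
  of the actual hinge gap, so the finite-\<open>M\<close> claims hold for all
  \<open>M \<ge> 2\<close> by definition and only its order is asymptotic.\<close>

abbreviation gauss_density ("\<phi>") where "\<phi> \<equiv> std_normal_density"

lemma prob_space_normal1: "prob_space (normal1 m)"
  unfolding normal1_def by (rule prob_space_normal_density) simp

lemma sets_normal1 [simp, measurable_cong]: "sets (normal1 m) = sets borel"
  and space_normal1 [simp]: "space (normal1 m) = UNIV"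
  by (simp_all add: normal1_def)

lemma real_distribution_normal1: "real_distribution (normal1 m)"
  using prob_space_normal1 by (simp add: real_distribution_def real_distribution_axioms_def)

lemma integral_normal1:
  fixes f :: "real \<Rightarrow> real"
  assumes [measurable]: "f \<in> borel_measurable borel"
  shows "(\<integral>x. f x \<partial>normal1 m) = (\<integral>x. normal_density m 1 x * f x \<partial>lborel)"
  unfolding normal1_def by (subst integral_density) auto

lemma integrable_normal1:
  fixes f :: "real \<Rightarrow> real"
  assumes [measurable]: "f \<in> borel_measurable borel"
  shows "integrable (normal1 m) f \<longleftrightarrow> integrable lborel (\<lambda>x. normal_density m 1 x * f x)"
  unfolding normal1_def by (subst integrable_density) auto

lemma std_normal_density_pos [simp]: "0 < \<phi> x"
  by (simp add: normal_density_pos)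

lemma std_normal_density_uminus [simp]: "\<phi> (- x) = \<phi> x"
  by (simp add: normal_density_def)

lemma std_normal_density_antimono: "\<bar>x\<bar> \<le> \<bar>y\<bar> \<Longrightarrow> \<phi> y \<le> \<phi> x"
  by (auto simp: normal_density_def abs_le_square_iff intro!: divide_right_mono)

lemma std_normal_density_le_1: "\<phi> x \<le> 1"
proof -
  have "\<phi> x \<le> \<phi> 0" by (rule std_normal_density_antimono) simp
  also have "\<phi> 0 \<le> 1"
    using pi_ge_two by (simp add: normal_density_def field_simps)
  finally show ?thesis .
qed

lemma DERIV_std_normal_density [derivative_intros]:
  assumes "(f has_real_derivative f') (at x within S)"
  shows "((\<lambda>x. \<phi> (f x)) has_real_derivative - f x * \<phi> (f x) * f') (at x within S)"
  unfolding normal_density_def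
  by (rule derivative_eq_intros assms refl | simp)+

lemma std_normal_density_tendsto_0_at_top: "(\<phi> \<longlongrightarrow> 0) at_top"
  unfolding std_normal_density_def by real_asymp

lemma std_normal_density_mult_tendsto_0_at_top: "((\<lambda>x. x * \<phi> x) \<longlongrightarrow> 0) at_top"
  unfolding std_normal_density_def by real_asymp

lemma continuous_on_std_normal_density: "continuous_on S \<phi>"
  unfolding normal_density_def by (intro continuous_intros) auto

lemma exp_tilt_std_normal_density: "exp (m * z - m\<^sup>2 / 2) * \<phi> z = normal_density m 1 z"
  by (simp add: normal_density_def flip: exp_add) (simp add: power2_eq_square field_simps)

text \<open>Completing the square: \<open>exp (m * z - m^2 / 2)\<close> is the likelihood ratio of
  \<open>N(m,1)\<close> against \<open>N(0,1)\<close>, the Gaussian counterpart of the shuffling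
  ratio.\<close>

lemma normal1_eq_density:
  "normal1 m = density (normal1 0) (\<lambda>z. ennreal (exp (m * z - m\<^sup>2 / 2)))"
proof -
  have "density (normal1 0) (\<lambda>z. ennreal (exp (m * z - m\<^sup>2 / 2)))
      = density lborel (\<lambda>z. ennreal (exp (m * z - m\<^sup>2 / 2) * \<phi> z))"
    unfolding normal1_def by (subst density_density_eq) (auto simp: ennreal_mult' mult.commute)
  also have "\<dots> = normal1 m"
    by (simp only: exp_tilt_std_normal_density normal1_def)
  finally show ?thesis ..
qed

section \<open>Distribution function and quantiles of the standard normal law\<close>

lemma Phi_eq_cdf: "Phi = cdf (normal1 0)"
  by (auto simp: Phi_def cdf_def)

lemma Phi_tendsto_1: "(Phi \<longlongrightarrow> 1) at_top"
  using real_distribution.cdf_lim_at_top_prob[OF real_distribution_normal1] by (simp add: Phi_eq_cdf)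

lemma Phi_tendsto_0: "(Phi \<longlongrightarrow> 0) at_bot"
proof -
  interpret real_distribution "normal1 0" by (rule real_distribution_normal1)
  show ?thesis using cdf_lim_at_bot by (simp add: Phi_eq_cdf)
qed

lemma Phi_le_1: "Phi x \<le> 1" and Phi_ge_0: "0 \<le> Phi x"
  unfolding Phi_def using prob_space.prob_le_1[OF prob_space_normal1] by auto

lemma measure_normal1_interval:
  assumes "a \<le> b"
  shows "Phi b - Phi a = integral {a..b} \<phi>"
proof -
  interpret real_distribution "normal1 0" by (rule real_distribution_normal1)
  have int: "set_integrable lborel {a..b} \<phi>"
    unfolding set_integrable_def by (rule integrable_mult_indicator) auto
  have "Phi b - Phi a = measure (normal1 0) {a<..b}"
    using cdf_diff_eq[of a b] assms by (cases "a = b") (auto simp: Phi_eq_cdf)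
  also have "\<dots> = (\<integral>x. indicator {a<..b} x \<partial>normal1 0)"
    by simp
  also have "\<dots> = (LINT x|lborel. \<phi> x * indicator {a<..b} x)"
    by (rule integral_normal1) simp
  also have "\<dots> = (LINT x|lborel. indicator {a..b} x *\<^sub>R \<phi> x)"
  proof (rule integral_cong_AE)
    show "AE x in lborel. \<phi> x * indicator {a<..b} x = indicator {a..b} x *\<^sub>R \<phi> x"
      using AE_lborel_singleton[of a] by eventually_elim (auto simp: indicator_def)
  qed auto
  also have "\<dots> = integral {a..b} \<phi>"
    using set_borel_integral_eq_integral(2)[OF int] by (simp add: set_lebesgue_integral_def)
  finally show ?thesis .
qed

lemma DERIV_Phi: "(Phi has_real_derivative \<phi> x) (at x)"
proof -
  have "((\<lambda>u. integral {x - 1..u} \<phi>) has_real_derivative \<phi> x) (at x within {x - 1..x + 1})"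
    by (rule integral_has_real_derivative) (auto intro: continuous_on_std_normal_density)
  then have "((\<lambda>u. Phi (x - 1) + integral {x - 1..u} \<phi>) has_real_derivative \<phi> x) (at x within {x - 1..x + 1})"
    by (auto intro!: derivative_eq_intros)
  moreover have "Phi (x - 1) + integral {x - 1..u} \<phi> = Phi u" if "u \<in> {x - 1..x + 1}" for u
    using measure_normal1_interval[of "x - 1" u] that by auto
  ultimately have "(Phi has_real_derivative \<phi> x) (at x within {x - 1..x + 1})"
    by (subst has_field_derivative_cong_ev[OF refl, where g = "\<lambda>u. Phi (x - 1) + integral {x - 1..u} \<phi>"])
       (auto simp: eventually_at_filter)
  then show ?thesis
    by (subst (asm) at_within_interior) auto
qed

lemmas DERIV_Phi' [derivative_intros] = DERIV_chain2[OF DERIV_Phi]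

lemma isCont_Phi: "isCont Phi x"
  by (rule DERIV_isCont[OF DERIV_Phi])

lemma Phi_strict_mono: "x < y \<Longrightarrow> Phi x < Phi y"
  by (rule DERIV_pos_imp_increasing[of x y Phi]) (auto intro: DERIV_Phi)

lemma Phi_mono: "x \<le> y \<Longrightarrow> Phi x \<le> Phi y"
  using Phi_strict_mono[of x y] by (cases "x = y") auto

lemma Phi_less_1: "Phi x < 1" and Phi_gt_0: "0 < Phi x"
  using Phi_strict_mono[of x "x + 1"] Phi_le_1[of "x + 1"] Phi_strict_mono[of "x - 1" x] Phi_ge_0[of "x - 1"]
  by auto

lemma Phi_diff_le: "x \<le> y \<Longrightarrow> Phi y - Phi x \<le> y - x"
proof -
  assume "x \<le> y"
  moreover have "\<exists>z. x < z \<and> z < y \<and> Phi y - Phi x = (y - x) * \<phi> z" if "x < y"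
    using that by (intro MVT2 DERIV_Phi)
  ultimately show ?thesis
    using std_normal_density_le_1 by (cases "x = y") (auto intro!: mult_left_le)
qed

lemma measure_normal1_greater: "measure (normal1 m) {z<..} = 1 - Phi (z - m)"
proof -
  interpret real_distribution "normal1 m" by (rule real_distribution_normal1)
  have "emeasure (normal1 m) {..z} = (\<integral>\<^sup>+x. ennreal (\<phi> (x - m)) * indicator {..z} x \<partial>lborel)"
    unfolding normal1_def by (subst emeasure_density) (simp_all add: normal_density_def)
  also have "\<dots> = (\<integral>\<^sup>+x. ennreal (\<phi> x) * indicator {..z - m} x \<partial>lborel)"
    by (subst nn_integral_real_affine[where c = 1 and t = m])
       (auto intro!: nn_integral_cong simp: indicator_def)
  also have "\<dots> = emeasure (normal1 0) {..z - m}"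
    unfolding normal1_def by (subst emeasure_density) auto
  finally have "measure (normal1 m) {..z} = Phi (z - m)"
    by (simp add: measure_def Phi_def)
  moreover have "{z<..} = space (normal1 m) - {..z}" by auto
  ultimately show ?thesis using prob_compl[of "{..z}"] by simp
qed

text \<open>The sum \<open>Phi (- x) + Phi x\<close> has derivative \<open>0\<close>, and its limit
  at infinity is \<open>1\<close>.\<close>

lemma Phi_uminus: "Phi (- x) = 1 - Phi x"
proof -
  have "((\<lambda>x. Phi (- x) + Phi x) has_real_derivative 0) (at x)" for x
    by (rule derivative_eq_intros DERIV_Phi refl | simp)+
  then have c: "Phi (- x) + Phi x = Phi (- y) + Phi y" for x y
    using DERIV_isconst_all by metis
  have "((\<lambda>y. Phi (- y) + Phi y) \<longlongrightarrow> 0 + 1) at_top"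
    by (intro tendsto_add Phi_tendsto_1 filterlim_compose[OF Phi_tendsto_0] filterlim_uminus_at_bot_at_top)
  also have "(\<lambda>y. Phi (- y) + Phi y) = (\<lambda>y. Phi (- x) + Phi x)"
    by (intro ext c)
  finally show ?thesis
    by (simp add: tendsto_const_iff)
qed

lemma Phi_Phi_inv:
  assumes "0 < p" "p < 1"
  shows "Phi (Phi_inv p) = p"
proof -
  obtain a where a: "Phi a < p"
    using order_tendstoD(2)[OF Phi_tendsto_0 assms(1)] by (auto simp: eventually_at_bot_linorder)
  obtain b where b: "Phi b > p"
    using order_tendstoD(1)[OF Phi_tendsto_1 assms(2)] by (auto simp: eventually_at_top_linorder)
  have "a \<le> b" using a b Phi_mono[of b a] by linarith
  then obtain x where x: "Phi x = p"
    using IVT'[of Phi a p b] a b by (auto intro!: continuous_at_imp_continuous_on isCont_Phi)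
  show ?thesis unfolding Phi_inv_def
  proof (rule theI)
    show "Phi x = p" by fact
    show "y = x" if "Phi y = p" for y
      using Phi_strict_mono[of x y] Phi_strict_mono[of y x] x that by (cases y x rule: linorder_cases) auto
  qed
qed

lemma Phi_inv_Phi: "Phi_inv (Phi x) = x"
proof -
  have "Phi (Phi_inv (Phi x)) = Phi x"
    by (rule Phi_Phi_inv) (auto simp: Phi_gt_0 Phi_less_1)
  then show ?thesis
    using Phi_strict_mono by (metis linorder_neqE_linordered_idom less_irrefl)
qed

text \<open>\<open>z\<close> is the threshold of the one-sided test \<open>{z<..}\<close> of level
  \<open>a\<close>; the same \<open>z\<close> serves every shift \<open>m\<close>.\<close>

lemma Phi_quantile:
  assumes "0 < a" "a < 1"
  obtains z where "Phi z = 1 - a" "\<And>m. G m a = Phi (z - m)"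
  using Phi_Phi_inv[of "1 - a"] assms by (auto simp: G_def intro!: that[of "Phi_inv (1 - a)"])

text \<open>The next two bounds express \<open>E (Z - x)\<^sub>+ \<ge> 0\<close> and \<open>E ((Z - x)\<^sub>+)\<^sup>2 \<ge> 0\<close> for a standard
  normal \<open>Z\<close>.\<close>

lemma Phi_tail_bound1: "x * (1 - Phi x) \<le> \<phi> x"
proof -
  \<comment> \<open>An antiderivative of \<open>(z - x) * \<phi> z\<close>; its increment from
    \<open>x\<close> to infinity is \<open>E (Z - x)_+\<close>.\<close>
  define F where "F z = - \<phi> z - x * Phi z" for z
  have "(F has_real_derivative (z - x) * \<phi> z) (at z)" for z
    unfolding F_def by (rule derivative_eq_intros DERIV_Phi refl | simp add: algebra_simps)+
  then have "F x \<le> F y" if "x \<le> y" for y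
    using that by (intro DERIV_nonneg_imp_nondecreasing[of x y F]) (auto intro!: exI)
  then have "eventually (\<lambda>y. F x \<le> F y) at_top"
    by (auto simp: eventually_at_top_linorder)
  moreover have "(F \<longlongrightarrow> - 0 - x * 1) at_top"
    unfolding F_def by (intro tendsto_intros std_normal_density_tendsto_0_at_top Phi_tendsto_1)
  ultimately have "F x \<le> - 0 - x * 1"
    using tendsto_lowerbound trivial_limit_at_top_linorder by blast
  then show ?thesis by (simp add: F_def algebra_simps)
qed

lemma Phi_tail_bound2: "x * \<phi> x \<le> (1 + x\<^sup>2) * (1 - Phi x)"
proof -
  \<comment> \<open>An antiderivative of \<open>(z - x)^2 * \<phi> z\<close>; its increment from
    \<open>x\<close> to infinity is the second moment of \<open>(Z - x)_+\<close>.\<close>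
  define F where "F z = (1 + x\<^sup>2) * Phi z - z * \<phi> z + 2 * x * \<phi> z" for z
  have "(F has_real_derivative (z - x)\<^sup>2 * \<phi> z) (at z)" for z
    unfolding F_def by (rule derivative_eq_intros DERIV_Phi refl | simp add: algebra_simps power2_eq_square)+
  then have "F x \<le> F y" if "x \<le> y" for y
    using that by (intro DERIV_nonneg_imp_nondecreasing[of x y F]) (auto intro!: exI)
  then have "eventually (\<lambda>y. F x \<le> F y) at_top"
    by (auto simp: eventually_at_top_linorder)
  moreover have "(F \<longlongrightarrow> (1 + x\<^sup>2) * 1 - 0 + 2 * x * 0) at_top"
    unfolding F_def by (intro tendsto_intros std_normal_density_tendsto_0_at_top Phi_tendsto_1
      std_normal_density_mult_tendsto_0_at_top)
  ultimately have "F x \<le> (1 + x\<^sup>2) * 1 - 0 + 2 * x * 0"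
    using tendsto_lowerbound trivial_limit_at_top_linorder by blast
  then show ?thesis by (simp add: F_def algebra_simps)
qed

text \<open>Closed form of \<open>E (Z - x)_+\<close> for a standard normal \<open>Z\<close>, as
  \<open>gauss_hinge_integral\<close> confirms.\<close>

definition gauss_hinge :: "real \<Rightarrow> real" where
  "gauss_hinge x = \<phi> x - x * (1 - Phi x)"

lemma nn_integral_gauss_hinge:
  "(\<integral>\<^sup>+z. ennreal (max 0 (z - x)) \<partial>normal1 0) = ennreal (gauss_hinge x)"
proof -
  define F where "F z = - \<phi> z - x * Phi z" for z
  have *: "(F has_real_derivative (z - x) * \<phi> z) (at z)" for z
    unfolding F_def by (rule derivative_eq_intros DERIV_Phi refl | simp add: algebra_simps)+
  have lim: "(F \<longlongrightarrow> - 0 - x * 1) at_top"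
    unfolding F_def by (intro tendsto_intros std_normal_density_tendsto_0_at_top Phi_tendsto_1)
  have "(\<integral>\<^sup>+z. ennreal (max 0 (z - x)) \<partial>normal1 0) = (\<integral>\<^sup>+z. ennreal (\<phi> z) * ennreal (max 0 (z - x)) \<partial>lborel)"
    unfolding normal1_def by (subst nn_integral_density) auto
  also have "\<dots> = (\<integral>\<^sup>+z\<in>{x..}. ennreal ((z - x) * \<phi> z) \<partial>lborel)"
    by (intro nn_integral_cong)
       (auto simp: indicator_def max_def mult.commute simp flip: ennreal_mult' split: if_splits)
  also have "\<dots> = ennreal ((- 0 - x * 1) - F x)"
    by (rule nn_integral_FTC_atLeast[OF _ * _ lim]) auto
  finally show ?thesis by (simp add: F_def gauss_hinge_def algebra_simps)
qed

lemma gauss_hinge_nonneg: "0 \<le> gauss_hinge x"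
  using Phi_tail_bound1[of x] by (simp add: gauss_hinge_def)

lemma gauss_hinge_integral:
  "(\<integral>z. max 0 (z - x) \<partial>normal1 0) = gauss_hinge x"
  "integrable (normal1 0) (\<lambda>z. max 0 (z - x))"
proof -
  have "has_bochner_integral (normal1 0) (\<lambda>z. max 0 (z - x)) (gauss_hinge x)"
    by (rule has_bochner_integral_nn_integral[OF _ _ _ nn_integral_gauss_hinge])
       (auto simp: gauss_hinge_nonneg)
  then show "(\<integral>z. max 0 (z - x) \<partial>normal1 0) = gauss_hinge x"
    "integrable (normal1 0) (\<lambda>z. max 0 (z - x))"
    by (auto simp: has_bochner_integral_iff)
qed

text \<open>Reflection: \<open>(z + x)_+ - (- z - x)_+ = z + x\<close>, and \<open>Z\<close> is
  symmetric with mean \<open>0\<close>. It reduces later estimates to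
  \<open>0 \<le> x\<close>.\<close>

lemma gauss_hinge_uminus: "gauss_hinge (- x) = x + gauss_hinge x"
  by (simp add: gauss_hinge_def Phi_uminus algebra_simps)

section \<open>Stein's equation for the hinge function\<close>

lemma std_normal_density_neq_0 [simp]: "\<phi> x \<noteq> 0"
  using std_normal_density_pos[of x] by linarith

definition mills :: "real \<Rightarrow> real" where
  "mills w = (1 - Phi w) / \<phi> w"

text \<open>So \<open>mills\<close> solves \<open>f' w - w * f w = -1\<close>, and
  \<open>mills (- w)\<close> solves it with right-hand side \<open>1\<close>: these are the building
  blocks of the Stein solution.\<close>

lemma DERIV_mills: "(mills has_real_derivative w * mills w - 1) (at w)"
  unfolding mills_def
  by (rule derivative_eq_intros DERIV_Phi refl
      | simp add: field_simps power2_eq_square)+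

lemmas DERIV_mills' [derivative_intros] = DERIV_chain2[OF DERIV_mills]

lemma mills_nonneg: "0 \<le> mills w"
  by (simp add: mills_def Phi_le_1)

lemma mills_le: "mills w \<le> 1 / \<phi> w"
  by (simp add: mills_def Phi_ge_0 divide_right_mono)

lemma mult_mills_le_1: "w * mills w \<le> 1"
  using Phi_tail_bound1[of w] by (simp add: mills_def field_simps)

lemma mills_lower: "w \<le> (1 + w\<^sup>2) * mills w"
  using Phi_tail_bound2[of w] by (simp add: mills_def field_simps)

lemma mills_antimono: "u \<le> w \<Longrightarrow> mills w \<le> mills u"
  by (rule DERIV_nonpos_imp_nonincreasing[of u w mills])
     (auto intro!: exI DERIV_mills simp: mult_mills_le_1)

lemma mills_add_uminus: "mills w + mills (- w) = 1 / \<phi> w"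
  by (simp add: mills_def Phi_uminus flip: add_divide_distrib)

lemma gauss_hinge_eq_mills: "gauss_hinge x = \<phi> x * (1 - x * mills x)"
  by (simp add: gauss_hinge_def mills_def right_diff_distrib diff_divide_distrib)

lemma gauss_hinge_le:
  assumes "0 \<le> x" shows "gauss_hinge x \<le> \<phi> x / (1 + x\<^sup>2)"
proof -
  have "x * x \<le> x * ((1 + x\<^sup>2) * mills x)"
    using mills_lower assms by (rule mult_left_mono)
  then have "(1 - x * mills x) * (1 + x\<^sup>2) \<le> 1"
    by (simp add: algebra_simps power2_eq_square)
  then have "1 - x * mills x \<le> 1 / (1 + x\<^sup>2)"
    by (simp add: pos_le_divide_eq add_pos_nonneg)
  then show ?thesis
    using mult_left_mono[of _ _ "\<phi> x"] by (fastforce simp: gauss_hinge_eq_mills)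
qed

text \<open>The expression inside the absolute value is the second derivative of
  \<open>mills\<close>, hence up to a factor that of the Stein solution on either side of its
  kink.\<close>

lemma mills_deriv2_bound_nonneg:
  assumes "0 \<le> w" shows "\<bar>(1 + w\<^sup>2) * mills w - w\<bar> \<le> mills w"
proof -
  have "w * (w * mills w) \<le> w * 1"
    using mult_mills_le_1 assms by (rule mult_left_mono)
  then show ?thesis
    using mills_lower[of w] by (simp add: algebra_simps power2_eq_square)
qed

text \<open>On negative arguments \<open>mills\<close> grows like \<open>1 / \<phi>\<close>. The
  bound depends on the radius \<open>y\<close> and is later compensated by the small factor
  \<open>gauss_hinge x\<close>.\<close>

lemma mills_deriv2_bound:
  assumes "\<bar>w\<bar> \<le> y" shows "\<bar>(1 + w\<^sup>2) * mills w - w\<bar> \<le> (1 + y\<^sup>2) / \<phi> y + y"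
proof -
  have "mills w \<le> 1 / \<phi> y"
    using mills_le[of w] std_normal_density_antimono[of w y] assms
    by (meson abs_ge_self divide_left_mono mult_pos_pos order_trans std_normal_density_pos zero_le_one)
  moreover have "w\<^sup>2 \<le> y\<^sup>2"
    using assms by (metis abs_ge_zero power2_abs power_mono)
  ultimately have "(1 + w\<^sup>2) * mills w \<le> (1 + y\<^sup>2) * (1 / \<phi> y)"
    by (intro mult_mono) (auto simp: mills_nonneg)
  then show ?thesis using mills_lower[of w] assms by auto
qed

text \<open>The solution of Stein's equation \<open>f' w - w f w = (w - x)\<^sub>+ - E (Z - x)\<^sub>+\<close>.\<close>

definition stein_sol :: "real \<Rightarrow> real \<Rightarrow> real" where
  "stein_sol x w = (if w \<le> x then - gauss_hinge x * mills (- w)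
                    else gauss_hinge (- x) * mills w - 1)"

definition stein_deriv :: "real \<Rightarrow> real \<Rightarrow> real" where
  "stein_deriv x w = (if w \<le> x then gauss_hinge x * ((- w) * mills (- w) - 1)
                      else gauss_hinge (- x) * (w * mills w - 1))"

text \<open>Continuity at the kink. The two branches meet because the subtracted constant in Stein's
  equation is the Gaussian mean \<open>gauss_hinge x\<close>; the identity behind it is
  \<open>mills x + mills (- x) = 1 / \<phi> x\<close>.\<close>

lemma stein_sol_match: "- gauss_hinge x * mills (- x) = gauss_hinge (- x) * mills x - 1"
proof -
  have "gauss_hinge x * (mills x + mills (- x)) = 1 - x * mills x"
    unfolding mills_add_uminus by (simp add: gauss_hinge_eq_mills)
  then show ?thesis by (simp add: gauss_hinge_uminus algebra_simps)
qed

lemma stein_deriv_match: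
  "gauss_hinge x * ((- x) * mills (- x) - 1) = gauss_hinge (- x) * (x * mills x - 1)"
  unfolding gauss_hinge_eq_mills by (simp add: algebra_simps)

lemma stein_equation: "stein_deriv x w - w * stein_sol x w = max 0 (w - x) - gauss_hinge x"
  by (auto simp: stein_deriv_def stein_sol_def gauss_hinge_uminus max_def algebra_simps)

section \<open>Regularity of the Stein solution across its kink\<close>

lemma DERIV_If_le:
  fixes g h :: "real \<Rightarrow> real"
  assumes g: "\<And>w. (g has_real_derivative g' w) (at w)"
    and h: "\<And>w. (h has_real_derivative h' w) (at w)"
    and match: "g x = h x" "g' x = h' x"
  shows "((\<lambda>w. if w \<le> x then g w else h w) has_real_derivative (if w \<le> x then g' w else h' w)) (at w)"
    (is "(?f has_real_derivative ?f' w) (at w)")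
proof (cases w x rule: linorder_cases)
  case less
  then show ?thesis
    using has_field_derivative_transform_within_open[OF g[of w], of "{..<x}" ?f] by auto
next
  case greater
  then show ?thesis
    using has_field_derivative_transform_within_open[OF h[of w], of "{x<..}" ?f] by auto
next
  case equal
  have "((\<lambda>y. (g y - g x) / (y - x)) \<longlongrightarrow> g' x) (at_left x)"
    using g[of x] unfolding has_field_derivative_iff by (rule filterlim_mono) (auto simp: at_le)
  then have "((\<lambda>y. (?f y - ?f x) / (y - x)) \<longlongrightarrow> g' x) (at_left x)"
    by (rule Lim_transform_eventually) (auto simp: eventually_at_filter)
  moreover have "((\<lambda>y. (h y - h x) / (y - x)) \<longlongrightarrow> g' x) (at_right x)"
    using h[of x] unfolding has_field_derivative_iff match by (rule filterlim_mono) (auto simp: at_le)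
  then have "((\<lambda>y. (?f y - ?f x) / (y - x)) \<longlongrightarrow> g' x) (at_right x)"
    by (rule Lim_transform_eventually) (auto simp: eventually_at_filter match)
  ultimately show ?thesis
    unfolding has_field_derivative_iff equal using filterlim_split_at by auto
qed

lemma DERIV_stein_sol: "(stein_sol x has_real_derivative stein_deriv x w) (at w)"
proof -
  have "((\<lambda>w. if w \<le> x then - gauss_hinge x * mills (- w) else gauss_hinge (- x) * mills w - 1)
      has_real_derivative (if w \<le> x then gauss_hinge x * ((- w) * mills (- w) - 1)
        else gauss_hinge (- x) * (w * mills w - 1))) (at w)"
    by (intro DERIV_If_le stein_sol_match stein_deriv_match)
       (auto intro!: derivative_eq_intros simp: algebra_simps)
  then show ?thesis by (simp add: stein_sol_def[abs_def] stein_deriv_def)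
qed

lemma DERIV_lipschitz:
  fixes f :: "real \<Rightarrow> real"
  assumes "\<And>w. (f has_real_derivative f' w) (at w)" "a \<le> b" "\<And>w. a \<le> w \<Longrightarrow> w \<le> b \<Longrightarrow> \<bar>f' w\<bar> \<le> C"
  shows "\<bar>f b - f a\<bar> \<le> C * (b - a)"
proof (cases "a = b")
  case False
  then obtain z where z: "a < z" "z < b" "f b - f a = (b - a) * f' z"
    using MVT2[of a b f f'] assms by auto
  then show ?thesis
    using assms(3)[of z] False \<open>a \<le> b\<close> by (simp add: abs_mult mult.commute mult_right_mono)
qed simp

text \<open>The derivative is continuous but has a corner at \<open>x\<close>, so the mean value
  theorem is applied on each side and the pieces are joined at \<open>x\<close>. The cutoff
  \<open>y\<close> allows a better constant on a half-line that stays away from the kink.\<close>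

lemma stein_deriv_lipschitz_pieces:
  assumes left: "\<And>w. w \<le> min x y \<Longrightarrow> gauss_hinge x * \<bar>(1 + w\<^sup>2) * mills (- w) + w\<bar> \<le> C"
    and right: "\<And>w. x \<le> w \<Longrightarrow> w \<le> y \<Longrightarrow> gauss_hinge (- x) * \<bar>(1 + w\<^sup>2) * mills w - w\<bar> \<le> C"
    and ab: "a \<le> b" "b \<le> y"
  shows "\<bar>stein_deriv x b - stein_deriv x a\<bar> \<le> C * (b - a)"
proof -
  have L: "\<bar>stein_deriv x d - stein_deriv x c\<bar> \<le> C * (d - c)" if "c \<le> d" "d \<le> x" "d \<le> y" for c d
  proof -
    have "((\<lambda>w. gauss_hinge x * ((- w) * mills (- w) - 1)) has_real_derivative
        - (gauss_hinge x * ((1 + w\<^sup>2) * mills (- w) + w))) (at w)" for w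
      by (rule derivative_eq_intros refl | simp add: algebra_simps power2_eq_square)+
    from DERIV_lipschitz[OF this \<open>c \<le> d\<close>, of C] show ?thesis
      using left that by (simp add: stein_deriv_def abs_mult gauss_hinge_nonneg)
  qed
  have R: "\<bar>stein_deriv x d - stein_deriv x c\<bar> \<le> C * (d - c)" if "c \<le> d" "x \<le> c" "d \<le> y" for c d
  proof -
    have *: "stein_deriv x w = gauss_hinge (- x) * (w * mills w - 1)" if "x \<le> w" for w
      using that stein_deriv_match[of x] by (auto simp: stein_deriv_def)
    have "((\<lambda>w. gauss_hinge (- x) * (w * mills w - 1)) has_real_derivative
        gauss_hinge (- x) * ((1 + w\<^sup>2) * mills w - w)) (at w)" for w
      by (rule derivative_eq_intros refl | simp add: algebra_simps power2_eq_square)+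
    from DERIV_lipschitz[OF this \<open>c \<le> d\<close>, of C] show ?thesis
      using right that by (simp add: * abs_mult gauss_hinge_nonneg)
  qed
  consider "b \<le> x" | "x \<le> a" | "a \<le> x" "x \<le> b" using ab by linarith
  then show ?thesis
  proof cases
    case 3
    have "\<bar>stein_deriv x b - stein_deriv x a\<bar> \<le> C * (b - x) + C * (x - a)"
      using L[of a x] R[of x b] 3 ab by linarith
    then show ?thesis by (simp add: algebra_simps)
  qed (use L R ab in auto)
qed

text \<open>For \<open>w \<le> 0\<close> the factor \<open>gauss_hinge x\<close> alone supplies the
  decay; for \<open>0 < w \<le> y\<close> it competes with the growth \<open>1 / \<phi> y\<close>.
  The choice \<open>y = x\<close> makes the quotient \<open>1\<close>, and \<open>y = x / 2\<close>
  makes it tiny.\<close>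

lemma stein_deriv_bound_left:
  assumes x: "0 \<le> x" and y: "0 \<le> y" "y \<le> x" and w: "w \<le> y"
  shows "gauss_hinge x * \<bar>(1 + w\<^sup>2) * mills (- w) + w\<bar>
    \<le> \<phi> x / \<phi> y + (2 + 2 * mills 0) / (1 + x)"
proof -
  have hx: "gauss_hinge x \<le> 1 / (1 + x\<^sup>2)"
    using gauss_hinge_le[OF x] std_normal_density_le_1[of x]
    by (meson add_nonneg_nonneg divide_right_mono order_trans zero_le_one zero_le_power2)
  have pos: "0 < 1 + x\<^sup>2" by (simp add: add_pos_nonneg)
  have "2 * x \<le> 1 + x\<^sup>2"
    using zero_le_power2[of "x - 1"] by (simp add: power2_diff)
  then have "1 + x \<le> 2 * (1 + x\<^sup>2)" "x + x\<^sup>2 \<le> 2 * (1 + x\<^sup>2)"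
    using zero_le_power2[of x] x by (smt (verit))+
  then have h0: "1 / (1 + x\<^sup>2) \<le> 2 / (1 + x)" "x / (1 + x\<^sup>2) \<le> 2 / (1 + x)"
    using x pos by (simp_all add: divide_simps algebra_simps power2_eq_square)
  show ?thesis
  proof (cases "w \<le> 0")
    case True
    then have "\<bar>(1 + w\<^sup>2) * mills (- w) + w\<bar> \<le> mills 0"
      using mills_deriv2_bound_nonneg[of "- w"] mills_antimono[of 0 "- w"] by simp
    then have "gauss_hinge x * \<bar>(1 + w\<^sup>2) * mills (- w) + w\<bar> \<le> gauss_hinge x * mills 0"
      by (intro mult_left_mono gauss_hinge_nonneg)
    also have "\<dots> \<le> 2 / (1 + x) * mills 0"
      using hx h0 by (intro mult_right_mono mills_nonneg) linarith
    also have "\<dots> \<le> \<phi> x / \<phi> y + (2 + 2 * mills 0) / (1 + x)"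
      using x by (simp add: add_divide_distrib add_nonneg_nonneg)
    finally show ?thesis .
  next
    case False
    then have "\<bar>(1 + w\<^sup>2) * mills (- w) + w\<bar> \<le> (1 + y\<^sup>2) / \<phi> y + y"
      using mills_deriv2_bound[of "- w" y] w by simp
    then have "gauss_hinge x * \<bar>(1 + w\<^sup>2) * mills (- w) + w\<bar> \<le> gauss_hinge x * ((1 + y\<^sup>2) / \<phi> y + y)"
      by (intro mult_left_mono gauss_hinge_nonneg)
    also have "\<dots> = gauss_hinge x * ((1 + y\<^sup>2) / \<phi> y) + gauss_hinge x * y"
      by (simp add: distrib_left)
    also have "gauss_hinge x * ((1 + y\<^sup>2) / \<phi> y) \<le> \<phi> x / (1 + x\<^sup>2) * ((1 + x\<^sup>2) / \<phi> y)"
      using x y by (intro mult_mono gauss_hinge_le divide_right_mono add_left_mono power_mono) auto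
    also have "\<dots> = \<phi> x / \<phi> y"
      using sum_power2_gt_zero_iff[of 1 x] by (simp add: add_pos_nonneg less_imp_neq[symmetric])
    also have "gauss_hinge x * y \<le> 1 / (1 + x\<^sup>2) * x"
      using hx y x by (intro mult_mono) auto
    also have "\<dots> \<le> 2 / (1 + x)"
      using h0 by simp
    also have "\<dots> \<le> (2 + 2 * mills 0) / (1 + x)"
      using x mills_nonneg[of 0] by (intro divide_right_mono) auto
    finally show ?thesis by simp
  qed
qed

text \<open>Here \<open>gauss_hinge (- x)\<close> grows like \<open>x\<close>, which is balanced by
  \<open>x * mills x \<le> 1\<close>.\<close>

lemma stein_deriv_bound_right:
  assumes x: "0 \<le> x" and w: "x \<le> w"
  shows "gauss_hinge (- x) * \<bar>(1 + w\<^sup>2) * mills w - w\<bar> \<le> 1 + mills 0"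
proof -
  have "\<bar>(1 + w\<^sup>2) * mills w - w\<bar> \<le> mills x"
    using mills_deriv2_bound_nonneg[of w] mills_antimono[OF w] x w by linarith
  then have "gauss_hinge (- x) * \<bar>(1 + w\<^sup>2) * mills w - w\<bar> \<le> gauss_hinge (- x) * mills x"
    by (intro mult_left_mono gauss_hinge_nonneg)
  also have "\<dots> = x * mills x + gauss_hinge x * mills x"
    by (simp add: gauss_hinge_uminus distrib_right)
  also have "gauss_hinge x \<le> \<phi> x"
  proof -
    have "0 \<le> x * mills x" using x mills_nonneg by simp
    then show ?thesis by (simp add: gauss_hinge_eq_mills mult_left_le)
  qed
  then have "gauss_hinge x * mills x \<le> 1 * mills 0"
    using std_normal_density_le_1[of x] x
    by (intro mult_mono mills_antimono mills_nonneg) auto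
  finally show ?thesis using mult_mills_le_1[of x] by linarith
qed

text \<open>The quotient is \<open>exp (- 3 x^2 / 8)\<close>; only decay of order
  \<open>1 / (1 + x)\<close> is kept.\<close>

lemma std_normal_density_ratio_half:
  assumes "0 \<le> x" shows "\<phi> x / \<phi> (x / 2) \<le> 4 / (1 + x)"
proof -
  have "\<phi> x / \<phi> (x / 2) = exp (- (3 * x\<^sup>2 / 8))"
    unfolding normal_density_def by (simp add: power_divide field_simps flip: exp_add)
  also have "\<dots> = 1 / exp (3 * x\<^sup>2 / 8)"
    by (simp add: exp_minus inverse_eq_divide)
  also have "\<dots> \<le> 1 / (1 + 3 * x\<^sup>2 / 8)"
    using exp_ge_add_one_self[of "3 * x\<^sup>2 / 8"]
    by (intro divide_left_mono) (auto intro!: mult_pos_pos add_pos_nonneg)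
  also have "\<dots> \<le> 4 / (1 + x)"
  proof -
    have "2 * x \<le> 1 + x\<^sup>2"
      using zero_le_power2[of "x - 1"] by (simp add: power2_diff)
    then have "1 + x \<le> 4 * (1 + 3 * x\<^sup>2 / 8)"
      using zero_le_power2[of x] by argo
    then show ?thesis using assms by (simp add: divide_simps add_pos_nonneg)
  qed
  finally show ?thesis .
qed

text \<open>The weight \<open>1 / (1 + x)\<close> is the source of the non-uniform error bound: away from
  the kink at \<open>x\<close> the second derivative of the Stein solution is small.\<close>

definition stein_const :: real where
  "stein_const = 12 + 8 * mills 0"

lemma stein_const_nonneg: "0 \<le> stein_const"
  using mills_nonneg[of 0] by (simp add: stein_const_def)

text \<open>A segment to the left of \<open>x / 2\<close> enjoys the small constant
  \<open>loc\<close>. Any other segment has only the global constant \<open>glob\<close>, but it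
  reaches points comparable to \<open>x\<close>, and the growth factor \<open>1 + |w| + |v|\<close>
  pays for the weight. That factor is later integrated against moments.\<close>

lemma stein_deriv_weighted_lipschitz:
  assumes x: "0 \<le> x"
  shows "\<bar>stein_deriv x (w + v) - stein_deriv x w\<bar>
    \<le> stein_const / (1 + x) * (1 + \<bar>w\<bar> + \<bar>v\<bar>) * \<bar>v\<bar>"
proof -
  have glob: "\<bar>stein_deriv x b - stein_deriv x a\<bar> \<le> (3 + 2 * mills 0) * (b - a)" if "a \<le> b" for a b
  proof (rule stein_deriv_lipschitz_pieces[of x b])
    fix w :: real assume "w \<le> min x b"
    then have "gauss_hinge x * \<bar>(1 + w\<^sup>2) * mills (- w) + w\<bar> \<le> 1 + (2 + 2 * mills 0) / (1 + x)"
      using stein_deriv_bound_left[of x x w] x by simp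
    also have "(2 + 2 * mills 0) / (1 + x) \<le> (2 + 2 * mills 0) / 1"
      using x mills_nonneg[of 0] by (intro divide_left_mono) auto
    finally show "gauss_hinge x * \<bar>(1 + w\<^sup>2) * mills (- w) + w\<bar> \<le> 3 + 2 * mills 0" by simp
  next
    fix w assume "x \<le> w"
    then show "gauss_hinge (- x) * \<bar>(1 + w\<^sup>2) * mills w - w\<bar> \<le> 3 + 2 * mills 0"
      using stein_deriv_bound_right[OF x, of w] mills_nonneg[of 0] by linarith
  qed (use that in auto)
  have loc: "\<bar>stein_deriv x b - stein_deriv x a\<bar> \<le> (6 + 2 * mills 0) / (1 + x) * (b - a)"
    if "a \<le> b" "b \<le> x / 2" "0 < x" for a b
  proof (rule stein_deriv_lipschitz_pieces[of x "x / 2"])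
    fix w :: real assume "w \<le> min x (x / 2)"
    then have "gauss_hinge x * \<bar>(1 + w\<^sup>2) * mills (- w) + w\<bar>
        \<le> \<phi> x / \<phi> (x / 2) + (2 + 2 * mills 0) / (1 + x)"
      using stein_deriv_bound_left[of x "x / 2" w] x by simp
    also have "\<dots> \<le> 4 / (1 + x) + (2 + 2 * mills 0) / (1 + x)"
      using std_normal_density_ratio_half[OF x] by simp
    finally show "gauss_hinge x * \<bar>(1 + w\<^sup>2) * mills (- w) + w\<bar> \<le> (6 + 2 * mills 0) / (1 + x)"
      by (simp add: add_divide_distrib)
  qed (use that in auto)
  define a b where "a = min w (w + v)" and "b = max w (w + v)"
  have ab: "a \<le> b" "b - a = \<bar>v\<bar>"
    "\<bar>stein_deriv x (w + v) - stein_deriv x w\<bar> = \<bar>stein_deriv x b - stein_deriv x a\<bar>"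
    by (auto simp: a_def b_def min_def max_def)
  show "\<bar>stein_deriv x (w + v) - stein_deriv x w\<bar> \<le> stein_const / (1 + x) * (1 + \<bar>w\<bar> + \<bar>v\<bar>) * \<bar>v\<bar>"
  proof (cases "0 < x \<and> b \<le> x / 2")
    case True
    then have "\<bar>stein_deriv x b - stein_deriv x a\<bar> \<le> (6 + 2 * mills 0) / (1 + x) * \<bar>v\<bar>"
      using loc[of a b] ab by simp
    also have "\<dots> \<le> (stein_const / (1 + x) * (1 + \<bar>w\<bar> + \<bar>v\<bar>)) * \<bar>v\<bar>"
    proof (rule mult_right_mono)
      have "(6 + 2 * mills 0) / (1 + x) * 1 \<le> stein_const / (1 + x) * (1 + \<bar>w\<bar> + \<bar>v\<bar>)"
        using x mills_nonneg[of 0] by (intro mult_mono divide_right_mono) (auto simp: stein_const_def)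
      then show "(6 + 2 * mills 0) / (1 + x) \<le> stein_const / (1 + x) * (1 + \<bar>w\<bar> + \<bar>v\<bar>)" by simp
    qed simp
    finally show ?thesis using ab by simp
  next
    case False
    \<comment> \<open>Hence \<open>1 + x \<le> 4 * (1 + |w| + |v|)\<close>, and
      \<open>4 * (3 + 2 * mills 0)\<close> is the value of \<open>stein_const\<close>.\<close>
    then have "x \<le> 2 * (\<bar>w\<bar> + \<bar>v\<bar>)"
      using x by (auto simp: b_def max_def split: if_splits)
    then have "(3 + 2 * mills 0) * (1 + x) \<le> (3 + 2 * mills 0) * (4 * (1 + \<bar>w\<bar> + \<bar>v\<bar>))"
      using mills_nonneg[of 0] by (intro mult_left_mono) auto
    also have "\<dots> \<le> stein_const * (1 + \<bar>w\<bar> + \<bar>v\<bar>)"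
      unfolding mult.assoc[symmetric] using mills_nonneg[of 0] by (intro mult_right_mono) (auto simp: stein_const_def)
    finally have "(3 + 2 * mills 0) \<le> stein_const / (1 + x) * (1 + \<bar>w\<bar> + \<bar>v\<bar>)"
      using x by (simp add: field_simps)
    then have "(3 + 2 * mills 0) * \<bar>v\<bar> \<le> stein_const / (1 + x) * (1 + \<bar>w\<bar> + \<bar>v\<bar>) * \<bar>v\<bar>"
      by (rule mult_right_mono) simp
    then show ?thesis using glob[OF ab(1)] ab by simp
  qed
qed

text \<open>Serves integrability only, so \<open>B\<close> may depend on \<open>x\<close>. By
  monotonicity of \<open>mills\<close> both branches are extremal at the kink.\<close>

lemma stein_sol_bounded:
  assumes "0 \<le> x" obtains B where "\<And>w. \<bar>stein_sol x w\<bar> \<le> B"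
proof
  fix w :: real
  have "\<bar>gauss_hinge x * mills (- w)\<bar> \<le> gauss_hinge x * mills (- x)" if "w \<le> x"
    using that by (auto simp: abs_mult gauss_hinge_nonneg mills_nonneg intro!: mult_left_mono mills_antimono)
  moreover have "\<bar>gauss_hinge (- x) * mills w\<bar> \<le> gauss_hinge (- x) * mills x" if "x \<le> w"
    using that by (auto simp: abs_mult gauss_hinge_nonneg mills_nonneg intro!: mult_left_mono mills_antimono)
  moreover have "0 \<le> gauss_hinge x * mills (- x)" "0 \<le> gauss_hinge (- x) * mills x"
    by (auto simp: gauss_hinge_nonneg mills_nonneg)
  ultimately show "\<bar>stein_sol x w\<bar> \<le> gauss_hinge x * mills (- x) + gauss_hinge (- x) * mills x + 1"
    unfolding stein_sol_def by fastforce
qed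

lemma stein_sol_measurable [measurable]: "stein_sol x \<in> borel_measurable borel"
  by (rule borel_measurable_continuous_onI)
     (auto intro: continuous_at_imp_continuous_on DERIV_isCont[OF DERIV_stein_sol])

lemma stein_deriv_eq: "stein_deriv x w = w * stein_sol x w + max 0 (w - x) - gauss_hinge x"
  using stein_equation[of x w] by linarith

lemma stein_deriv_measurable [measurable]: "stein_deriv x \<in> borel_measurable borel"
  unfolding stein_deriv_eq[abs_def] by measurable

section \<open>Trade-off functions and hinge duality\<close>

lemma tradeoff_le:
  assumes "prob_space Q" and sets: "sets Q = sets P" and phi: "phi \<in> borel_measurable P"
    "\<And>x. x \<in> space P \<Longrightarrow> 0 \<le> phi x \<and> phi x \<le> 1" "(\<integral>x. phi x \<partial>P) \<le> a"
  shows "tradeoff P Q a \<le> 1 - (\<integral>x. phi x \<partial>Q)"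
  unfolding tradeoff_def
proof (rule cINF_lower)
  interpret Q: prob_space Q by fact
  have "(\<integral>x. psi x \<partial>Q) \<le> 1"
    if psi: "psi \<in> borel_measurable P" "\<And>x. x \<in> space P \<Longrightarrow> 0 \<le> psi x \<and> psi x \<le> 1" for psi :: "'a \<Rightarrow> real"
  proof -
    have "space Q = space P" using sets by (rule sets_eq_imp_space_eq)
    moreover have "psi \<in> borel_measurable Q" using psi(1) sets by (simp cong: measurable_cong_sets)
    ultimately have "integrable Q psi"
      using psi by (intro Q.integrable_const_bound[of _ 1]) auto
    then show ?thesis
      using psi \<open>space Q = space P\<close> by (intro Q.integral_le_const) auto
  qed
  then show "bdd_below ((\<lambda>phi. 1 - (\<integral>x. phi x \<partial>Q)) ` {phi \<in> borel_measurable P.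
      (\<forall>x\<in>space P. 0 \<le> phi x \<and> phi x \<le> 1) \<and> (\<integral>x. phi x \<partial>P) \<le> a})"
    by (auto intro!: bdd_belowI2[of _ 0])
qed (use phi in auto)

lemma tradeoff_greatest:
  assumes "0 \<le> a" and "\<And>phi. phi \<in> borel_measurable P \<Longrightarrow>
      (\<And>x. x \<in> space P \<Longrightarrow> 0 \<le> phi x \<and> phi x \<le> 1) \<Longrightarrow> (\<integral>x. phi x \<partial>P) \<le> a \<Longrightarrow>
      c \<le> 1 - (\<integral>x. phi x \<partial>Q)"
  shows "c \<le> tradeoff P Q a"
  unfolding tradeoff_def
proof (rule cINF_greatest)
  have "(\<lambda>_. 0) \<in> {phi \<in> borel_measurable P. (\<forall>x\<in>space P. 0 \<le> phi x \<and> phi x \<le> 1) \<and> (\<integral>x. phi x \<partial>P) \<le> a}"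
    using assms(1) by auto
  then show "{phi \<in> borel_measurable P. (\<forall>x\<in>space P. 0 \<le> phi x \<and> phi x \<le> 1) \<and> (\<integral>x. phi x \<partial>P) \<le> a} \<noteq> {}"
    by blast
qed (use assms in auto)

text \<open>Witnessed by the test that ignores the data and rejects with probability
  \<open>a\<close>.\<close>

lemma tradeoff_le_one_minus:
  assumes "prob_space P" "prob_space Q" "sets Q = sets P" "0 \<le> a" "a \<le> 1"
  shows "tradeoff P Q a \<le> 1 - a"
  using tradeoff_le[of Q P "\<lambda>_. a" a] assms by (simp add: prob_space.prob_space)

lemma tradeoff_le_indicator:
  assumes "prob_space Q" "sets Q = sets P" "A \<in> sets P" "measure P A \<le> a"
  shows "tradeoff P Q a \<le> 1 - measure Q A"
proof -
  have "A \<inter> space P = A" "A \<inter> space Q = A"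
    using sets.sets_into_space[OF assms(3)] sets_eq_imp_space_eq[OF assms(2)] by auto
  then show ?thesis
    using tradeoff_le[of Q P "indicator A" a] assms by simp
qed

lemma tradeoff_nonneg:
  assumes "prob_space Q" "sets Q = sets P" "0 \<le> a"
  shows "0 \<le> tradeoff P Q a"
proof (rule tradeoff_greatest[OF assms(3)])
  fix phi :: "'a \<Rightarrow> real"
  interpret Q: prob_space Q by fact
  assume phi: "phi \<in> borel_measurable P" "\<And>x. x \<in> space P \<Longrightarrow> 0 \<le> phi x \<and> phi x \<le> 1"
  have sp: "space Q = space P" using assms(2) by (rule sets_eq_imp_space_eq)
  have "phi \<in> borel_measurable Q" using phi(1) assms(2) by (simp cong: measurable_cong_sets)
  then have "integrable Q phi"
    using phi sp by (intro Q.integrable_const_bound[of _ 1]) auto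
  then have "(\<integral>x. phi x \<partial>Q) \<le> 1"
    using phi sp by (intro Q.integral_le_const) auto
  then show "0 \<le> 1 - (\<integral>x. phi x \<partial>Q)" by simp
qed

text \<open>One setting for the shuffling pair, the Gaussian shift and their products: the
  alternative enters only through its density \<open>L\<close>, so it is absolutely continuous by
  construction.\<close>

locale likelihood_ratio = prob_space P for P :: "'a measure" +
  fixes L :: "'a \<Rightarrow> real"
  assumes L_measurable [measurable]: "L \<in> borel_measurable P"
    and L_nonneg: "0 \<le> L x"
    and nn_integral_L: "(\<integral>\<^sup>+x. ennreal (L x) \<partial>P) = 1"
begin

abbreviation "Q \<equiv> density P (\<lambda>x. ennreal (L x))"

text \<open>For \<open>t \<ge> 0\<close> this is the hockey-stick divergence of order
  \<open>t\<close>, the largest value of \<open>E_Q phi - t * E_P phi\<close> over all tests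
  \<open>phi\<close>.\<close>

definition hinge :: "real \<Rightarrow> real" where
  "hinge t = (\<integral>x. max 0 (L x - t) \<partial>P)"

lemma prob_space_Q: "prob_space Q"
  by (rule prob_spaceI) (simp add: emeasure_density nn_integral_L cong: nn_integral_cong_simp)

lemma integrable_L: "integrable P L" and integral_L: "(\<integral>x. L x \<partial>P) = 1"
proof -
  have "has_bochner_integral P L 1"
    by (rule has_bochner_integral_nn_integral) (auto simp: L_nonneg nn_integral_L)
  then show "integrable P L" "(\<integral>x. L x \<partial>P) = 1"
    by (auto simp: has_bochner_integral_iff)
qed

lemma integrable_hinge: "integrable P (\<lambda>x. max 0 (L x - t))"
  using integrable_L by simp

lemma hinge_nonneg: "0 \<le> hinge t"
  unfolding hinge_def by (rule integral_nonneg_AE) auto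

lemma hinge_le_1: "0 \<le> t \<Longrightarrow> hinge t \<le> 1"
  unfolding hinge_def integral_L[symmetric]
  by (rule integral_mono) (auto simp: integrable_hinge integrable_L L_nonneg)

lemma nn_integral_hinge: "(\<integral>\<^sup>+x. ennreal (max 0 (L x - t)) \<partial>P) = ennreal (hinge t)"
  unfolding hinge_def by (rule nn_integral_eq_integral) (auto simp: integrable_hinge)

lemma integral_Q: "f \<in> borel_measurable P \<Longrightarrow> (\<integral>x. f x \<partial>Q) = (\<integral>x. L x * f x \<partial>P)" for f :: "'a \<Rightarrow> real"
  by (subst integral_density) (auto simp: L_nonneg)

lemma integrable_L_mult:
  assumes [measurable]: "phi \<in> borel_measurable P" and phi: "\<And>x. x \<in> space P \<Longrightarrow> 0 \<le> phi x \<and> phi x \<le> 1"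
  shows "integrable P (\<lambda>x. L x * phi x)" "integrable P phi"
proof -
  show "integrable P (\<lambda>x. L x * phi x)"
    using phi by (intro Bochner_Integration.integrable_bound[OF integrable_L])
      (auto simp: abs_mult L_nonneg intro!: mult_left_le)
  show "integrable P phi"
    using phi by (intro integrable_const_bound[of _ 1]) auto
qed

text \<open>Weak duality, with \<open>t\<close> as Lagrange multiplier of the level constraint:
  pointwise, \<open>(L - t) * phi\<close> is at most \<open>(L - t)_+\<close>.\<close>

lemma tradeoff_ge_hinge:
  assumes "0 \<le> t" "0 \<le> a"
  shows "1 - t * a - hinge t \<le> tradeoff P Q a"
proof (rule tradeoff_greatest[OF assms(2)])
  fix phi :: "'a \<Rightarrow> real"
  assume phi: "phi \<in> borel_measurable P" "\<And>x. x \<in> space P \<Longrightarrow> 0 \<le> phi x \<and> phi x \<le> 1"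
    and a: "(\<integral>x. phi x \<partial>P) \<le> a"
  note int = integrable_L_mult[OF phi]
  have "(\<integral>x. phi x \<partial>Q) = (\<integral>x. L x * phi x \<partial>P)"
    using phi(1) by (rule integral_Q)
  also have "\<dots> \<le> (\<integral>x. max 0 (L x - t) + t * phi x \<partial>P)"
  proof (rule integral_mono)
    fix x assume x: "x \<in> space P"
    have "(L x - t) * phi x \<le> max 0 (L x - t) * phi x"
      using phi(2)[OF x] by (intro mult_right_mono) auto
    also have "\<dots> \<le> max 0 (L x - t)"
      using phi(2)[OF x] by (intro mult_left_le) auto
    finally show "L x * phi x \<le> max 0 (L x - t) + t * phi x"
      by (simp add: algebra_simps)
  qed (use int integrable_hinge in auto)
  also have "\<dots> = hinge t + t * (\<integral>x. phi x \<partial>P)"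
    using int integrable_hinge by (simp add: hinge_def)
  also have "t * (\<integral>x. phi x \<partial>P) \<le> t * a"
    using a assms(1) by (rule mult_left_mono)
  finally show "1 - t * a - hinge t \<le> 1 - (\<integral>x. phi x \<partial>Q)" by simp
qed

text \<open>Level \<open>0\<close> forces \<open>phi = 0\<close> almost everywhere under
  \<open>P\<close>, hence under \<open>Q\<close>. The endpoint is treated apart because the Gaussian
  dual optimum is attained at a finite multiplier only for interior levels.\<close>

lemma tradeoff_at_0: "1 \<le> tradeoff P Q 0"
proof (rule tradeoff_greatest)
  fix phi :: "'a \<Rightarrow> real"
  assume phi: "phi \<in> borel_measurable P" "\<And>x. x \<in> space P \<Longrightarrow> 0 \<le> phi x \<and> phi x \<le> 1"
    and a: "(\<integral>x. phi x \<partial>P) \<le> 0"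
  note int = integrable_L_mult[OF phi]
  have "0 \<le> (\<integral>x. phi x \<partial>P)" using phi(2) by (intro integral_nonneg_AE) auto
  with a have "(\<integral>x. phi x \<partial>P) = 0" by linarith
  moreover have "AE x in P. 0 \<le> phi x" using phi(2) by auto
  ultimately have "AE x in P. phi x = 0"
    using integral_nonneg_eq_0_iff_AE[OF int(2)] by blast
  then have "(\<integral>x. L x * phi x \<partial>P) = (\<integral>x. 0 \<partial>P)"
    using phi(1) by (intro integral_cong_AE) auto
  then show "1 \<le> 1 - (\<integral>x. phi x \<partial>Q)"
    using integral_Q[OF phi(1)] by simp
qed simp

text \<open>\<open>t\<close> is the lower \<open>1 - a\<close> quantile of \<open>L\<close> under
  \<open>P\<close>. As \<open>L\<close> may have an atom at \<open>t\<close>, the open and the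
  closed tail only bracket \<open>a\<close>; right continuity of the distribution function gives one
  inequality, its left limit the other.\<close>

lemma quantile_exists:
  assumes a: "0 < a" "a < 1"
  obtains t where "0 \<le> t" "prob {x \<in> space P. t < L x} \<le> a" "a \<le> prob {x \<in> space P. t \<le> L x}"
proof -
  define D where "D = distr P borel L"
  interpret D: real_distribution D
    unfolding D_def by (rule real_distribution_distr) simp
  define S where "S = {t. 1 - a \<le> cdf D t}"
  define t where "t = Inf S"
  have prob_D: "measure D A = prob {x \<in> space P. L x \<in> A}" if "A \<in> sets borel" for A
    unfolding D_def using that by (subst measure_distr) (auto intro!: arg_cong[where f = prob])
  have "eventually (\<lambda>t. 1 - a < cdf D t) at_top"
    using order_tendstoD(1)[OF D.cdf_lim_at_top_prob, of "1 - a"] a by simp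
  then obtain u where "\<forall>s\<ge>u. 1 - a < cdf D s"
    by (auto simp: eventually_at_top_linorder)
  then have "u \<in> S" by (auto simp: S_def less_imp_le)
  have S0: "0 \<le> s" if "s \<in> S" for s
  proof (rule ccontr)
    assume "\<not> 0 \<le> s"
    then have "{x \<in> space P. L x \<in> {..s}} = {}"
      using less_le_trans[OF _ L_nonneg, of s] by (auto simp: not_le[of 0] not_le[of "L _"])
    moreover have "cdf D s = prob {x \<in> space P. L x \<in> {..s}}"
      unfolding cdf_def by (rule prob_D) simp
    ultimately have "cdf D s = 0" by (simp only: measure_empty)
    with that a show False by (simp add: S_def)
  qed
  have bdd: "bdd_below S" by (rule bdd_belowI[of S 0]) (rule S0)
  have t0: "0 \<le> t"
    unfolding t_def using \<open>u \<in> S\<close> by (intro cInf_greatest S0) blast+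
  have right: "1 - a \<le> cdf D s" if "t < s" for s
  proof -
    have "S \<noteq> {}" using \<open>u \<in> S\<close> by blast
    moreover have "Inf S < s" using that by (simp only: t_def)
    ultimately have "\<exists>x\<in>S. x < s" by (rule cInf_lessD)
    then obtain s' where "s' \<in> S" "s' < s" by blast
    then show ?thesis using D.cdf_nondecreasing[of s' s] by (auto simp: S_def)
  qed
  have "1 - a \<le> cdf D t"
  proof (rule tendsto_lowerbound)
    show "(cdf D \<longlongrightarrow> cdf D t) (at_right t)"
      using D.cdf_is_right_cont[of t] by (simp add: continuous_within)
    show "eventually (\<lambda>s. 1 - a \<le> cdf D s) (at_right t)"
      using right by (auto simp: eventually_at_filter)
  qed simp
  then have "prob {x \<in> space P. L x \<le> t} \<ge> 1 - a"
    by (simp add: cdf_def prob_D)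
  moreover have "{x \<in> space P. t < L x} = space P - {x \<in> space P. L x \<le> t}" by auto
  ultimately have 1: "prob {x \<in> space P. t < L x} \<le> a"
    using prob_compl[of "{x \<in> space P. L x \<le> t}"] by simp
  have left: "cdf D s \<le> 1 - a" if "s < t" for s
  proof (rule ccontr)
    assume "\<not> cdf D s \<le> 1 - a"
    then have "s \<in> S" by (simp add: S_def)
    then show False using cInf_lower[OF _ bdd, of s] that by (simp add: t_def)
  qed
  have "measure D {..<t} \<le> 1 - a"
  proof (rule tendsto_upperbound)
    show "(cdf D \<longlongrightarrow> measure D {..<t}) (at_left t)" by (rule D.cdf_at_left)
    show "eventually (\<lambda>s. cdf D s \<le> 1 - a) (at_left t)"
      using left by (auto simp: eventually_at_filter)
  qed simp
  then have "prob {x \<in> space P. L x < t} \<le> 1 - a"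
    by (simp add: prob_D)
  moreover have "{x \<in> space P. t \<le> L x} = space P - {x \<in> space P. L x < t}" by auto
  ultimately have 2: "a \<le> prob {x \<in> space P. t \<le> L x}"
    using prob_compl[of "{x \<in> space P. L x < t}"] by simp
  show ?thesis using t0 1 2 by (rule that)
qed

text \<open>Neyman-Pearson: thresholding \<open>L\<close> at \<open>t\<close>, randomised on \<open>L = t\<close>, attains the dual bound.\<close>

lemma tradeoff_le_hinge:
  assumes a: "0 < a" "a < 1"
  obtains t where "0 \<le> t" "tradeoff P Q a \<le> 1 - t * a - hinge t"
proof -
  obtain t where t: "0 \<le> t" and up: "prob {x \<in> space P. t < L x} \<le> a"
    and lo: "a \<le> prob {x \<in> space P. t \<le> L x}"
    using quantile_exists[OF a] by blast
  define A B where "A = {x \<in> space P. t < L x}" and "B = {x \<in> space P. L x = t}"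
  have [measurable]: "A \<in> sets P" "B \<in> sets P" by (auto simp: A_def B_def)
  have "{x \<in> space P. t \<le> L x} = A \<union> B" "A \<inter> B = {}" by (auto simp: A_def B_def)
  then have AB: "prob {x \<in> space P. t \<le> L x} = prob A + prob B"
    by (simp add: finite_measure_Union)
  \<comment> \<open>If \<open>prob B = 0\<close>, division by zero yields \<open>r = 0\<close>, and
    the quantile bounds force \<open>prob A = a\<close>, so the level is still exact.\<close>
  define r where "r = (a - prob A) / prob B"
  have r: "0 \<le> r" "r \<le> 1" "prob A + r * prob B = a"
    using up lo measure_nonneg[of P B] unfolding AB A_def[symmetric] r_def
    by (auto simp: divide_le_eq_1)
  define phi where "phi x = indicator A x + r * indicator B x" for x :: 'a
  have [measurable]: "phi \<in> borel_measurable P" unfolding phi_def by measurable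
  have range: "0 \<le> phi x \<and> phi x \<le> 1" for x
    using r by (auto simp: phi_def indicator_def A_def B_def)
  have int: "integrable P phi"
    by (rule integrable_L_mult(2)) (simp_all only: range \<open>phi \<in> borel_measurable P\<close> simp_thms)
  have "A \<inter> space P = A" "B \<inter> space P = B" by (auto simp: A_def B_def)
  moreover have "integrable P (indicator C :: 'a \<Rightarrow> real)" if "C \<in> sets P" for C
    using that by (intro integrable_const_bound[of _ 1]) auto
  ultimately have "(\<integral>x. phi x \<partial>P) = prob A + r * prob B"
    unfolding phi_def by simp
  then have phi: "(\<integral>x. phi x \<partial>P) = a" using r by simp
  have "tradeoff P Q a \<le> 1 - (\<integral>x. phi x \<partial>Q)"
    by (rule tradeoff_le) (auto simp: prob_space_Q phi range)
  also have "(\<integral>x. phi x \<partial>Q) = (\<integral>x. L x * phi x \<partial>P)"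
    by (rule integral_Q) simp
  also have "\<dots> = (\<integral>x. max 0 (L x - t) + t * phi x \<partial>P)"
  proof (rule Bochner_Integration.integral_cong[OF refl])
    fix x assume "x \<in> space P"
    then show "L x * phi x = max 0 (L x - t) + t * phi x"
      by (auto simp: phi_def A_def B_def indicator_def max_def)
  qed
  also have "\<dots> = hinge t + t * a"
    using int integrable_hinge phi by (simp add: hinge_def)
  finally have "tradeoff P Q a \<le> 1 - t * a - hinge t" by linarith
  with t show ?thesis by (rule that)
qed

end

section \<open>Gaussian trade-off functions as maxima of dual lines\<close>

lemma gauss_ratio: "likelihood_ratio (normal1 0) (\<lambda>z. exp (m * z - m\<^sup>2 / 2))"
proof -
  interpret N0: prob_space "normal1 0" by (rule prob_space_normal1)
  interpret Nm: prob_space "normal1 m" by (rule prob_space_normal1)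
  show ?thesis
  proof
    show "(\<integral>\<^sup>+z. ennreal (exp (m * z - m\<^sup>2 / 2)) \<partial>normal1 0) = 1"
      using Nm.emeasure_space_1 unfolding normal1_eq_density[of m]
      by (subst (asm) emeasure_density) (auto cong: nn_integral_cong_simp)
  qed auto
qed

interpretation gauss: likelihood_ratio "normal1 0" "\<lambda>z. exp (m * z - m\<^sup>2 / 2)" for m :: real
  by (rule gauss_ratio)

lemma G_bounds: "0 \<le> G m a" "G m a \<le> 1"
  by (auto simp: G_def Phi_ge_0 Phi_le_1)

lemma G_antimono: "a \<le> b \<Longrightarrow> G m b \<le> G m a"
proof (cases "0 < a \<and> b < 1")
  case True
  assume "a \<le> b"
  with True obtain z w where z: "Phi z = 1 - a" "\<And>m. G m a = Phi (z - m)"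
    and w: "Phi w = 1 - b" "\<And>m. G m b = Phi (w - m)"
    using Phi_quantile[of a] Phi_quantile[of b] by (metis less_le_trans le_less_trans)
  have "w \<le> z" using Phi_strict_mono[of z w] z w \<open>a \<le> b\<close> by linarith
  then show ?thesis by (simp add: z w Phi_mono)
qed (auto simp: G_def Phi_ge_0 Phi_le_1)

lemma G_zero: "0 \<le> a \<Longrightarrow> a \<le> 1 \<Longrightarrow> G 0 a = 1 - a"
  by (auto simp: G_def Phi_Phi_inv)

lemma G_diff_le: "m \<le> m' \<Longrightarrow> G m a - G m' a \<le> m' - m"
  using Phi_diff_le[of "Phi_inv (1 - a) - m'" "Phi_inv (1 - a) - m"] by (auto simp: G_def)

text \<open>Symmetry of the normal law: exchanging the two error probabilities reflects the
  threshold \<open>z\<close> to \<open>m - z\<close>.\<close>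

lemma G_self_inverse:
  assumes "0 < a" "a < 1" shows "G m (G m a) = a"
proof -
  obtain z where z: "Phi z = 1 - a" "\<And>m. G m a = Phi (z - m)"
    using Phi_quantile assms by blast
  have "1 - Phi (z - m) = Phi (m - z)" using Phi_uminus[of "z - m"] by simp
  then have "G m (Phi (z - m)) = Phi (- z)"
    using Phi_gt_0[of "z - m"] Phi_less_1[of "z - m"]
    by (simp add: G_def Phi_inv_Phi)
  then show ?thesis by (simp add: z Phi_uminus)
qed

lemma tradeoff_normal_le_G:
  assumes "0 \<le> a" "a \<le> 1"
  shows "tradeoff (normal1 0) (normal1 m) a \<le> G m a"
proof -
  consider "a = 0" | "a = 1" | "0 < a" "a < 1" using assms by linarith
  then show ?thesis
  proof cases
    case 3
    then obtain z where z: "Phi z = 1 - a" "\<And>m. G m a = Phi (z - m)"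
      using Phi_quantile by blast
    have "tradeoff (normal1 0) (normal1 m) a \<le> 1 - measure (normal1 m) {z<..}"
      by (rule tradeoff_le_indicator) (auto simp: prob_space_normal1 measure_normal1_greater z)
    then show ?thesis by (simp add: measure_normal1_greater z)
  qed (use tradeoff_le_one_minus[of "normal1 0" "normal1 m" a] prob_space_normal1 in \<open>auto simp: G_def\<close>)
qed

lemma G_ge_gauss_hinge:
  assumes "0 \<le> t" "0 \<le> a" "a \<le> 1"
  shows "1 - t * a - gauss.hinge m t \<le> G m a"
  using gauss.tradeoff_ge_hinge[of t a m] tradeoff_normal_le_G[of a m] assms
  by (simp flip: normal1_eq_density)

text \<open>Take for \<open>t\<close> the likelihood ratio at the threshold \<open>z\<close>. For
  \<open>m \<ge> 0\<close> the ratio is nondecreasing, so the hinge integrand lives on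
  \<open>{z<..}\<close>. Together with \<open>G_ge_gauss_hinge\<close>, this makes
  \<open>G m\<close> a maximum of affine functions on the open interval.\<close>

lemma G_eq_gauss_hinge:
  assumes m: "0 \<le> m" and a: "0 < a" "a < 1"
  obtains t where "0 \<le> t" "G m a = 1 - t * a - gauss.hinge m t"
proof -
  obtain z where z: "Phi z = 1 - a" "\<And>m. G m a = Phi (z - m)"
    using Phi_quantile a by blast
  define t where "t = exp (m * z - m\<^sup>2 / 2)"
  have "gauss.hinge m t = (\<integral>x. exp (m * x - m\<^sup>2 / 2) * indicator {z<..} x - t * indicator {z<..} x \<partial>normal1 0)"
    unfolding gauss.hinge_def
  proof (rule Bochner_Integration.integral_cong[OF refl])
    fix x
    have "exp (m * x - m\<^sup>2 / 2) \<le> t \<longleftrightarrow> m * x \<le> m * z" "t \<le> exp (m * x - m\<^sup>2 / 2) \<longleftrightarrow> m * z \<le> m * x"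
      by (auto simp: t_def)
    moreover have "x \<le> z \<Longrightarrow> m * x \<le> m * z" "z < x \<Longrightarrow> m * z \<le> m * x"
      using m by (auto intro: mult_left_mono)
    ultimately show "max 0 (exp (m * x - m\<^sup>2 / 2) - t)
        = exp (m * x - m\<^sup>2 / 2) * indicator {z<..} x - t * indicator {z<..} x"
      by (cases "z < x") auto
  qed
  also have "(\<integral>x. exp (m * x - m\<^sup>2 / 2) * indicator {z<..} x - t * indicator {z<..} x \<partial>normal1 0)
      = (\<integral>x. exp (m * x - m\<^sup>2 / 2) * indicator {z<..} x \<partial>normal1 0) - t * measure (normal1 0) {z<..}"
  proof -
    have "integrable (normal1 0) (\<lambda>x. exp (m * x - m\<^sup>2 / 2) * indicator {z<..} x)"
      by (rule gauss.integrable_L_mult) auto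
    moreover have "integrable (normal1 0) (indicator {z<..} :: real \<Rightarrow> real)"
      by (rule gauss.integrable_const_bound[of _ 1]) auto
    ultimately show ?thesis
      by simp
  qed
  also have "(\<integral>x. exp (m * x - m\<^sup>2 / 2) * indicator {z<..} x \<partial>normal1 0) = measure (normal1 m) {z<..}"
    by (subst gauss.integral_Q[symmetric]) (simp_all flip: normal1_eq_density)
  finally have "gauss.hinge m t = 1 - Phi (z - m) - t * a"
    by (simp add: measure_normal1_greater z)
  then show ?thesis
    by (intro that[of t]) (simp_all add: z t_def)
qed

text \<open>Convexity along chords ending at \<open>(1, 0)\<close>: the supporting line at the
  intermediate point lies below \<open>G m\<close> at both ends.\<close>

lemma G_convex_at_1:
  assumes m: "0 \<le> m" and x: "0 < x" "x < 1" and l: "0 < l" "l \<le> 1"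
  shows "G m (l * x + (1 - l)) \<le> l * G m x"
proof -
  define y where "y = l * x + (1 - l)"
  have y: "y = 1 - l * (1 - x)" by (simp add: y_def algebra_simps)
  have "0 < l * (1 - x)" "l * (1 - x) < 1 * 1"
    using x l by (simp, intro mult_le_less_imp_less) auto
  then have "0 < y" "y < 1" using y by auto
  then obtain t where t: "0 \<le> t" "G m y = 1 - t * y - gauss.hinge m t"
    using G_eq_gauss_hinge[OF m] by blast
  have "1 - t * y - gauss.hinge m t
      = l * (1 - t * x - gauss.hinge m t) + (1 - l) * (1 - t * 1 - gauss.hinge m t)"
    by (simp add: y_def algebra_simps)
  also have "\<dots> \<le> l * G m x + (1 - l) * G m 1"
    using t x l by (intro add_mono mult_left_mono G_ge_gauss_hinge) auto
  also have "G m 1 = 0" by (simp add: G_def)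
  finally show ?thesis by (simp add: t(2) flip: y_def)
qed

text \<open>With \<open>q = (1 - d) * b\<close>, both \<open>b\<close> and \<open>1 - d\<close> lie
  between \<open>q\<close> and \<open>1\<close>. The two chord bounds add up to exactly
  \<open>G m q\<close> because \<open>(1 - d) * (1 - b) + d = 1 - q\<close>.\<close>

lemma G_superadditive:
  assumes m: "0 \<le> m" and d: "0 < d" "d < 1" and b: "0 < b" "b < 1"
  shows "(1 - d) * G m b + G m (1 - d) \<le> G m ((1 - d) * b)"
proof -
  define q where "q = (1 - d) * b"
  have q: "0 < q" "q < 1" using d b mult_strict_mono[of "1 - d" 1 b 1] by (auto simp: q_def)
  have "q \<le> 1 * b" "q \<le> (1 - d) * 1" unfolding q_def using d b by (intro mult_mono; simp)+
  then have l: "0 < (1 - b) / (1 - q)" "(1 - b) / (1 - q) \<le> 1" "0 < d / (1 - q)" "d / (1 - q) \<le> 1"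
    using q b d by (auto simp: divide_le_eq_1)
  have *: "l * q + (1 - l) = 1 - l * (1 - q)" for l :: real
    by (simp add: algebra_simps)
  have "(1 - b) / (1 - q) * q + (1 - (1 - b) / (1 - q)) = b" "d / (1 - q) * q + (1 - d / (1 - q)) = 1 - d"
    unfolding * using q by auto
  then have "G m b \<le> (1 - b) / (1 - q) * G m q" "G m (1 - d) \<le> d / (1 - q) * G m q"
    using G_convex_at_1[OF m q l(1,2)] G_convex_at_1[OF m q l(3,4)] by (simp_all only:)
  then have "(1 - d) * G m b + G m (1 - d) \<le> (1 - d) * ((1 - b) / (1 - q) * G m q) + d / (1 - q) * G m q"
    using d by (intro add_mono mult_left_mono) auto
  also have "\<dots> = ((1 - d) * (1 - b) + d) / (1 - q) * G m q"
    by (simp add: add_divide_distrib distrib_right)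
  also have "(1 - d) * (1 - b) + d = 1 - q" by (simp add: q_def algebra_simps)
  finally show ?thesis using q by (simp flip: q_def)
qed

context likelihood_ratio
begin

text \<open>The multiplier is the optimal one on the Gaussian side; for the pair \<open>P\<close>,
  \<open>Q\<close> any multiplier gives a lower bound. So the hinge error passes over
  unchanged.\<close>

lemma tradeoff_ge_G:
  assumes "0 \<le> m" "0 \<le> \<delta>" and le: "\<And>t. 0 \<le> t \<Longrightarrow> hinge t \<le> gauss.hinge m t + \<delta>"
    and a: "0 \<le> a" "a \<le> 1"
  shows "G m a - \<delta> \<le> tradeoff P Q a"
proof -
  consider "a = 0" | "a = 1" | "0 < a" "a < 1" using a by linarith
  then show ?thesis
  proof cases
    case 1
    then show ?thesis using tradeoff_at_0 G_bounds[of m a] assms(2) by simp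
  next
    case 2
    then show ?thesis
      using tradeoff_nonneg[OF prob_space_Q, of P a] assms(2) by (simp add: G_def)
  next
    case 3
    then obtain t where t: "0 \<le> t" "G m a = 1 - t * a - gauss.hinge m t"
      using G_eq_gauss_hinge assms(1) by blast
    then show ?thesis using tradeoff_ge_hinge[of t a] le[of t] a by simp
  qed
qed

text \<open>The roles are exchanged: the multiplier is optimal for \<open>P\<close>,
  \<open>Q\<close> by Neyman-Pearson, and any multiplier bounds \<open>G m\<close> from
  below.\<close>

lemma tradeoff_le_G:
  assumes "0 \<le> m" "0 \<le> \<delta>" and le: "\<And>t. 0 \<le> t \<Longrightarrow> gauss.hinge m t \<le> hinge t + \<delta>"
    and a: "0 \<le> a" "a \<le> 1"
  shows "tradeoff P Q a \<le> G m a + \<delta>"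
proof (cases "0 < a \<and> a < 1")
  case True
  then obtain t where t: "0 \<le> t" "tradeoff P Q a \<le> 1 - t * a - hinge t"
    using tradeoff_le_hinge by blast
  then show ?thesis using G_ge_gauss_hinge[of t a m] le[of t] a by simp
next
  case False
  then show ?thesis
    using tradeoff_le_one_minus[OF prob_space_axioms prob_space_Q _ a] a assms(2) by (auto simp: G_def)
qed

end

section \<open>Upper bounds for the composition of a Gaussian trade-off function with
  \<open>f_{0,d}\<close>\<close>

lemma measure_uniform_interval:
  assumes "d \<le> u" "u \<le> 1 + d"
  shows "measure (uniform_measure lborel {d..1 + d}) {u..1 + d} = 1 + d - u"
    and "measure (uniform_measure lborel {d..1 + d}) {1 + d<..} = 0"
proof -
  have "{d..1 + d} \<inter> {u..1 + d} = {u..1 + d}" "{d..1 + d} \<inter> {1 + d<..} = {}" using assms by auto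
  then show "measure (uniform_measure lborel {d..1 + d}) {u..1 + d} = 1 + d - u"
    "measure (uniform_measure lborel {d..1 + d}) {1 + d<..} = 0"
    using assms by (auto simp: measure_uniform_measure)
qed

lemma prob_space_uniform: "prob_space (uniform_measure lborel {d..1 + d :: real})"
  by (rule prob_space_uniform_measure) auto

text \<open>The test rejects when the uniform coordinate exceeds \<open>1\<close>, a null event
  under the null hypothesis, and consults \<open>A\<close> when that coordinate lies in
  \<open>{d..1}\<close>, which has mass \<open>1 - d\<close> under both hypotheses.\<close>

lemma G_comp_f0_le:
  assumes A: "A \<in> sets borel" and d: "0 \<le> d" "d \<le> 1" and a: "measure (normal1 0) A * (1 - d) \<le> a"
  shows "G_comp_f0 m d a \<le> (1 - d) * (1 - measure (normal1 m) A)"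
proof -
  let ?U = "\<lambda>d. uniform_measure lborel {d..1 + d :: real}"
  define S where "S = A \<times> {d..1} \<union> UNIV \<times> {1<..}"
  have meas: "measure (normal1 k \<Otimes>\<^sub>M ?U e) S
      = measure (normal1 k) A * measure (?U e) {d..1} + measure (?U e) {1<..}" for k e
  proof -
    interpret N: prob_space "normal1 k" by (rule prob_space_normal1)
    interpret U: prob_space "?U e" by (rule prob_space_uniform)
    interpret NU: pair_prob_space "normal1 k" "?U e" ..
    have "measure (normal1 k \<Otimes>\<^sub>M ?U e) S
      = measure (normal1 k \<Otimes>\<^sub>M ?U e) (A \<times> {d..1}) + measure (normal1 k \<Otimes>\<^sub>M ?U e) (UNIV \<times> {1<..})"
      unfolding S_def by (rule NU.finite_measure_Union) (auto intro!: pair_measureI simp: A)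
    also have "measure (normal1 k \<Otimes>\<^sub>M ?U e) (A \<times> {d..1}) = measure (normal1 k) A * measure (?U e) {d..1}"
      by (simp add: measure_def U.emeasure_pair_measure_Times enn2real_mult A)
    also have "measure (normal1 k \<Otimes>\<^sub>M ?U e) (UNIV \<times> {1<..}) = measure (normal1 k) UNIV * measure (?U e) {1<..}"
      by (simp add: measure_def U.emeasure_pair_measure_Times enn2real_mult)
    finally show ?thesis using N.prob_space by simp
  qed
  interpret N: prob_space "normal1 m" by (rule prob_space_normal1)
  interpret U: prob_space "?U d" by (rule prob_space_uniform)
  interpret NU: pair_prob_space "normal1 m" "?U d" ..
  have 0: "measure (?U 0) {d..1} = 1 - d" "measure (?U 0) {1<..} = 0"
    using measure_uniform_interval[of 0 d] d by auto
  have 1: "measure (?U d) {d..1} = 1 - d" "measure (?U d) {1<..} = d"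
  proof -
    have "{d..1 + d} \<inter> {d..1} = {d..1}" "{d..1 + d} \<inter> {1<..} = {1<..1 + d}" using d by auto
    then show "measure (?U d) {d..1} = 1 - d" "measure (?U d) {1<..} = d"
      using d by (simp_all add: measure_uniform_measure)
  qed
  have "measure (normal1 0 \<Otimes>\<^sub>M ?U 0) S \<le> a"
    unfolding meas 0 using a by simp
  then have "tradeoff (normal1 0 \<Otimes>\<^sub>M ?U 0) (normal1 m \<Otimes>\<^sub>M ?U d) a \<le> 1 - measure (normal1 m \<Otimes>\<^sub>M ?U d) S"
    by (intro tradeoff_le_indicator NU.prob_space_axioms)
       (auto simp: S_def A intro!: sets_pair_measure_cong pair_measureI)
  then have "G_comp_f0 m d a \<le> 1 - measure (normal1 m \<Otimes>\<^sub>M ?U d) S"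
    by (simp add: G_comp_f0_def)
  also have "\<dots> = (1 - d) * (1 - measure (normal1 m) A)"
    unfolding meas 1 by (simp add: algebra_simps)
  finally show ?thesis .
qed

text \<open>The two uniform laws are mutually singular, so looking at whether the second coordinate
  exceeds \<open>1\<close> decides without error.\<close>

lemma G_comp_f0_le_0:
  assumes d: "1 \<le> d" and a: "0 \<le> a"
  shows "G_comp_f0 m d a \<le> 0"
proof -
  let ?U = "\<lambda>d. uniform_measure lborel {d..1 + d :: real}"
  have meas: "measure (normal1 k \<Otimes>\<^sub>M ?U e) (UNIV \<times> {1<..}) = measure (?U e) {1<..}" for k e
  proof -
    interpret N: prob_space "normal1 k" by (rule prob_space_normal1)
    interpret U: prob_space "?U e" by (rule prob_space_uniform)
    show ?thesis
      using U.emeasure_pair_measure_Times[of UNIV "normal1 k" "{1<..}"] N.emeasure_space_1 by (simp add: measure_def)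
  qed
  interpret N: prob_space "normal1 m" by (rule prob_space_normal1)
  interpret U: prob_space "?U d" by (rule prob_space_uniform)
  interpret NU: pair_prob_space "normal1 m" "?U d" ..
  have "{d..1 + d} \<inter> {1<..} = (if d = 1 then {1<..1 + d} else {d..1 + d})" using d by auto
  then have 1: "measure (?U d) {1<..} = 1"
    using d by (simp add: measure_uniform_measure)
  have 0: "measure (?U 0) {1<..} = 0"
    using measure_uniform_interval[of 0 0] by simp
  have "measure (normal1 0 \<Otimes>\<^sub>M ?U 0) (UNIV \<times> {1<..}) \<le> a"
    unfolding meas 0 by (rule a)
  then have "tradeoff (normal1 0 \<Otimes>\<^sub>M ?U 0) (normal1 m \<Otimes>\<^sub>M ?U d) a
      \<le> 1 - measure (normal1 m \<Otimes>\<^sub>M ?U d) (UNIV \<times> {1<..})"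
    by (intro tradeoff_le_indicator NU.prob_space_axioms)
       (auto intro!: sets_pair_measure_cong pair_measureI)
  then show ?thesis by (simp add: G_comp_f0_def meas 1)
qed

text \<open>Convexity of \<open>G m\<close> reduces the claim to the single inequality \<open>\<delta> \<le> G m (1 - d)\<close>, which
  follows from \<open>1 - d \<le> G m \<delta>\<close> because \<open>G m\<close> is its own inverse.\<close>

lemma G_comp_f0_le_tradeoff:
  assumes m: "0 \<le> m" and \<delta>: "0 \<le> \<delta>" and f: "\<And>a. 0 \<le> a \<Longrightarrow> a \<le> 1 \<Longrightarrow> G m a - \<delta> \<le> f a"
    and f_nonneg: "\<And>a. 0 \<le> a \<Longrightarrow> a \<le> 1 \<Longrightarrow> 0 \<le> f a"
    and d: "(1 - G m \<delta>) + \<delta> \<le> d" and a: "0 \<le> a" "a \<le> 1"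
  shows "G_comp_f0 m d a \<le> f a"
proof (cases "1 \<le> d")
  case True
  then show ?thesis using G_comp_f0_le_0[of d a m] f_nonneg a by fastforce
next
  case False
  have d0: "0 \<le> d" "\<delta> \<le> d" using d \<delta> G_bounds[of m \<delta>] by auto
  consider "1 - d \<le> a" | "a = 0" | "0 < a" "a < 1 - d" using a by linarith
  then show ?thesis
  proof cases
    case 1
    have "measure (normal1 k) UNIV = 1" for k
      using prob_space.prob_space[OF prob_space_normal1, of k] by simp
    then show ?thesis
      using G_comp_f0_le[of UNIV d a m] False d0 1 f_nonneg[OF a] by simp
  next
    case 2
    then show ?thesis
      using G_comp_f0_le[of "{}" d a m] False d0 f[of 0] by (simp add: G_def)
  next
    case 3
    \<comment> \<open>The Gaussian coordinate is consulted with probability \<open>1 - d\<close>, so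
      its threshold test may spend the larger level \<open>b\<close>.\<close>
    define b where "b = a / (1 - d)"
    have b: "0 < b" "b < 1" "a = (1 - d) * b" using 3 False by (auto simp: b_def)
    obtain z where z: "Phi z = 1 - b" "\<And>m. G m b = Phi (z - m)"
      using Phi_quantile b by blast
    have "G_comp_f0 m d a \<le> (1 - d) * G m b"
      using G_comp_f0_le[of "{z<..}" d a m] d0 False b by (simp add: measure_normal1_greater z mult.commute)
    \<comment> \<open>\<open>G_superadditive\<close> leaves the loss \<open>G m (1 - d)\<close>,
      which is at least \<open>\<delta>\<close>; for \<open>d = 0\<close> also
      \<open>\<delta> = 0\<close>.\<close>
    also have "\<dots> \<le> G m a - \<delta>"
    proof (cases "d = 0")
      case True
      then show ?thesis using b d0 \<delta> by simp
    next
      case False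
      have "\<delta> \<le> G m (1 - d)"
      proof (cases "\<delta> = 0")
        case False
        then have "\<delta> = G m (G m \<delta>)"
          using d0 \<delta> \<open>\<not> 1 \<le> d\<close> by (simp add: G_self_inverse)
        also have "\<dots> \<le> G m (1 - d)"
          using d \<delta> by (intro G_antimono) auto
        finally show ?thesis .
      qed (simp add: G_bounds)
      then show ?thesis
        using G_superadditive[OF m, of d b] False d0 \<open>\<not> 1 \<le> d\<close> b by simp
    qed
    also have "\<dots> \<le> f a" using f a by blast
    finally show ?thesis .
  qed
qed

section \<open>Normal approximation of hinge expectations\<close>

context prob_space
begin

lemma indep_var_mult:
  fixes X Y :: "'a \<Rightarrow> real" and f g :: "real \<Rightarrow> real"
  assumes "indep_var borel X borel Y"
    and [measurable]: "f \<in> borel_measurable borel" "g \<in> borel_measurable borel"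
    and int: "integrable M (\<lambda>\<omega>. f (X \<omega>))" "integrable M (\<lambda>\<omega>. g (Y \<omega>))"
  shows "integrable M (\<lambda>\<omega>. f (X \<omega>) * g (Y \<omega>))"
    and "expectation (\<lambda>\<omega>. f (X \<omega>) * g (Y \<omega>)) = expectation (\<lambda>\<omega>. f (X \<omega>)) * expectation (\<lambda>\<omega>. g (Y \<omega>))"
proof -
  have "indep_var borel (\<lambda>\<omega>. f (X \<omega>)) borel (\<lambda>\<omega>. g (Y \<omega>))"
    using indep_var_compose[OF assms(1-3)] by (simp add: comp_def)
  from indep_var_integrable[OF this int] indep_var_lebesgue_integral[OF this int]
  show "integrable M (\<lambda>\<omega>. f (X \<omega>) * g (Y \<omega>))"
    and "expectation (\<lambda>\<omega>. f (X \<omega>) * g (Y \<omega>)) = expectation (\<lambda>\<omega>. f (X \<omega>)) * expectation (\<lambda>\<omega>. g (Y \<omega>))"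
    by auto
qed

lemma indep_var_random_variable:
  assumes "indep_var N X N' Y"
  shows "X \<in> measurable M N" "Y \<in> measurable M N'"
  using assms by (auto simp: indep_var_rv1 indep_var_rv2)

lemma integrable_power_bound:
  fixes X :: "'a \<Rightarrow> real"
  assumes [measurable]: "X \<in> borel_measurable M" and int: "integrable M (\<lambda>\<omega>. X \<omega> ^ 4)" and k: "k \<le> 4"
  shows "integrable M (\<lambda>\<omega>. \<bar>X \<omega>\<bar> ^ k)" "integrable M (\<lambda>\<omega>. X \<omega> ^ k)"
    "expectation (\<lambda>\<omega>. \<bar>X \<omega>\<bar> ^ k) \<le> 1 + expectation (\<lambda>\<omega>. X \<omega> ^ 4)"
proof -
  have le: "\<bar>y\<bar> ^ k \<le> 1 + y ^ 4" for y :: real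
  proof (cases "\<bar>y\<bar> \<le> 1")
    case True
    then have "\<bar>y\<bar> ^ k \<le> 1" by (intro power_le_one) auto
    moreover have "0 \<le> y ^ 4" by (rule zero_le_even_power) simp
    ultimately show ?thesis by linarith
  next
    case False
    then have "\<bar>y\<bar> ^ k \<le> \<bar>y\<bar> ^ 4" using k by (intro power_increasing) auto
    then show ?thesis by (simp add: power_even_abs)
  qed
  show 1: "integrable M (\<lambda>\<omega>. \<bar>X \<omega>\<bar> ^ k)"
    by (rule Bochner_Integration.integrable_bound[of M "\<lambda>\<omega>. 1 + X \<omega> ^ 4"])
       (use int le in \<open>auto intro!: AE_I2 order_trans[OF le]\<close>)
  show "integrable M (\<lambda>\<omega>. X \<omega> ^ k)"
    by (rule Bochner_Integration.integrable_bound[OF 1]) (auto simp: power_abs)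
  have "expectation (\<lambda>\<omega>. \<bar>X \<omega>\<bar> ^ k) \<le> expectation (\<lambda>\<omega>. 1 + X \<omega> ^ 4)"
    using 1 int le by (intro integral_mono) auto
  then show "expectation (\<lambda>\<omega>. \<bar>X \<omega>\<bar> ^ k) \<le> 1 + expectation (\<lambda>\<omega>. X \<omega> ^ 4)"
    using int by (simp add: prob_space)
qed

text \<open>Expand the Stein solution around \<open>R\<close>: since \<open>\<xi>\<close> is independent of \<open>R\<close> with mean \<open>0\<close> and
  variance \<open>1\<close>, the terms \<open>\<xi> f R\<close> and \<open>(\<xi>\<^sup>2 - 1) f' R\<close> vanish in expectation.\<close>

lemma stein_leave_one_out:
  fixes \<xi> R :: "'a \<Rightarrow> real"
  assumes indep: "indep_var borel \<xi> borel R"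
    and xi4: "integrable M (\<lambda>\<omega>. \<xi> \<omega> ^ 4)" and K: "expectation (\<lambda>\<omega>. \<xi> \<omega> ^ 4) \<le> K"
    and mean: "expectation \<xi> = 0" and var: "expectation (\<lambda>\<omega>. \<xi> \<omega> ^ 2) = 1"
    and R: "integrable M R" "expectation (\<lambda>\<omega>. \<bar>R \<omega>\<bar>) \<le> 1"
    and s: "1 \<le> s" and x: "0 \<le> x"
  defines "W \<equiv> \<lambda>\<omega>. R \<omega> + \<xi> \<omega> / s"
  shows "integrable M (\<lambda>\<omega>. \<xi> \<omega> * stein_sol x (W \<omega>))"
    and "integrable M (\<lambda>\<omega>. stein_deriv x (W \<omega>))"
    and "\<bar>s * expectation (\<lambda>\<omega>. \<xi> \<omega> * stein_sol x (W \<omega>)) - expectation (\<lambda>\<omega>. stein_deriv x (W \<omega>))\<bar>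
      \<le> stein_const / (1 + x) / s * (5 * (1 + K))"
proof -
  let ?f = "stein_sol x" and ?f' = "stein_deriv x"
  define B where "B = stein_const / (1 + x)"
  have B: "0 \<le> B" using stein_const_nonneg x by (simp add: B_def)
  note [measurable] = indep_var_random_variable[OF indep]
  note xi_pow = integrable_power_bound[OF indep_var_random_variable(1)[OF indep] xi4]
  have xi: "integrable M \<xi>" "integrable M (\<lambda>\<omega>. \<bar>\<xi> \<omega>\<bar>)" "integrable M (\<lambda>\<omega>. \<bar>\<xi> \<omega>\<bar> ^ 3)" "integrable M (\<lambda>\<omega>. \<xi> \<omega> ^ 2)"
    using xi_pow(2)[of 1] xi_pow(1)[of 1] xi_pow(1)[of 3] xi_pow(2)[of 2] by auto
  obtain Bf where Bf: "\<And>w. \<bar>?f w\<bar> \<le> Bf" using stein_sol_bounded[OF x] by blast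
  have W: "integrable M W" unfolding W_def using R xi by auto
  have bounded_int: "integrable M (\<lambda>\<omega>. Y \<omega> * ?f (Z \<omega>))"
    if "integrable M Y" and [measurable]: "Z \<in> borel_measurable M" for Y Z
  proof (rule Bochner_Integration.integrable_bound[OF integrable_mult_right[OF that(1), of Bf]])
    have "\<bar>Y \<omega>\<bar> * \<bar>?f (Z \<omega>)\<bar> \<le> \<bar>Y \<omega>\<bar> * \<bar>Bf\<bar>" for \<omega>
      using Bf[of "Z \<omega>"] by (intro mult_left_mono) auto
    then show "AE \<omega> in M. norm (Y \<omega> * ?f (Z \<omega>)) \<le> norm (Bf * Y \<omega>)"
      by (auto simp: abs_mult mult.commute)
  qed (use that in measurable)
  have f_int: "integrable M (\<lambda>\<omega>. ?f (R \<omega>))"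
    using bounded_int[of "\<lambda>_. 1" R] by simp
  have deriv_int: "integrable M (\<lambda>\<omega>. ?f' (Z \<omega>))" if "integrable M Z" for Z
    unfolding stein_deriv_eq using that bounded_int[of Z Z] by auto
  show xif: "integrable M (\<lambda>\<omega>. \<xi> \<omega> * ?f (W \<omega>))"
    using bounded_int[OF xi(1)] W by auto
  show f'W: "integrable M (\<lambda>\<omega>. ?f' (W \<omega>))" by (rule deriv_int[OF W])
  have f'R: "integrable M (\<lambda>\<omega>. ?f' (R \<omega>))" by (rule deriv_int[OF R(1)])

  have e1: "integrable M (\<lambda>\<omega>. \<xi> \<omega> * ?f (R \<omega>))" "expectation (\<lambda>\<omega>. \<xi> \<omega> * ?f (R \<omega>)) = 0"
    using indep_var_mult[OF indep, of "\<lambda>u. u" ?f] xi f_int mean by auto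
  have e2: "integrable M (\<lambda>\<omega>. (\<xi> \<omega> ^ 2 - 1) * ?f' (R \<omega>))"
    "expectation (\<lambda>\<omega>. (\<xi> \<omega> ^ 2 - 1) * ?f' (R \<omega>)) = 0"
    using indep_var_mult[OF indep, of "\<lambda>u. u ^ 2 - 1" ?f'] xi f'R var by (auto simp: prob_space)
  \<comment> \<open>Pointwise majorant of the expansion remainder. The growth factor of the weighted
    Lipschitz bound costs one extra power, hence fourth moments; the product of \<open>\<xi>\<close>
    and \<open>R\<close> terms is split by independence.\<close>
  define E where "E \<omega> = (\<bar>\<xi> \<omega>\<bar> ^ 3 + \<bar>\<xi> \<omega>\<bar>) * (1 + \<bar>R \<omega>\<bar>) + (\<xi> \<omega> ^ 4 + \<xi> \<omega> ^ 2)" for \<omega>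
  have E_prod: "integrable M (\<lambda>\<omega>. (\<bar>\<xi> \<omega>\<bar> ^ 3 + \<bar>\<xi> \<omega>\<bar>) * (1 + \<bar>R \<omega>\<bar>))"
    "expectation (\<lambda>\<omega>. (\<bar>\<xi> \<omega>\<bar> ^ 3 + \<bar>\<xi> \<omega>\<bar>) * (1 + \<bar>R \<omega>\<bar>))
      = expectation (\<lambda>\<omega>. \<bar>\<xi> \<omega>\<bar> ^ 3 + \<bar>\<xi> \<omega>\<bar>) * expectation (\<lambda>\<omega>. 1 + \<bar>R \<omega>\<bar>)"
    using indep_var_mult[OF indep, of "\<lambda>u. \<bar>u\<bar> ^ 3 + \<bar>u\<bar>" "\<lambda>u. 1 + \<bar>u\<bar>"] xi R by auto
  have E_int: "integrable M E" unfolding E_def using E_prod xi xi4 by auto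
  have "expectation (\<lambda>\<omega>. \<bar>\<xi> \<omega>\<bar> ^ 3 + \<bar>\<xi> \<omega>\<bar>) \<le> 2 * (1 + K)"
    using xi_pow(3)[of 3] xi_pow(3)[of 1] K xi by auto
  moreover have "expectation (\<lambda>\<omega>. 1 + \<bar>R \<omega>\<bar>) \<le> 2" using R by (simp add: prob_space)
  moreover have "0 \<le> expectation (\<lambda>\<omega>. 1 + \<bar>R \<omega>\<bar>)" by (rule integral_nonneg_AE) auto
  moreover have K0: "0 \<le> K" using K by (rule order_trans[OF integral_nonneg_AE, rotated]) auto
  ultimately have "expectation (\<lambda>\<omega>. \<bar>\<xi> \<omega>\<bar> ^ 3 + \<bar>\<xi> \<omega>\<bar>) * expectation (\<lambda>\<omega>. 1 + \<bar>R \<omega>\<bar>) \<le> 2 * (1 + K) * 2"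
    by (intro mult_mono) auto
  moreover have "expectation E = expectation (\<lambda>\<omega>. \<bar>\<xi> \<omega>\<bar> ^ 3 + \<bar>\<xi> \<omega>\<bar>) * expectation (\<lambda>\<omega>. 1 + \<bar>R \<omega>\<bar>)
      + (expectation (\<lambda>\<omega>. \<xi> \<omega> ^ 4) + 1)"
    unfolding E_def using E_prod xi xi4 var by simp
  \<comment> \<open>The product contributes \<open>4 * (1 + K)\<close>, the remaining fourth and
    second moments at most \<open>K + 1\<close>.\<close>
  ultimately have E_le: "expectation E \<le> 5 * (1 + K)" using K by argo

  \<comment> \<open>The last two terms have mean \<open>0\<close> by \<open>e1\<close> and
    \<open>e2\<close>; subtracting them leaves only increments of the Stein derivative.\<close>
  define \<Delta> where "\<Delta> \<omega> = s * (\<xi> \<omega> * ?f (W \<omega>)) - ?f' (W \<omega>) - s * (\<xi> \<omega> * ?f (R \<omega>)) - (\<xi> \<omega> ^ 2 - 1) * ?f' (R \<omega>)" for \<omega>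
  have pointwise: "\<bar>\<Delta> \<omega>\<bar> \<le> B / s * E \<omega>" for \<omega>
  proof -
    define r z v where "r = R \<omega>" and "z = \<xi> \<omega>" and "v = z / s"
    have w: "W \<omega> = r + v" by (simp add: W_def r_def z_def v_def)
    have v_le: "\<bar>v\<bar> \<le> \<bar>z\<bar>" using s by (simp add: v_def abs_divide divide_le_eq mult_left_le mult_le_cancel_left1)
    have zsv: "z = s * v" using s by (simp add: v_def)
    have lip: "\<bar>?f' (r + u) - ?f' r\<bar> \<le> B * (1 + \<bar>r\<bar> + \<bar>z\<bar>) * \<bar>v\<bar>" if "\<bar>u\<bar> \<le> \<bar>v\<bar>" for u
    proof -
      have "\<bar>?f' (r + u) - ?f' r\<bar> \<le> B * (1 + \<bar>r\<bar> + \<bar>u\<bar>) * \<bar>u\<bar>"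
        using stein_deriv_weighted_lipschitz[OF x, of r u] by (simp add: B_def)
      also have "\<dots> \<le> B * (1 + \<bar>r\<bar> + \<bar>z\<bar>) * \<bar>v\<bar>"
        using that v_le B by (intro mult_mono) auto
      finally show ?thesis .
    qed
    obtain u where u: "\<bar>u\<bar> \<le> \<bar>v\<bar>" "?f (r + v) - ?f r = v * ?f' (r + u)"
    proof (cases v "0 :: real" rule: linorder_cases)
      case less
      then obtain t where "r + v < t" "t < r" "?f r - ?f (r + v) = (r - (r + v)) * ?f' t"
        using MVT2[of "r + v" r ?f ?f'] DERIV_stein_sol by auto
      then show ?thesis by (intro that[of "t - r"]) auto
    next
      case greater
      then obtain t where "r < t" "t < r + v" "?f (r + v) - ?f r = (r + v - r) * ?f' t"
        using MVT2[of r "r + v" ?f ?f'] DERIV_stein_sol by auto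
      then show ?thesis by (intro that[of "t - r"]) auto
    qed (auto intro: that[of 0])
    have "\<Delta> \<omega> = s * z * (?f (r + v) - ?f r) - z ^ 2 * ?f' r - (?f' (r + v) - ?f' r)"
      by (simp add: \<Delta>_def w flip: r_def z_def) (simp add: algebra_simps)
    also have "\<dots> = z ^ 2 * (?f' (r + u) - ?f' r) - (?f' (r + v) - ?f' r)"
      unfolding u(2) using s by (simp add: zsv power2_eq_square algebra_simps)
    finally have "\<bar>\<Delta> \<omega>\<bar> \<le> z ^ 2 * \<bar>?f' (r + u) - ?f' r\<bar> + \<bar>?f' (r + v) - ?f' r\<bar>"
      using abs_triangle_ineq4[of "z ^ 2 * (?f' (r + u) - ?f' r)" "?f' (r + v) - ?f' r"] by (simp add: abs_mult)
    also have "\<dots> \<le> z ^ 2 * (B * (1 + \<bar>r\<bar> + \<bar>z\<bar>) * \<bar>v\<bar>) + B * (1 + \<bar>r\<bar> + \<bar>z\<bar>) * \<bar>v\<bar>"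
      using lip[OF u(1)] lip[of v] by (intro add_mono mult_left_mono) auto
    also have "\<dots> = B / s * ((\<bar>z\<bar> ^ 2 + 1) * (1 + \<bar>r\<bar> + \<bar>z\<bar>) * \<bar>z\<bar>)"
      using s by (simp add: v_def abs_divide field_simps)
    also have "(\<bar>z\<bar> ^ 2 + 1) * (1 + \<bar>r\<bar> + \<bar>z\<bar>) * \<bar>z\<bar> = (\<bar>z\<bar> ^ 3 + \<bar>z\<bar>) * (1 + \<bar>r\<bar>) + (\<bar>z\<bar> ^ 4 + \<bar>z\<bar> ^ 2)"
      by (simp add: algebra_simps power2_eq_square power3_eq_cube power4_eq_xxxx)
    also have "\<dots> = E \<omega>" by (simp add: E_def r_def z_def power_even_abs)
    finally show ?thesis .
  qed
  have "\<bar>s * expectation (\<lambda>\<omega>. \<xi> \<omega> * ?f (W \<omega>)) - expectation (\<lambda>\<omega>. ?f' (W \<omega>))\<bar> = \<bar>expectation \<Delta>\<bar>"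
    unfolding \<Delta>_def using xif f'W e1 e2 by simp
  also have "\<dots> \<le> expectation (\<lambda>\<omega>. \<bar>\<Delta> \<omega>\<bar>)"
    by (rule integral_abs_bound)
  also have "\<dots> \<le> expectation (\<lambda>\<omega>. B / s * E \<omega>)"
  proof (rule integral_mono)
    show "integrable M (\<lambda>\<omega>. \<bar>\<Delta> \<omega>\<bar>)"
      unfolding \<Delta>_def using xif f'W e1 e2 by auto
  qed (use E_int pointwise in auto)
  also have "\<dots> = B / s * expectation E" by simp
  also have "\<dots> \<le> B / s * (5 * (1 + K))"
    using B s E_le by (intro mult_left_mono) auto
  finally show "\<bar>s * expectation (\<lambda>\<omega>. \<xi> \<omega> * ?f (W \<omega>)) - expectation (\<lambda>\<omega>. ?f' (W \<omega>))\<bar>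
      \<le> stein_const / (1 + x) / s * (5 * (1 + K))"
    by (simp add: B_def)
qed

lemma indep_sum_second_moment:
  fixes X :: "'i \<Rightarrow> 'a \<Rightarrow> real"
  assumes "finite I" and "indep_vars (\<lambda>_. borel) X I"
    and "\<And>i. i \<in> I \<Longrightarrow> integrable M (X i)" "\<And>i. i \<in> I \<Longrightarrow> integrable M (\<lambda>\<omega>. X i \<omega> ^ 2)"
    and "\<And>i. i \<in> I \<Longrightarrow> expectation (X i) = 0" "\<And>i. i \<in> I \<Longrightarrow> expectation (\<lambda>\<omega>. X i \<omega> ^ 2) = 1"
  shows "integrable M (\<lambda>\<omega>. (\<Sum>i\<in>I. X i \<omega>) ^ 2) \<and> expectation (\<lambda>\<omega>. (\<Sum>i\<in>I. X i \<omega>) ^ 2) = card I"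
  using assms
proof (induction I rule: finite_induct)
  case (insert i I)
  have S: "integrable M (\<lambda>\<omega>. \<Sum>i\<in>I. X i \<omega>)"
    using insert.prems by (intro Bochner_Integration.integrable_sum) auto
  have "indep_var borel (X i) borel (\<lambda>\<omega>. \<Sum>i\<in>I. X i \<omega>)"
    using insert by (intro indep_vars_sum) auto
  then have XS: "integrable M (\<lambda>\<omega>. X i \<omega> * (\<Sum>i\<in>I. X i \<omega>))"
    "expectation (\<lambda>\<omega>. X i \<omega> * (\<Sum>i\<in>I. X i \<omega>)) = 0"
    using indep_var_integrable[of "X i" "\<lambda>\<omega>. \<Sum>i\<in>I. X i \<omega>"]
      indep_var_lebesgue_integral[of "X i" "\<lambda>\<omega>. \<Sum>i\<in>I. X i \<omega>"] insert.prems S by auto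
  have IH: "integrable M (\<lambda>\<omega>. (\<Sum>i\<in>I. X i \<omega>) ^ 2)" "expectation (\<lambda>\<omega>. (\<Sum>i\<in>I. X i \<omega>) ^ 2) = card I"
    using insert.IH insert.prems by (auto intro: indep_vars_subset)
  have "(\<Sum>i\<in>insert i I. X i \<omega>) ^ 2 = X i \<omega> ^ 2 + 2 * (X i \<omega> * (\<Sum>i\<in>I. X i \<omega>)) + (\<Sum>i\<in>I. X i \<omega>) ^ 2" for \<omega>
    using insert.hyps by (simp add: power2_sum algebra_simps)
  then show ?case using XS IH insert.prems insert.hyps by simp
qed (simp add: prob_space)

text \<open>Averaging the leave-one-out estimate over \<open>i\<close> compares
  \<open>E (W f W)\<close> with \<open>E (f' W)\<close>, and by Stein's equation their difference is
  the hinge error.\<close>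

lemma hinge_normal_approx_nonneg:
  fixes X :: "nat \<Rightarrow> 'a \<Rightarrow> real"
  assumes n: "0 < n" and indep: "indep_vars (\<lambda>_. borel) X {..<n}"
    and X4: "\<And>i. i < n \<Longrightarrow> integrable M (\<lambda>\<omega>. X i \<omega> ^ 4)" "\<And>i. i < n \<Longrightarrow> expectation (\<lambda>\<omega>. X i \<omega> ^ 4) \<le> K"
    and mean: "\<And>i. i < n \<Longrightarrow> expectation (X i) = 0"
    and var: "\<And>i. i < n \<Longrightarrow> expectation (\<lambda>\<omega>. X i \<omega> ^ 2) = 1" and x: "0 \<le> x"
  defines "W \<equiv> \<lambda>\<omega>. (\<Sum>i<n. X i \<omega>) / sqrt n"
  shows "\<bar>expectation (\<lambda>\<omega>. max 0 (W \<omega> - x)) - gauss_hinge x\<bar> \<le> stein_const * (5 * (1 + K)) / ((1 + x) * sqrt n)"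
proof -
  let ?f = "stein_sol x" and ?f' = "stein_deriv x"
  define s where "s = sqrt (real n)"
  have s: "1 \<le> s" "s * s = real n" using n by (auto simp: s_def)
  have rv: "X i \<in> borel_measurable M" if "i < n" for i
    using indep that unfolding indep_vars_def by auto
  have X1: "integrable M (X i)" and X2: "integrable M (\<lambda>\<omega>. X i \<omega> ^ 2)" if "i < n" for i
    using integrable_power_bound(2)[OF rv[OF that] X4(1)[OF that], of 1]
      integrable_power_bound(2)[OF rv[OF that] X4(1)[OF that], of 2] by auto
  define c where "c = stein_const / (1 + x) / s * (5 * (1 + K))"
  have step: "integrable M (\<lambda>\<omega>. X i \<omega> * ?f (W \<omega>)) \<and> integrable M (\<lambda>\<omega>. ?f' (W \<omega>)) \<and>
      \<bar>s * expectation (\<lambda>\<omega>. X i \<omega> * ?f (W \<omega>)) - expectation (\<lambda>\<omega>. ?f' (W \<omega>))\<bar> \<le> c" if i: "i < n" for i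
  proof -
    define I where "I = {..<n} - {i}"
    have I: "finite I" "i \<notin> I" "insert i I = {..<n}" "real (card I) \<le> real n" using i by (auto simp: I_def)
    define S where "S \<omega> = (\<Sum>j\<in>I. X j \<omega>)" for \<omega>
    have indS: "indep_var borel (X i) borel S"
      unfolding S_def[abs_def] using I indep by (intro indep_vars_sum) auto
    then have ind: "indep_var borel (X i) borel (\<lambda>\<omega>. S \<omega> / s)"
      using indep_var_compose[OF indS, of "\<lambda>u. u" borel "\<lambda>u. u / s" borel] by (simp add: comp_def)
    have S1: "integrable M S" unfolding S_def[abs_def]
      using X1 by (intro Bochner_Integration.integrable_sum) (auto simp: I_def)
    have S2: "integrable M (\<lambda>\<omega>. S \<omega> ^ 2)" "expectation (\<lambda>\<omega>. S \<omega> ^ 2) = card I"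
      using indep_sum_second_moment[of I X] I(1) indep X1 X2 mean var
      unfolding S_def by (auto simp: I_def intro: indep_vars_subset)
    \<comment> \<open>From \<open>|y| \<le> (1 + y^2) / 2\<close> and additivity of variances over
      the \<open>n - 1\<close> remaining summands.\<close>
    have "expectation (\<lambda>\<omega>. \<bar>S \<omega> / s\<bar>) \<le> expectation (\<lambda>\<omega>. (1 + S \<omega> ^ 2 / n) / 2)"
    proof (rule integral_mono)
      fix \<omega>
      have "0 \<le> (\<bar>S \<omega> / s\<bar> - 1) ^ 2" by simp
      also have "\<dots> = (S \<omega> / s) ^ 2 + 1 - 2 * \<bar>S \<omega> / s\<bar>"
        by (simp add: power2_diff del: abs_divide)
      also have "(S \<omega> / s) ^ 2 = S \<omega> ^ 2 / n" using s by (simp add: power_divide power2_eq_square)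
      finally show "\<bar>S \<omega> / s\<bar> \<le> (1 + S \<omega> ^ 2 / n) / 2" by argo
    qed (use S1 S2 in auto)
    also have "\<dots> = (1 + real (card I) / n) / 2" using S2 by (simp add: prob_space)
    also have "\<dots> \<le> 1" using I n by simp
    finally have R: "expectation (\<lambda>\<omega>. \<bar>S \<omega> / s\<bar>) \<le> 1" .
    have W: "W \<omega> = S \<omega> / s + X i \<omega> / s" for \<omega>
      unfolding W_def I(3)[symmetric] s_def[symmetric] S_def using I(1,2) by (simp add: add_divide_distrib)
    show ?thesis
      unfolding W c_def
      using stein_leave_one_out[OF ind X4[OF i] mean[OF i] var[OF i] _ R s(1) x] S1 by auto
  qed
  have f'W: "integrable M (\<lambda>\<omega>. ?f' (W \<omega>))" using step[of 0] n by auto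
  have WfW: "W \<omega> * ?f (W \<omega>) = (\<Sum>i<n. s / n * (X i \<omega> * ?f (W \<omega>)))" for \<omega>
    unfolding sum_distrib_left[symmetric] sum_distrib_right[symmetric] using s n
    by (simp add: W_def s_def field_simps)
  have WfW_int: "integrable M (\<lambda>\<omega>. W \<omega> * ?f (W \<omega>))"
    unfolding WfW using step by (intro Bochner_Integration.integrable_sum integrable_mult_right) auto
  have "expectation (\<lambda>\<omega>. W \<omega> * ?f (W \<omega>)) = (\<Sum>i<n. s / n * expectation (\<lambda>\<omega>. X i \<omega> * ?f (W \<omega>)))"
    unfolding WfW using step by (subst Bochner_Integration.integral_sum) auto
  also have "\<dots> = (\<Sum>i<n. s * expectation (\<lambda>\<omega>. X i \<omega> * ?f (W \<omega>))) / n"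
    by (simp add: sum_divide_distrib)
  finally have "expectation (\<lambda>\<omega>. W \<omega> * ?f (W \<omega>)) - expectation (\<lambda>\<omega>. ?f' (W \<omega>))
      = (\<Sum>i<n. s * expectation (\<lambda>\<omega>. X i \<omega> * ?f (W \<omega>)) - expectation (\<lambda>\<omega>. ?f' (W \<omega>))) / n"
    using n by (simp add: sum_subtractf diff_divide_distrib)
  then have "\<bar>expectation (\<lambda>\<omega>. W \<omega> * ?f (W \<omega>)) - expectation (\<lambda>\<omega>. ?f' (W \<omega>))\<bar>
      = \<bar>\<Sum>i<n. s * expectation (\<lambda>\<omega>. X i \<omega> * ?f (W \<omega>)) - expectation (\<lambda>\<omega>. ?f' (W \<omega>))\<bar> / n"
    by (simp add: abs_divide)
  also have "\<dots> \<le> (\<Sum>i<n. c) / n"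
    using step by (intro divide_right_mono order_trans[OF sum_abs] sum_mono) auto
  also have "\<dots> = c" using n by simp
  finally have main: "\<bar>expectation (\<lambda>\<omega>. W \<omega> * ?f (W \<omega>)) - expectation (\<lambda>\<omega>. ?f' (W \<omega>))\<bar> \<le> c" .
  have "max 0 (W \<omega> - x) = ?f' (W \<omega>) - W \<omega> * ?f (W \<omega>) + gauss_hinge x" for \<omega>
    using stein_equation[of x "W \<omega>"] by linarith
  then have "expectation (\<lambda>\<omega>. max 0 (W \<omega> - x)) = expectation (\<lambda>\<omega>. ?f' (W \<omega>)) - expectation (\<lambda>\<omega>. W \<omega> * ?f (W \<omega>)) + gauss_hinge x"
    using f'W WfW_int by (simp add: prob_space)
  with main have "\<bar>expectation (\<lambda>\<omega>. max 0 (W \<omega> - x)) - gauss_hinge x\<bar> \<le> c" by linarith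
  then show ?thesis by (simp add: c_def s_def)
qed

text \<open>Negative \<open>x\<close> is reduced to \<open>- x\<close> by the reflection
  \<open>(W - x)_+ = W - x + (- W + x)_+\<close> with \<open>E W = 0\<close>, matching
  \<open>gauss_hinge_uminus\<close>.\<close>

lemma hinge_normal_approx:
  fixes X :: "nat \<Rightarrow> 'a \<Rightarrow> real"
  assumes n: "0 < n" and indep: "indep_vars (\<lambda>_. borel) X {..<n}"
    and X4: "\<And>i. i < n \<Longrightarrow> integrable M (\<lambda>\<omega>. X i \<omega> ^ 4)" "\<And>i. i < n \<Longrightarrow> expectation (\<lambda>\<omega>. X i \<omega> ^ 4) \<le> K"
    and mean: "\<And>i. i < n \<Longrightarrow> expectation (X i) = 0"
    and var: "\<And>i. i < n \<Longrightarrow> expectation (\<lambda>\<omega>. X i \<omega> ^ 2) = 1"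
  defines "W \<equiv> \<lambda>\<omega>. (\<Sum>i<n. X i \<omega>) / sqrt n"
  shows "\<bar>expectation (\<lambda>\<omega>. max 0 (W \<omega> - x)) - gauss_hinge x\<bar>
    \<le> stein_const * (5 * (1 + K)) / ((1 + \<bar>x\<bar>) * sqrt n)"
proof (cases "0 \<le> x")
  case True
  then show ?thesis
    unfolding W_def using hinge_normal_approx_nonneg[OF n indep X4 mean var, of x] by simp
next
  case False
  define V where "V \<omega> = (\<Sum>i<n. - X i \<omega>) / sqrt n" for \<omega>
  have V: "V \<omega> = - W \<omega>" for \<omega> by (simp add: V_def W_def sum_negf)
  have rv: "X i \<in> borel_measurable M" if "i < n" for i
    using indep that unfolding indep_vars_def by auto
  have X1: "integrable M (X i)" if "i < n" for i
    using integrable_power_bound(2)[OF rv[OF that] X4(1)[OF that], of 1] by simp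
  then have W: "integrable M W" "expectation W = 0"
    unfolding W_def using mean
    by (auto simp: Bochner_Integration.integral_sum intro!: Bochner_Integration.integrable_sum
        integrable_divide)
  have "indep_vars (\<lambda>_. borel) (\<lambda>i \<omega>. - X i \<omega>) {..<n}"
    using indep_vars_compose2[OF indep, of "\<lambda>_ u. - u" "\<lambda>_. borel"] by simp
  then have "\<bar>expectation (\<lambda>\<omega>. max 0 (V \<omega> - (- x))) - gauss_hinge (- x)\<bar>
      \<le> stein_const * (5 * (1 + K)) / ((1 + (- x)) * sqrt n)"
    unfolding V_def using X4 mean var False by (intro hinge_normal_approx_nonneg n) auto
  moreover have "max 0 (W \<omega> - x) = W \<omega> - x + max 0 (V \<omega> - (- x))" for \<omega>
    by (simp add: V max_def)
  then have "expectation (\<lambda>\<omega>. max 0 (W \<omega> - x)) = - x + expectation (\<lambda>\<omega>. max 0 (V \<omega> - (- x)))"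
    using W by (simp add: V prob_space)
  ultimately show ?thesis using False by (simp add: gauss_hinge_uminus)
qed

end

section \<open>The random-shuffling likelihood ratio\<close>

lemma measurable_normal1 [simp]: "measurable (normal1 m) N = measurable borel N"
  by (rule measurable_cong_sets) auto

lemma indep_vars_PiM_coordinates:
  assumes "finite I" "I \<noteq> {}" and M: "\<And>i. i \<in> I \<Longrightarrow> prob_space (M i)"
  shows "prob_space.indep_vars (PiM I M) M (\<lambda>i x. x i) I"
proof -
  interpret P: prob_space "PiM I M" by (rule prob_space_PiM[OF M])
  have "distr (PiM I M) (PiM I M) (\<lambda>x. \<lambda>i\<in>I. x i) = distr (PiM I M) (PiM I M) (\<lambda>x. x)"
    by (rule distr_cong) (auto simp: space_PiM PiE_restrict)
  also have "\<dots> = PiM I M" by simp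
  also have "\<dots> = PiM I (\<lambda>i. distr (PiM I M) (M i) (\<lambda>x. x i))"
    by (intro PiM_cong refl distr_PiM_component[OF M, symmetric])
  finally show ?thesis
    using assms by (subst P.indep_vars_iff_distr_eq_PiM') auto
qed

text \<open>Checked on measurable boxes, where the integrand factorises over the
  coordinates.\<close>

lemma PiM_density:
  fixes P :: "'i \<Rightarrow> 'a measure" and L :: "'i \<Rightarrow> 'a \<Rightarrow> ennreal"
  assumes I: "finite I" and P: "\<And>i. prob_space (P i)"
    and L [measurable]: "\<And>i. L i \<in> borel_measurable (P i)"
    and Q: "\<And>i. prob_space (density (P i) (L i))"
  shows "PiM I (\<lambda>i. density (P i) (L i)) = density (PiM I P) (\<lambda>x. \<Prod>i\<in>I. L i (x i))"
proof -
  interpret P: product_sigma_finite P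
    by (rule product_sigma_finite.intro) (use P prob_space_imp_sigma_finite in auto)
  interpret Q: product_sigma_finite "\<lambda>i. density (P i) (L i)"
    by (rule product_sigma_finite.intro) (use Q prob_space_imp_sigma_finite in auto)
  show ?thesis
  proof (rule Q.PiM_eqI[symmetric])
    show "sets (density (PiM I P) (\<lambda>x. \<Prod>i\<in>I. L i (x i))) = sets (PiM I (\<lambda>i. density (P i) (L i)))"
      by (auto intro!: sets_PiM_cong)
    fix A assume A: "\<And>i. i \<in> I \<Longrightarrow> A i \<in> sets (density (P i) (L i))"
    then have [measurable]: "\<And>i. i \<in> I \<Longrightarrow> A i \<in> sets (P i)" by simp
    have "emeasure (density (PiM I P) (\<lambda>x. \<Prod>i\<in>I. L i (x i))) (Pi\<^sub>E I A)
        = (\<integral>\<^sup>+x. (\<Prod>i\<in>I. L i (x i)) * indicator (Pi\<^sub>E I A) x \<partial>PiM I P)"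
      using I by (intro emeasure_density) (auto intro!: sets_PiM_I_finite)
    also have "\<dots> = (\<integral>\<^sup>+x. (\<Prod>i\<in>I. L i (x i) * indicator (A i) (x i)) \<partial>PiM I P)"
    proof (intro nn_integral_cong)
      fix x assume "x \<in> space (PiM I P)"
      then have "indicator (Pi\<^sub>E I A) x = (\<Prod>i\<in>I. indicator (A i) (x i) :: ennreal)"
        using I by (auto simp: indicator_def space_PiM PiE_iff prod_zero_iff)
      then show "(\<Prod>i\<in>I. L i (x i)) * indicator (Pi\<^sub>E I A) x = (\<Prod>i\<in>I. L i (x i) * indicator (A i) (x i))"
        by (simp add: prod.distrib)
    qed
    also have "\<dots> = (\<Prod>i\<in>I. \<integral>\<^sup>+x. L i x * indicator (A i) x \<partial>P i)"
      using I by (intro P.product_nn_integral_prod) auto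
    also have "\<dots> = (\<Prod>i\<in>I. emeasure (density (P i) (L i)) (A i))"
      by (intro prod.cong refl emeasure_density[symmetric]) auto
    finally show "emeasure (density (PiM I P) (\<lambda>x. \<Prod>i\<in>I. L i (x i))) (Pi\<^sub>E I A)
        = (\<Prod>i\<in>I. emeasure (density (P i) (L i)) (A i))" .
  qed (rule I)
qed

text \<open>With \<open>\<tau> = 1 / \<sigma>\<close> this is the density of \<open>P1\<close> with
  respect to \<open>P0\<close>: the mixture over \<open>J\<close> averages the ratios of the laws
  with one shifted coordinate.\<close>

definition shuffle_ratio :: "real \<Rightarrow> nat \<Rightarrow> (nat \<Rightarrow> real) \<Rightarrow> real" where
  "shuffle_ratio \<tau> M x = (\<Sum>i<M. exp (\<tau> * x i - \<tau>\<^sup>2 / 2)) / M"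

lemma prob_space_P0: "prob_space (P0 M)"
  unfolding P0_def by (rule prob_space_PiM) (rule prob_space_normal1)

lemma P0_component_measurable [measurable]: "i < M \<Longrightarrow> (\<lambda>x. x i) \<in> borel_measurable (P0 M)"
  unfolding P0_def
  using measurable_component_singleton[of i "{..<M}" "\<lambda>_. normal1 0"] by (simp cong: measurable_cong_sets)

lemma shuffle_ratio_measurable [measurable]: "shuffle_ratio \<tau> M \<in> borel_measurable (P0 M)"
  unfolding shuffle_ratio_def[abs_def] by measurable

lemma PiM_one_shifted:
  assumes "J < M"
  shows "PiM {..<M} (\<lambda>i. if i = J then normal1 \<tau> else normal1 0)
    = density (P0 M) (\<lambda>x. ennreal (exp (\<tau> * x J - \<tau>\<^sup>2 / 2)))"
proof -
  define m where "m i = (if i = J then \<tau> else 0)" for i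
  have "PiM {..<M} (\<lambda>i. if i = J then normal1 \<tau> else normal1 0)
      = PiM {..<M} (\<lambda>i. density (normal1 0) (\<lambda>z. ennreal (exp (m i * z - (m i)\<^sup>2 / 2))))"
    by (intro PiM_cong refl) (simp add: m_def flip: normal1_eq_density)
  also have "\<dots> = density (P0 M) (\<lambda>x. \<Prod>i<M. ennreal (exp (m i * x i - (m i)\<^sup>2 / 2)))"
    unfolding P0_def by (intro PiM_density) (auto simp: prob_space_normal1 simp flip: normal1_eq_density)
  also have "(\<lambda>x. \<Prod>i<M. ennreal (exp (m i * x i - (m i)\<^sup>2 / 2)))
      = (\<lambda>x. \<Prod>i<M. if i = J then ennreal (exp (\<tau> * x J - \<tau>\<^sup>2 / 2)) else 1)"
    by (intro ext prod.cong) (auto simp: m_def)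
  also have "\<dots> = (\<lambda>x. ennreal (exp (\<tau> * x J - \<tau>\<^sup>2 / 2)))"
    using assms by simp
  finally show ?thesis .
qed

lemma prob_space_one_shifted:
  "prob_space (PiM {..<M} (\<lambda>i. if i = J then normal1 \<tau> else normal1 0))"
  by (rule prob_space_PiM) (auto simp: prob_space_normal1)

lemma P1_eq_density:
  assumes M: "0 < M"
  shows "P1 \<sigma> M = density (P0 M) (\<lambda>x. ennreal (shuffle_ratio (1 / \<sigma>) M x))"
proof (rule measure_eqI)
  let ?K = "\<lambda>J. PiM {..<M} (\<lambda>i. if i = J then normal1 (1 / \<sigma>) else normal1 0)"
  let ?g = "\<lambda>J x. exp (1 / \<sigma> * x J - (1 / \<sigma>)\<^sup>2 / 2)"
  let ?p = "measure_pmf (pmf_of_set {..<M})"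
  have sets_K: "sets (?K J) = sets (P0 M)" for J
    unfolding P0_def by (rule sets_PiM_cong) auto
  have K: "?K \<in> measurable ?p (subprob_algebra (P0 M))"
    using prob_space_one_shifted sets_K
    by (auto simp: space_subprob_algebra intro: prob_space_imp_subprob_space)
  have sets_P1: "sets (P1 \<sigma> M) = sets (P0 M)"
    unfolding P1_def by (rule sets_bind) (use sets_K in auto)
  then show "sets (P1 \<sigma> M) = sets (density (P0 M) (\<lambda>x. ennreal (shuffle_ratio (1 / \<sigma>) M x)))"
    by simp
  fix A assume "A \<in> sets (P1 \<sigma> M)"
  with sets_P1 have A [measurable]: "A \<in> sets (P0 M)" by simp
  have "emeasure (P1 \<sigma> M) A = (\<integral>\<^sup>+J. emeasure (?K J) A \<partial>?p)"
    unfolding P1_def using A by (intro emeasure_bind[OF _ K]) auto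
  also have "\<dots> = (\<Sum>J<M. emeasure (?K J) A) / M"
    using M by (subst nn_integral_pmf_of_set) (auto simp: ennreal_of_nat_eq_real_of_nat)
  also have "(\<Sum>J<M. emeasure (?K J) A) = (\<Sum>J<M. \<integral>\<^sup>+x. ennreal (?g J x) * indicator A x \<partial>P0 M)"
    by (intro sum.cong refl) (simp add: PiM_one_shifted emeasure_density A)
  also have "\<dots> = (\<integral>\<^sup>+x. (\<Sum>J<M. ennreal (?g J x) * indicator A x) \<partial>P0 M)"
    by (rule nn_integral_sum[symmetric]) measurable
  also have "\<dots> / M = (\<integral>\<^sup>+x. (\<Sum>J<M. ennreal (?g J x) * indicator A x) / M \<partial>P0 M)"
    by (rule nn_integral_divide[symmetric]) measurable
  also have "\<dots> = (\<integral>\<^sup>+x. ennreal (shuffle_ratio (1 / \<sigma>) M x) * indicator A x \<partial>P0 M)"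
  proof (intro nn_integral_cong)
    fix x
    show "(\<Sum>J<M. ennreal (?g J x) * indicator A x) / M = ennreal (shuffle_ratio (1 / \<sigma>) M x) * indicator A x"
      using M by (auto simp: indicator_def shuffle_ratio_def sum_nonneg divide_ennreal
          ennreal_of_nat_eq_real_of_nat sum_ennreal)
  qed
  also have "\<dots> = emeasure (density (P0 M) (\<lambda>x. ennreal (shuffle_ratio (1 / \<sigma>) M x))) A"
    by (simp add: emeasure_density A)
  finally show "emeasure (P1 \<sigma> M) A = emeasure (density (P0 M) (\<lambda>x. ennreal (shuffle_ratio (1 / \<sigma>) M x))) A" .
qed

lemma shuffle_likelihood_ratio:
  assumes M: "0 < M"
  shows "likelihood_ratio (P0 M) (shuffle_ratio \<tau> M)"
proof -
  interpret P: prob_space "P0 M" by (rule prob_space_P0)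
  show ?thesis
  proof
    show "0 \<le> shuffle_ratio \<tau> M x" for x by (simp add: shuffle_ratio_def sum_nonneg)
    have "(\<integral>\<^sup>+x. ennreal (exp (\<tau> * x J - \<tau>\<^sup>2 / 2)) \<partial>P0 M) = 1" if "J < M" for J
      using prob_space.emeasure_space_1[OF prob_space_one_shifted[of M J \<tau>]] that
      by (subst (asm) PiM_one_shifted[OF that], subst (asm) emeasure_density)
         (auto simp: PiM_one_shifted cong: nn_integral_cong_simp)
    then have "(\<Sum>J<M. \<integral>\<^sup>+x. ennreal (exp (\<tau> * x J - \<tau>\<^sup>2 / 2)) \<partial>P0 M) / M = of_nat M / of_nat M"
      by (simp add: ennreal_of_nat_eq_real_of_nat)
    also have "\<dots> = 1"
      using M by (intro ennreal_divide_self) (auto simp: ennreal_of_nat_eq_real_of_nat)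
    finally have one: "(\<Sum>J<M. \<integral>\<^sup>+x. ennreal (exp (\<tau> * x J - \<tau>\<^sup>2 / 2)) \<partial>P0 M) / M = 1" .
    have "(\<integral>\<^sup>+x. ennreal (shuffle_ratio \<tau> M x) \<partial>P0 M)
        = (\<integral>\<^sup>+x. (\<Sum>J<M. ennreal (exp (\<tau> * x J - \<tau>\<^sup>2 / 2))) / M \<partial>P0 M)"
      using M by (intro nn_integral_cong) (simp add: shuffle_ratio_def sum_nonneg divide_ennreal
          ennreal_of_nat_eq_real_of_nat sum_ennreal)
    also have "\<dots> = (\<integral>\<^sup>+x. (\<Sum>J<M. ennreal (exp (\<tau> * x J - \<tau>\<^sup>2 / 2))) \<partial>P0 M) / M"
      by (rule nn_integral_divide) measurable
    also have "(\<integral>\<^sup>+x. (\<Sum>J<M. ennreal (exp (\<tau> * x J - \<tau>\<^sup>2 / 2))) \<partial>P0 M)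
        = (\<Sum>J<M. \<integral>\<^sup>+x. ennreal (exp (\<tau> * x J - \<tau>\<^sup>2 / 2)) \<partial>P0 M)"
      by (rule nn_integral_sum) measurable
    also note one
    finally show "(\<integral>\<^sup>+x. ennreal (shuffle_ratio \<tau> M x) \<partial>P0 M) = 1" .
  qed measurable
qed

section \<open>Moments of the lognormal summands and the hinge of the shuffling ratio\<close>

lemma exp_moment_normal1:
  "integrable (normal1 0) (\<lambda>z. exp (\<tau> * z))" "(\<integral>z. exp (\<tau> * z) \<partial>normal1 0) = exp (\<tau>\<^sup>2 / 2)"
proof -
  have *: "exp (\<tau> * z) = exp (\<tau>\<^sup>2 / 2) * exp (\<tau> * z - \<tau>\<^sup>2 / 2)" for z
    by (simp flip: exp_add)
  show "integrable (normal1 0) (\<lambda>z. exp (\<tau> * z))"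
    unfolding * using gauss.integrable_L[of \<tau>] by simp
  show "(\<integral>z. exp (\<tau> * z) \<partial>normal1 0) = exp (\<tau>\<^sup>2 / 2)"
    unfolding * using gauss.integral_L[of \<tau>] by simp
qed

text \<open>The variable \<open>exp (\<tau> Z - \<tau>^2 / 2)\<close> has mean \<open>1\<close> and
  variance \<open>exp (\<tau>^2) - 1\<close>; here it is standardised.\<close>

definition std_lognormal :: "real \<Rightarrow> real \<Rightarrow> real" where
  "std_lognormal \<tau> u = (exp (\<tau> * u - \<tau>\<^sup>2 / 2) - 1) / sqrt (exp (\<tau>\<^sup>2) - 1)"

lemma std_lognormal_measurable [measurable]: "std_lognormal \<tau> \<in> borel_measurable borel"
  unfolding std_lognormal_def by measurable

lemma std_lognormal_moments:
  assumes "\<tau> \<noteq> 0"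
  shows "integrable (normal1 0) (\<lambda>u. std_lognormal \<tau> u ^ 4)"
    and "(\<integral>u. std_lognormal \<tau> u \<partial>normal1 0) = 0"
    and "(\<integral>u. std_lognormal \<tau> u ^ 2 \<partial>normal1 0) = 1"
proof -
  define v where "v = exp (\<tau>\<^sup>2) - 1"
  have v: "0 < v" using assms by (simp add: v_def)
  define Y where "Y u = exp (\<tau> * u - \<tau>\<^sup>2 / 2)" for u
  have Y_pow: "Y u ^ k = exp (- (k * \<tau>\<^sup>2 / 2)) * exp (k * \<tau> * u)" for k :: nat and u
    unfolding Y_def by (simp add: algebra_simps flip: exp_of_nat_mult exp_add)
  have int: "integrable (normal1 0) (\<lambda>u. Y u ^ k)" for k :: nat
    unfolding Y_pow using exp_moment_normal1(1)[of "k * \<tau>"] by simp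
  have Y1: "(\<integral>u. Y u \<partial>normal1 0) = 1" "integrable (normal1 0) Y"
    using gauss.integral_L[of \<tau>] gauss.integrable_L[of \<tau>] by (simp_all add: Y_def[abs_def])
  have "(\<integral>u. Y u ^ 2 \<partial>normal1 0) = exp (- \<tau>\<^sup>2) * exp ((2 * \<tau>)\<^sup>2 / 2)"
    using exp_moment_normal1[of "2 * \<tau>"] unfolding Y_pow[of _ 2] by simp
  also have "\<dots> = exp (\<tau>\<^sup>2)" by (simp add: power_mult_distrib flip: exp_add)
  finally have Y2: "(\<integral>u. Y u ^ 2 \<partial>normal1 0) = exp (\<tau>\<^sup>2)" .
  have xi: "std_lognormal \<tau> u = (Y u - 1) / sqrt v" for u
    by (simp add: std_lognormal_def Y_def v_def)
  have "(Y u - 1) ^ 4 = Y u ^ 4 - 4 * Y u ^ 3 + 6 * Y u ^ 2 - 4 * Y u ^ 1 + 1" for u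
    by algebra
  then show "integrable (normal1 0) (\<lambda>u. std_lognormal \<tau> u ^ 4)"
    unfolding xi power_divide using int[of 4] int[of 3] int[of 2] int[of 1] by simp
  show "(\<integral>u. std_lognormal \<tau> u \<partial>normal1 0) = 0"
    unfolding xi using Y1 gauss.prob_space by simp
  have "(Y u - 1) ^ 2 = Y u ^ 2 - 2 * Y u + 1" for u by (simp add: power2_diff)
  then show "(\<integral>u. std_lognormal \<tau> u ^ 2 \<partial>normal1 0) = 1"
    unfolding xi power_divide using Y1 Y2 int[of 2] v gauss.prob_space by (simp add: v_def)
qed

lemma integral_P0_component:
  fixes g :: "real \<Rightarrow> real"
  assumes [measurable]: "g \<in> borel_measurable borel" and i: "i < M"
  shows "(\<integral>x. g (x i) \<partial>P0 M) = (\<integral>u. g u \<partial>normal1 0)"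
    and "integrable (P0 M) (\<lambda>x. g (x i)) \<longleftrightarrow> integrable (normal1 0) g"
proof -
  have d: "distr (P0 M) (normal1 0) (\<lambda>x. x i) = normal1 0"
    unfolding P0_def using i by (intro distr_PiM_component) (auto simp: prob_space_normal1)
  have m: "(\<lambda>x. x i) \<in> measurable (P0 M) (normal1 0)"
    unfolding P0_def using i by (intro measurable_component_singleton) auto
  have g: "g \<in> borel_measurable (normal1 0)" by simp
  show "(\<integral>x. g (x i) \<partial>P0 M) = (\<integral>u. g u \<partial>normal1 0)"
    using integral_distr[OF m g] by (simp add: d)
  show "integrable (P0 M) (\<lambda>x. g (x i)) \<longleftrightarrow> integrable (normal1 0) g"
    using integrable_distr_eq[OF m g] by (simp add: d)
qed

lemma max_scaled:
  fixes m :: real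
  assumes "0 < m" shows "max 0 (1 + m * z - t) = m * max 0 (z - (t - 1) / m)"
proof -
  have "m * (z - (t - 1) / m) = 1 + m * z - t" using assms by (simp add: field_simps)
  then show ?thesis using assms by (simp add: max_mult_distrib_left)
qed

lemma shuffle_hinge_approx:
  assumes \<tau>: "\<tau> \<noteq> 0" and M: "0 < M"
  defines "s \<equiv> sqrt ((exp (\<tau>\<^sup>2) - 1) / M)"
  shows "\<bar>likelihood_ratio.hinge (P0 M) (shuffle_ratio \<tau> M) t - s * gauss_hinge ((t - 1) / s)\<bar>
    \<le> s * (stein_const * (5 * (1 + (\<integral>u. std_lognormal \<tau> u ^ 4 \<partial>normal1 0))) / ((1 + \<bar>(t - 1) / s\<bar>) * sqrt M))"
proof -
  interpret likelihood_ratio "P0 M" "shuffle_ratio \<tau> M" by (rule shuffle_likelihood_ratio[OF M])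
  define v where "v = exp (\<tau>\<^sup>2) - 1"
  have v: "0 < v" using \<tau> by (simp add: v_def)
  have s: "0 < s" unfolding s_def using v M by (simp add: v_def)
  define X where "X i x = std_lognormal \<tau> (x i)" for i and x :: "nat \<Rightarrow> real"
  have "{..<M} \<noteq> {}" using M by auto
  then have "indep_vars (\<lambda>_. normal1 0) (\<lambda>i x. x i) {..<M}"
    unfolding P0_def by (intro indep_vars_PiM_coordinates) (auto simp: prob_space_normal1)
  then have indep: "indep_vars (\<lambda>_. borel) X {..<M}"
    unfolding X_def[abs_def] by (rule indep_vars_compose2) auto
  have moments: "integrable (P0 M) (\<lambda>x. X i x ^ 4)"
    "expectation (\<lambda>x. X i x ^ 4) = (\<integral>u. std_lognormal \<tau> u ^ 4 \<partial>normal1 0)"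
    "expectation (X i) = 0" "expectation (\<lambda>x. X i x ^ 2) = 1" if "i < M" for i
    using std_lognormal_moments[OF \<tau>] that
      integral_P0_component[of "\<lambda>u. std_lognormal \<tau> u ^ 4" i M]
      integral_P0_component[of "\<lambda>u. std_lognormal \<tau> u" i M]
      integral_P0_component[of "\<lambda>u. std_lognormal \<tau> u ^ 2" i M]
    by (auto simp: X_def[abs_def])
  define W where "W x = (\<Sum>i<M. X i x) / sqrt M" for x
  have approx: "\<bar>expectation (\<lambda>x. max 0 (W x - y)) - gauss_hinge y\<bar>
      \<le> stein_const * (5 * (1 + (\<integral>u. std_lognormal \<tau> u ^ 4 \<partial>normal1 0))) / ((1 + \<bar>y\<bar>) * sqrt M)" for y
    unfolding W_def using M indep
    by (rule hinge_normal_approx) (simp_all add: moments)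
  have ratio: "shuffle_ratio \<tau> M x = 1 + s * W x" for x
  proof -
    have "s * W x = sqrt v * (\<Sum>i<M. X i x) / M"
      using M by (simp add: s_def W_def v_def real_sqrt_divide)
    also have "\<dots> = (\<Sum>i<M. exp (\<tau> * x i - \<tau>\<^sup>2 / 2) - 1) / M"
      using v by (simp add: X_def std_lognormal_def v_def sum_distrib_left)
    also have "\<dots> = shuffle_ratio \<tau> M x - 1"
      using M by (simp add: shuffle_ratio_def sum_subtractf diff_divide_distrib)
    finally show ?thesis by simp
  qed
  have "max 0 (shuffle_ratio \<tau> M x - t) = s * max 0 (W x - (t - 1) / s)" for x
    using max_scaled[OF s, of "W x" t] by (simp add: ratio)
  then have "hinge t = s * expectation (\<lambda>x. max 0 (W x - (t - 1) / s))"
    by (simp add: hinge_def)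
  then have "\<bar>hinge t - s * gauss_hinge ((t - 1) / s)\<bar>
      = s * \<bar>expectation (\<lambda>x. max 0 (W x - (t - 1) / s)) - gauss_hinge ((t - 1) / s)\<bar>"
    using s by (simp add: abs_mult flip: right_diff_distrib)
  also have "\<dots> \<le> s * (stein_const * (5 * (1 + (\<integral>u. std_lognormal \<tau> u ^ 4 \<partial>normal1 0))) / ((1 + \<bar>(t - 1) / s\<bar>) * sqrt M))"
    by (rule mult_left_mono[OF approx]) (use s in simp)
  finally show ?thesis .
qed

section \<open>Linearisation of the Gaussian likelihood ratio\<close>

text \<open>The hinges differ only if \<open>r\<close> or \<open>a\<close> passes \<open>t\<close>,
  and then \<open>|t - 1|\<close> is at most the distance of one of them from \<open>1\<close>. For
  \<open>t < 1\<close> the difference \<open>r - a\<close>, which has mean \<open>0\<close> in the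
  application, is removed and the picture is reflected at \<open>1\<close>. This produces the decay
  in \<open>t\<close>.\<close>

lemma hinge_diff_pointwise:
  fixes r a t :: real
  shows "t \<ge> 1 \<Longrightarrow> \<bar>t - 1\<bar> * \<bar>max 0 (r - t) - max 0 (a - t)\<bar> \<le> \<bar>r - a\<bar> * (\<bar>r - 1\<bar> + \<bar>a - 1\<bar>)"
    and "t < 1 \<Longrightarrow> \<bar>t - 1\<bar> * \<bar>max 0 (r - t) - max 0 (a - t) - (r - a)\<bar> \<le> \<bar>r - a\<bar> * (\<bar>r - 1\<bar> + \<bar>a - 1\<bar>)"
proof -
  have upper: "\<bar>t - 1\<bar> * \<bar>max 0 (r - t) - max 0 (a - t)\<bar> \<le> \<bar>r - a\<bar> * (\<bar>r - 1\<bar> + \<bar>a - 1\<bar>)"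
    if "t \<ge> 1" for r a t :: real
  proof (cases "r \<le> t \<and> a \<le> t")
    case False
    have "\<bar>max 0 (r - t) - max 0 (a - t)\<bar> \<le> \<bar>r - a\<bar>" by (auto simp: max_def)
    moreover have "\<bar>t - 1\<bar> \<le> \<bar>r - 1\<bar> + \<bar>a - 1\<bar>" using False that by auto
    ultimately show ?thesis
      by (subst mult.commute[of "\<bar>r - a\<bar>"]) (intro mult_mono, auto)
  qed (simp add: max_absorb1)
  show "t \<ge> 1 \<Longrightarrow> \<bar>t - 1\<bar> * \<bar>max 0 (r - t) - max 0 (a - t)\<bar> \<le> \<bar>r - a\<bar> * (\<bar>r - 1\<bar> + \<bar>a - 1\<bar>)"
    by (rule upper)
  assume t: "t < 1"
  have "max 0 (r - t) - max 0 (a - t) - (r - a) = max 0 ((2 - r) - (2 - t)) - max 0 ((2 - a) - (2 - t))"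
    by (auto simp: max_def)
  moreover have "\<bar>(2 - t) - 1\<bar> * \<bar>max 0 ((2 - r) - (2 - t)) - max 0 ((2 - a) - (2 - t))\<bar>
      \<le> \<bar>(2 - r) - (2 - a)\<bar> * (\<bar>(2 - r) - 1\<bar> + \<bar>(2 - a) - 1\<bar>)"
    using t by (intro upper) simp
  ultimately show "\<bar>t - 1\<bar> * \<bar>max 0 (r - t) - max 0 (a - t) - (r - a)\<bar> \<le> \<bar>r - a\<bar> * (\<bar>r - 1\<bar> + \<bar>a - 1\<bar>)"
    by (simp add: abs_minus_commute)
qed

lemma normal1_moments:
  "integrable (normal1 m) (\<lambda>z. z)" "(\<integral>z. z \<partial>normal1 m) = m"
  "integrable (normal1 0) (\<lambda>z. z ^ 2)" "(\<integral>z. z ^ 2 \<partial>normal1 0) = 1"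
proof -
  show "integrable (normal1 m) (\<lambda>z. z)" "(\<integral>z. z \<partial>normal1 m) = m"
    using integrable_normal_moment_nz_1[of 1 m] integral_normal_moment_nz_1[of 1 m]
    by (simp_all add: integrable_normal1 integral_normal1)
  show "integrable (normal1 0) (\<lambda>z. z ^ 2)" "(\<integral>z. z ^ 2 \<partial>normal1 0) = 1"
    using integrable_std_normal_moment[of 2] integral_std_normal_moment_even[of 1]
    by (simp_all add: integrable_normal1 integral_normal1)
qed

text \<open>The second moment equals \<open>exp (m^2) - 1 - m^2\<close>, and
  \<open>exp y \<le> 1 + y + y^2\<close> on the unit interval.\<close>

lemma gauss_ratio_linearization:
  assumes m: "0 \<le> m" "m \<le> 1"
  defines "R \<equiv> \<lambda>z. exp (m * z - m\<^sup>2 / 2)"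
  shows "integrable (normal1 0) (\<lambda>z. (R z - (1 + m * z))\<^sup>2)"
    and "(\<integral>z. (R z - (1 + m * z))\<^sup>2 \<partial>normal1 0) \<le> m ^ 4"
proof -
  have R: "integrable (normal1 0) R" "(\<integral>z. R z \<partial>normal1 0) = 1"
    unfolding R_def by (rule gauss.integrable_L gauss.integral_L)+
  have *: "R z ^ 2 = exp (- m\<^sup>2) * exp (2 * m * z)" for z
    unfolding R_def by (simp add: power2_eq_square field_simps flip: exp_add)
  have R2: "integrable (normal1 0) (\<lambda>z. R z ^ 2)" "(\<integral>z. R z ^ 2 \<partial>normal1 0) = exp (m\<^sup>2)"
  proof -
    show "integrable (normal1 0) (\<lambda>z. R z ^ 2)"
      unfolding * using exp_moment_normal1[of "2 * m"] by simp
    have "(\<integral>z. R z ^ 2 \<partial>normal1 0) = exp (- m\<^sup>2) * exp ((2 * m)\<^sup>2 / 2)"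
      unfolding * using exp_moment_normal1[of "2 * m"] by simp
    also have "\<dots> = exp (m\<^sup>2)" by (simp add: power_mult_distrib flip: exp_add)
    finally show "(\<integral>z. R z ^ 2 \<partial>normal1 0) = exp (m\<^sup>2)" .
  qed
  have "integrable (density (normal1 0) (\<lambda>z. ennreal (R z))) (\<lambda>z. z)"
    using normal1_moments(1)[of m] unfolding normal1_eq_density[of m] R_def .
  then have Rz: "integrable (normal1 0) (\<lambda>z. R z * z)"
    by (subst (asm) integrable_density) (auto simp: R_def)
  have "(\<integral>z. z \<partial>density (normal1 0) (\<lambda>z. ennreal (R z))) = m"
    using normal1_moments(2)[of m] unfolding normal1_eq_density[of m] R_def .
  then have Rz': "(\<integral>z. R z * z \<partial>normal1 0) = m"
    unfolding R_def by (subst (asm) gauss.integral_Q) auto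
  have sq: "(R z - (1 + m * z))\<^sup>2 = R z ^ 2 - 2 * R z - 2 * m * (R z * z) + 1 + 2 * m * z + m\<^sup>2 * z ^ 2" for z
    by (simp add: power2_eq_square algebra_simps)
  show "integrable (normal1 0) (\<lambda>z. (R z - (1 + m * z))\<^sup>2)"
    unfolding sq using R R2 Rz normal1_moments(1)[of 0] normal1_moments(3) by auto
  have "(\<integral>z. (R z - (1 + m * z))\<^sup>2 \<partial>normal1 0) = exp (m\<^sup>2) - 2 - 2 * m * m + 1 + m\<^sup>2"
    unfolding sq using R R2 Rz Rz' normal1_moments(1,2)[of 0] normal1_moments(3,4) gauss.prob_space by simp
  also have "\<dots> = exp (m\<^sup>2) - 1 - m\<^sup>2" by (simp add: power2_eq_square)
  also have "\<dots> \<le> (m\<^sup>2)\<^sup>2"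
    using exp_bound[of "m\<^sup>2"] m by (simp add: power_le_one)
  finally show "(\<integral>z. (R z - (1 + m * z))\<^sup>2 \<partial>normal1 0) \<le> m ^ 4" by simp
qed

lemma linear_hinge:
  assumes m: "0 < m"
  shows "(\<integral>z. max 0 (1 + m * z - t) \<partial>normal1 0) = m * gauss_hinge ((t - 1) / m)"
    and "integrable (normal1 0) (\<lambda>z. max 0 (1 + m * z - t))"
proof -
  note * = max_scaled[OF m, of _ t]
  show "(\<integral>z. max 0 (1 + m * z - t) \<partial>normal1 0) = m * gauss_hinge ((t - 1) / m)"
    and "integrable (normal1 0) (\<lambda>z. max 0 (1 + m * z - t))"
    unfolding * using gauss_hinge_integral[of "(t - 1) / m"] by simp_all
qed

text \<open>A plain bound \<open>m^2\<close> and a bound \<open>3 * m^3\<close> after multiplication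
  by \<open>|t - 1|\<close> are added at scale \<open>m\<close>, which gives the constant
  \<open>4\<close> and the weight.\<close>

lemma gauss_hinge_approx:
  assumes m: "0 < m" "m \<le> 1"
  shows "\<bar>gauss.hinge m t - m * gauss_hinge ((t - 1) / m)\<bar> \<le> 4 * m\<^sup>2 / (1 + \<bar>(t - 1) / m\<bar>)"
proof -
  define R A D where "R z = exp (m * z - m\<^sup>2 / 2)" and "A z = 1 + m * z" and "D z = R z - A z" for z :: real
  define d where "d = \<bar>gauss.hinge m t - m * gauss_hinge ((t - 1) / m)\<bar>"
  have R: "integrable (normal1 0) R" "(\<integral>z. R z \<partial>normal1 0) = 1"
    unfolding R_def by (rule gauss.integrable_L gauss.integral_L)+
  have D: "integrable (normal1 0) D" "(\<integral>z. D z \<partial>normal1 0) = 0"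
    unfolding D_def A_def using R normal1_moments(1,2)[of 0] gauss.prob_space by simp_all
  have D2: "integrable (normal1 0) (\<lambda>z. D z ^ 2)" "(\<integral>z. D z ^ 2 \<partial>normal1 0) \<le> m ^ 4"
    unfolding D_def A_def R_def using gauss_ratio_linearization[of m] m by auto
  have hint: "integrable (normal1 0) (\<lambda>z. max 0 (R z - t))" "integrable (normal1 0) (\<lambda>z. max 0 (A z - t))"
    unfolding R_def A_def using gauss.integrable_hinge linear_hinge(2)[OF m(1)] by auto
  have diff: "gauss.hinge m t - m * gauss_hinge ((t - 1) / m) = (\<integral>z. max 0 (R z - t) - max 0 (A z - t) \<partial>normal1 0)"
    using hint by (simp add: gauss.hinge_def linear_hinge(1)[OF m(1), symmetric] R_def A_def)
  have "d \<le> (\<integral>z. \<bar>max 0 (R z - t) - max 0 (A z - t)\<bar> \<partial>normal1 0)"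
    unfolding d_def diff by (rule integral_abs_bound)
  also have "\<dots> \<le> (\<integral>z. (m\<^sup>2 + D z ^ 2 / m\<^sup>2) / 2 \<partial>normal1 0)"
  proof (rule integral_mono)
    fix z
    have "\<bar>max 0 (R z - t) - max 0 (A z - t)\<bar> \<le> \<bar>D z\<bar>" by (auto simp: D_def max_def)
    moreover have "0 \<le> (m - \<bar>D z\<bar> / m)\<^sup>2" by simp
    then have "2 * \<bar>D z\<bar> \<le> m\<^sup>2 + D z ^ 2 / m\<^sup>2"
      using m by (simp add: power2_diff power_divide)
    ultimately show "\<bar>max 0 (R z - t) - max 0 (A z - t)\<bar> \<le> (m\<^sup>2 + D z ^ 2 / m\<^sup>2) / 2" by argo
  qed (use hint D2 in auto)
  also have "\<dots> = (m\<^sup>2 + (\<integral>z. D z ^ 2 \<partial>normal1 0) / m\<^sup>2) / 2"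
    using D2 gauss.prob_space by simp
  also have "(\<integral>z. D z ^ 2 \<partial>normal1 0) / m\<^sup>2 \<le> m\<^sup>2"
    using D2(2) m by (simp add: divide_le_eq flip: power_add)
  finally have b1: "d \<le> m\<^sup>2" by simp
  have key: "\<bar>t - 1\<bar> * d \<le> 3 * m ^ 3"
  proof -
    \<comment> \<open>Selects the variant of \<open>hinge_diff_pointwise\<close>; subtracting
      \<open>c * D\<close> does not change the integral because \<open>D\<close> has mean
      \<open>0\<close>.\<close>
    define c :: real where "c = (if t < 1 then 1 else 0)"
    have "gauss.hinge m t - m * gauss_hinge ((t - 1) / m)
        = (\<integral>z. max 0 (R z - t) - max 0 (A z - t) - c * D z \<partial>normal1 0)"
      unfolding diff using hint D by simp
    then have "\<bar>t - 1\<bar> * d = \<bar>t - 1\<bar> * \<bar>\<integral>z. max 0 (R z - t) - max 0 (A z - t) - c * D z \<partial>normal1 0\<bar>"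
      by (simp only: d_def)
    also have "\<dots> \<le> \<bar>t - 1\<bar> * (\<integral>z. \<bar>max 0 (R z - t) - max 0 (A z - t) - c * D z\<bar> \<partial>normal1 0)"
      by (intro mult_left_mono integral_abs_bound) simp
    also have "\<dots> = (\<integral>z. \<bar>t - 1\<bar> * \<bar>max 0 (R z - t) - max 0 (A z - t) - c * D z\<bar> \<partial>normal1 0)"
      by simp
    also have "\<dots> \<le> (\<integral>z. D z ^ 2 + (D z ^ 2 / m + m ^ 3 * z ^ 2) \<partial>normal1 0)"
    proof (rule integral_mono)
      fix z
      have "\<bar>t - 1\<bar> * \<bar>max 0 (R z - t) - max 0 (A z - t) - c * D z\<bar> \<le> \<bar>D z\<bar> * (\<bar>R z - 1\<bar> + \<bar>A z - 1\<bar>)"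
        using hinge_diff_pointwise[of t "R z" "A z"] by (auto simp: c_def D_def)
      also have "\<dots> \<le> \<bar>D z\<bar> * (\<bar>D z\<bar> + 2 * (m * \<bar>z\<bar>))"
      proof (rule mult_left_mono)
        have "\<bar>A z - 1\<bar> = m * \<bar>z\<bar>" using m by (simp add: A_def abs_mult)
        then show "\<bar>R z - 1\<bar> + \<bar>A z - 1\<bar> \<le> \<bar>D z\<bar> + 2 * (m * \<bar>z\<bar>)"
          unfolding D_def by linarith
      qed simp
      also have "\<dots> = D z ^ 2 + 2 * \<bar>D z\<bar> * (m * \<bar>z\<bar>)"
        by (simp add: power2_eq_square algebra_simps flip: abs_mult)
      \<comment> \<open>Weighted arithmetic-geometric mean: since \<open>D^2\<close> has integral of
        order \<open>m^4\<close>, these weights make both terms of order \<open>m^3\<close>.\<close>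
      also have "2 * \<bar>D z\<bar> * (m * \<bar>z\<bar>) \<le> D z ^ 2 / m + m ^ 3 * z ^ 2"
      proof -
        have "0 \<le> (\<bar>D z\<bar> - m\<^sup>2 * \<bar>z\<bar>)\<^sup>2 / m" using m by simp
        also have "\<dots> = D z ^ 2 / m + m ^ 3 * z ^ 2 - 2 * \<bar>D z\<bar> * (m * \<bar>z\<bar>)"
          using m by (simp add: power2_diff power_mult_distrib field_simps power2_eq_square power3_eq_cube)
        finally show ?thesis by simp
      qed
      finally show "\<bar>t - 1\<bar> * \<bar>max 0 (R z - t) - max 0 (A z - t) - c * D z\<bar> \<le> D z ^ 2 + (D z ^ 2 / m + m ^ 3 * z ^ 2)"
        by simp
    qed (use hint D D2 normal1_moments(3) in auto)
    also have "\<dots> = (\<integral>z. D z ^ 2 \<partial>normal1 0) + ((\<integral>z. D z ^ 2 \<partial>normal1 0) / m + m ^ 3)"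
      using D2 normal1_moments(3,4) by simp
    also have "\<dots> \<le> m ^ 4 + (m ^ 4 / m + m ^ 3)"
      using D2(2) m by (intro add_mono divide_right_mono) auto
    also have "m ^ 4 / m = m ^ 3" using m by (simp add: power4_eq_xxxx power3_eq_cube)
    finally have "\<bar>t - 1\<bar> * d \<le> m ^ 4 + (m ^ 3 + m ^ 3)" .
    moreover have "m ^ 4 \<le> m ^ 3" using m by (intro power_decreasing) auto
    ultimately show ?thesis by linarith
  qed
  have "d * (1 + \<bar>(t - 1) / m\<bar>) = d + (\<bar>t - 1\<bar> * d) / m"
    using m by (simp add: field_simps abs_divide)
  also have "\<dots> \<le> m\<^sup>2 + 3 * m ^ 3 / m"
    using b1 key m by (intro add_mono divide_right_mono) auto
  also have "3 * m ^ 3 / m = 3 * m\<^sup>2" using m by (simp add: power3_eq_cube power2_eq_square)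
  finally have "d * (1 + \<bar>(t - 1) / m\<bar>) \<le> 4 * m\<^sup>2" by simp
  then show ?thesis
    unfolding d_def[symmetric] by (subst pos_le_divide_eq) (auto simp: add_pos_nonneg)
qed

text \<open>\<open>m * gauss_hinge (u / m)\<close> is \<open>E (m Z - u)_+\<close>, whose derivative
  in \<open>m\<close> is \<open>\<phi> (u / m)\<close> and does not decrease in \<open>m\<close>.
  This is the gain from shifting the Gaussian parameter.\<close>

lemma scaled_gauss_hinge_mono:
  assumes m: "0 < m" "m \<le> m'"
  shows "m * gauss_hinge (u / m) + (m' - m) * \<phi> (u / m) \<le> m' * gauss_hinge (u / m')"
proof (cases "m = m'")
  case False
  define h where "h m = m * \<phi> (u / m) - u * (1 - Phi (u / m))" for m
  have h: "h m = m * gauss_hinge (u / m)" if "0 < m" for m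
    using that by (simp add: h_def gauss_hinge_def right_diff_distrib)
  have "(h has_real_derivative \<phi> (u / x)) (at x)" if "m \<le> x" for x
    unfolding h_def using that m
    by (auto intro!: derivative_eq_intros DERIV_Phi' simp: field_simps power2_eq_square)
  then obtain y where y: "m < y" "y < m'" "h m' - h m = (m' - m) * \<phi> (u / y)"
    using MVT2[of m m' h "\<lambda>x. \<phi> (u / x)"] m False by auto
  have "\<phi> (u / m) \<le> \<phi> (u / y)"
    using y m by (intro std_normal_density_antimono) (auto simp: abs_divide intro!: divide_left_mono)
  then have "(m' - m) * \<phi> (u / m) \<le> h m' - h m"
    unfolding y(3) using m by (intro mult_left_mono) auto
  then show ?thesis using h[of m] h[of m'] m by simp
qed simp

section \<open>Composition\<close>

text \<open>Stability of the normal law. The degenerate case is included because the hybrid argument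
  starts with \<open>b = 0\<close>, whereas the density calculus for sums requires positive standard
  deviations.\<close>

lemma nn_integral_normal_conv:
  fixes g :: "real \<Rightarrow> ennreal"
  assumes g [measurable]: "g \<in> borel_measurable borel" and a: "0 \<le> a" "0 \<le> b"
  shows "(\<integral>\<^sup>+z. \<integral>\<^sup>+w. g (a * z + b * w) \<partial>normal1 0 \<partial>normal1 0)
    = (\<integral>\<^sup>+z. g (sqrt (a\<^sup>2 + b\<^sup>2) * z) \<partial>normal1 0)"
proof (cases "a = 0 \<or> b = 0")
  case True
  then show ?thesis using a gauss.emeasure_space_1 by auto
next
  case False
  with a have ab: "0 < a" "0 < b" by auto
  let ?N = "normal1 0"
  interpret NN: pair_prob_space ?N ?N ..
  have dist_std: "distributed M lborel X std_normal_density"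
    if "X \<in> measurable M borel" "distr M borel X = ?N" for M X
    unfolding distributed_def
  proof (intro conjI)
    have "distr M lborel X = distr M borel X" by (rule distr_cong) auto
    then show "distr M lborel X = density lborel (\<lambda>x. ennreal (std_normal_density x))"
      using that by (simp add: normal1_def)
  qed (use that in auto)
  have m: "fst \<in> measurable (?N \<Otimes>\<^sub>M ?N) borel" "snd \<in> measurable (?N \<Otimes>\<^sub>M ?N) borel"
    by (auto cong: measurable_cong_sets)
  have d1: "distr (?N \<Otimes>\<^sub>M ?N) borel fst = ?N"
  proof -
    have "distr (?N \<Otimes>\<^sub>M ?N) borel fst = distr (?N \<Otimes>\<^sub>M ?N) ?N fst" by (rule distr_cong) auto
    then show ?thesis using gauss.distr_pair_fst[of ?N] by simp
  qed
  have d2: "distr (?N \<Otimes>\<^sub>M ?N) borel snd = ?N"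
  proof -
    have "distr (?N \<Otimes>\<^sub>M ?N) borel snd = distr (?N \<Otimes>\<^sub>M ?N) ?N (fst \<circ> (\<lambda>(x, y). (y, x)))"
      by (rule distr_cong) auto
    also have "\<dots> = distr (distr (?N \<Otimes>\<^sub>M ?N) (?N \<Otimes>\<^sub>M ?N) (\<lambda>(x, y). (y, x))) ?N fst"
      by (rule distr_distr[symmetric]) (auto intro: measurable_pair_swap' measurable_fst)
    also have "distr (?N \<Otimes>\<^sub>M ?N) (?N \<Otimes>\<^sub>M ?N) (\<lambda>(x, y). (y, x)) = ?N \<Otimes>\<^sub>M ?N"
      by (rule NN.distr_pair_swap[symmetric])
    finally show ?thesis using gauss.distr_pair_fst[of ?N] by simp
  qed
  have "NN.indep_var borel fst borel snd"
    unfolding NN.indep_var_distribution_eq d1 d2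
  proof (intro conjI m)
    have "distr (?N \<Otimes>\<^sub>M ?N) (borel \<Otimes>\<^sub>M borel) (\<lambda>x. (fst x, snd x)) = distr (?N \<Otimes>\<^sub>M ?N) (?N \<Otimes>\<^sub>M ?N) (\<lambda>x. x)"
      by (rule distr_cong) (auto intro: sets_pair_measure_cong)
    then show "?N \<Otimes>\<^sub>M ?N = distr (?N \<Otimes>\<^sub>M ?N) (borel \<Otimes>\<^sub>M borel) (\<lambda>x. (fst x, snd x))"
      by simp
  qed
  from NN.indep_var_compose[OF this, of "\<lambda>z. a * z" borel "\<lambda>z. b * z" borel]
  have indep: "NN.indep_var borel (\<lambda>x. a * fst x) borel (\<lambda>x. b * snd x)"
    by (simp add: comp_def)
  have "distributed (?N \<Otimes>\<^sub>M ?N) lborel (\<lambda>x. a * fst x) (normal_density 0 a)"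
    using NN.normal_density_affine[OF dist_std[OF m(1) d1], of a 0] ab by simp
  moreover have "distributed (?N \<Otimes>\<^sub>M ?N) lborel (\<lambda>x. b * snd x) (normal_density 0 b)"
    using NN.normal_density_affine[OF dist_std[OF m(2) d2], of b 0] ab by simp
  ultimately have ds: "distributed (?N \<Otimes>\<^sub>M ?N) lborel (\<lambda>x. a * fst x + b * snd x) (normal_density 0 (sqrt (a\<^sup>2 + b\<^sup>2)))"
    using NN.add_indep_normal[OF indep ab, of 0 0] by simp
  have s: "0 < sqrt (a\<^sup>2 + b\<^sup>2)" using ab by (simp add: add_pos_pos)
  have "distr ?N borel (\<lambda>z. z) = ?N"
    by (rule distr_id2) simp
  then have d: "distributed ?N lborel (\<lambda>z. sqrt (a\<^sup>2 + b\<^sup>2) * z) (normal_density 0 (sqrt (a\<^sup>2 + b\<^sup>2)))"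
    using gauss.normal_density_affine[OF dist_std[of "\<lambda>z. z" ?N], of "sqrt (a\<^sup>2 + b\<^sup>2)" 0] s ab by simp
  have "(\<integral>\<^sup>+z. \<integral>\<^sup>+w. g (a * z + b * w) \<partial>?N \<partial>?N) = (\<integral>\<^sup>+x. g (a * fst x + b * snd x) \<partial>(?N \<Otimes>\<^sub>M ?N))"
    by (subst gauss.nn_integral_fst[symmetric]) (auto intro!: measurable_compose[OF _ g] cong: measurable_cong_sets)
  also have "\<dots> = (\<integral>\<^sup>+y. ennreal (normal_density 0 (sqrt (a\<^sup>2 + b\<^sup>2)) y) * g y \<partial>lborel)"
    by (rule distributed_nn_integral[OF ds, symmetric]) simp
  also have "\<dots> = (\<integral>\<^sup>+z. g (sqrt (a\<^sup>2 + b\<^sup>2) * z) \<partial>?N)"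
    by (rule distributed_nn_integral[OF d]) simp
  finally show ?thesis .
qed

lemma nn_integral_scaled_hinge:
  fixes L :: "'a \<Rightarrow> real"
  assumes [measurable]: "L \<in> borel_measurable M" and c: "0 < c"
  shows "(\<integral>\<^sup>+x. ennreal (max 0 (c * L x - t)) \<partial>M) = ennreal c * (\<integral>\<^sup>+x. ennreal (max 0 (L x - t / c)) \<partial>M)"
proof -
  have "c * (L x - t / c) = c * L x - t" for x using c by (simp add: field_simps)
  then have "max 0 (c * L x - t) = c * max 0 (L x - t / c)" for x
    using c by (simp add: max_mult_distrib_left)
  then show ?thesis
    using c by (subst nn_integral_cmult[symmetric]) (auto simp: ennreal_mult')
qed

context likelihood_ratio
begin

abbreviation prod_ratio :: "nat \<Rightarrow> (nat \<Rightarrow> 'a) \<Rightarrow> real" where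
  "prod_ratio E x \<equiv> \<Prod>i<E. L (x i)"

lemma prod_ratio_measurable [measurable]: "prod_ratio E \<in> borel_measurable (PiM {..<E} (\<lambda>_. P))"
  by measurable

lemma product_sigma_finite_P: "product_sigma_finite (\<lambda>_. P)"
  by (rule product_sigma_finite.intro) (rule sigma_finite_measure_axioms)

lemma nn_integral_prod_ratio: "(\<integral>\<^sup>+x. ennreal (prod_ratio E x) \<partial>PiM {..<E} (\<lambda>_. P)) = 1"
proof -
  interpret product_sigma_finite "\<lambda>_. P" by (rule product_sigma_finite_P)
  have "(\<integral>\<^sup>+x. ennreal (prod_ratio E x) \<partial>PiM {..<E} (\<lambda>_. P)) = (\<integral>\<^sup>+x. (\<Prod>i<E. ennreal (L (x i))) \<partial>PiM {..<E} (\<lambda>_. P))"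
    by (simp add: prod_ennreal L_nonneg)
  also have "\<dots> = (\<Prod>i<E. \<integral>\<^sup>+x. ennreal (L x) \<partial>P)"
    by (rule product_nn_integral_prod) auto
  finally show ?thesis by (simp add: nn_integral_L)
qed

lemma likelihood_ratio_product: "likelihood_ratio (PiM {..<E} (\<lambda>_. P)) (prod_ratio E)"
proof -
  interpret Pi: prob_space "PiM {..<E} (\<lambda>_. P)" by (rule prob_space_PiM) (rule prob_space_axioms)
  show ?thesis
    by standard (auto simp: nn_integral_prod_ratio L_nonneg prod_nonneg)
qed

lemma PiM_Q: "PiM {..<E} (\<lambda>_. Q) = density (PiM {..<E} (\<lambda>_. P)) (\<lambda>x. ennreal (prod_ratio E x))"
  by (subst PiM_density) (auto simp: prob_space_axioms prob_space_Q prod_ennreal L_nonneg)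

text \<open>Hybrid argument: the factors \<open>L\<close> are replaced one at a time by Gaussian likelihood ratios.
  Since the remaining factors have mean \<open>1\<close>, each replacement costs only \<open>\<delta>\<close>.\<close>

lemma nn_integral_prod_hinge_le:
  fixes E :: nat and \<delta> :: real
  assumes m: "0 \<le> m" and \<delta>: "0 \<le> \<delta>" and le: "\<And>t. 0 \<le> t \<Longrightarrow> hinge t \<le> gauss.hinge m t + \<delta>"
    and t: "0 \<le> t"
  shows "(\<integral>\<^sup>+x. ennreal (max 0 (prod_ratio E x - t)) \<partial>PiM {..<E} (\<lambda>_. P))
    \<le> ennreal (gauss.hinge (sqrt E * m) t + E * \<delta>)"
  using t
proof (induction E arbitrary: t)
  case 0
  \<comment> \<open>With no factors both likelihood ratios are the constant
    \<open>1\<close>.\<close>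
  have "gauss.hinge 0 t = max 0 (1 - t)"
    unfolding gauss.hinge_def using gauss.prob_space by simp
  then show ?case
    by (simp add: PiM_empty nn_integral_count_space_finite)
next
  case (Suc E)
  let ?PE = "PiM {..<E} (\<lambda>_. P)" and ?N = "normal1 0"
  have E\<delta>: "0 \<le> E * \<delta>" using \<delta> by simp
  define b where "b = sqrt E * m"
  define R where "R k z = exp (k * z - k\<^sup>2 / 2)" for k z :: real
  have R [measurable]: "R k \<in> borel_measurable borel" for k unfolding R_def by measurable
  have R_pos: "0 < R k z" for k z by (simp add: R_def)
  have R1: "(\<integral>\<^sup>+z. ennreal (R k z) \<partial>?N) = 1" for k unfolding R_def by (rule gauss.nn_integral_L)
  have R_hinge: "(\<integral>\<^sup>+z. ennreal (max 0 (R k z - u)) \<partial>?N) = ennreal (gauss.hinge k u)" for k u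
    unfolding R_def by (rule gauss.nn_integral_hinge)
  interpret PE: prob_space ?PE by (rule prob_space_PiM) (rule prob_space_axioms)
  interpret product_sigma_finite "\<lambda>_. P" by (rule product_sigma_finite_P)
  interpret pair: pair_sigma_finite ?PE ?N ..
  \<comment> \<open>The last factor is exchanged while the product of the others is frozen at
    \<open>c\<close>; rescaling the threshold to \<open>t / c\<close> turns the cost
    \<open>\<delta>\<close> into \<open>\<delta> * c\<close>, and \<open>c\<close> integrates to
    \<open>1\<close>.\<close>
  have replace: "(\<integral>\<^sup>+y. ennreal (max 0 (c * L y - t)) \<partial>P)
      \<le> (\<integral>\<^sup>+z. ennreal (max 0 (c * R m z - t)) \<partial>?N) + ennreal \<delta> * ennreal c" if c: "0 \<le> c" for c
  proof (cases "c = 0")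
    case True
    then show ?thesis using \<open>0 \<le> t\<close> by (simp add: max_absorb1)
  next
    case False
    with c have c: "0 < c" by simp
    have "(\<integral>\<^sup>+y. ennreal (max 0 (c * L y - t)) \<partial>P) = ennreal c * ennreal (hinge (t / c))"
      by (simp only: nn_integral_scaled_hinge[OF L_measurable c] nn_integral_hinge)
    also have "\<dots> \<le> ennreal c * ennreal (gauss.hinge m (t / c) + \<delta>)"
      using le[of "t / c"] c \<open>0 \<le> t\<close> by (intro mult_left_mono ennreal_leI) auto
    also have "\<dots> = ennreal c * ennreal (gauss.hinge m (t / c)) + ennreal \<delta> * ennreal c"
      by (simp only: ennreal_plus[OF gauss.hinge_nonneg \<delta>] distrib_left mult.commute[of "ennreal c" "ennreal \<delta>"])
    also have "ennreal c * ennreal (gauss.hinge m (t / c)) = (\<integral>\<^sup>+z. ennreal (max 0 (c * R m z - t)) \<partial>?N)"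
      by (subst nn_integral_scaled_hinge[OF _ c]) (simp_all only: R_hinge measurable_normal1 R)
    finally show ?thesis .
  qed
  \<comment> \<open>Now the new Gaussian factor is frozen at \<open>r\<close> and the induction
    hypothesis is used at \<open>t / r\<close>, which is why \<open>t\<close> is arbitrary in the
    induction.\<close>
  have IH: "(\<integral>\<^sup>+x. ennreal (max 0 (prod_ratio E x * r - t)) \<partial>?PE)
      \<le> (\<integral>\<^sup>+w. ennreal (max 0 (r * R b w - t)) \<partial>?N) + ennreal (E * \<delta>) * ennreal r" if r: "0 < r" for r
  proof -
    have "(\<integral>\<^sup>+x. ennreal (max 0 (prod_ratio E x * r - t)) \<partial>?PE)
        = ennreal r * (\<integral>\<^sup>+x. ennreal (max 0 (prod_ratio E x - t / r)) \<partial>?PE)"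
      unfolding mult.commute[of _ r] by (rule nn_integral_scaled_hinge[OF prod_ratio_measurable r])
    also have "\<dots> \<le> ennreal r * ennreal (gauss.hinge b (t / r) + E * \<delta>)"
      unfolding b_def using r \<open>0 \<le> t\<close> by (intro mult_left_mono Suc.IH) auto
    also have "\<dots> = ennreal r * ennreal (gauss.hinge b (t / r)) + ennreal (E * \<delta>) * ennreal r"
      by (simp only: ennreal_plus[OF gauss.hinge_nonneg E\<delta>] distrib_left mult.commute[of "ennreal r" "ennreal (E * \<delta>)"])
    also have "ennreal r * ennreal (gauss.hinge b (t / r)) = (\<integral>\<^sup>+w. ennreal (max 0 (r * R b w - t)) \<partial>?N)"
      by (subst nn_integral_scaled_hinge[OF _ r]) (simp_all only: R_hinge measurable_normal1 R)
    finally show ?thesis .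
  qed
  have [measurable]: "prod_ratio E \<in> borel_measurable ?PE" by (rule prod_ratio_measurable)
  have swap_meas: "(\<lambda>(x, z). ennreal (max 0 (prod_ratio E x * R m z - t))) \<in> borel_measurable (?PE \<Otimes>\<^sub>M ?N)"
  proof -
    have [measurable]: "(\<lambda>p. prod_ratio E (fst p)) \<in> borel_measurable (?PE \<Otimes>\<^sub>M ?N)"
      by (rule measurable_compose[OF measurable_fst prod_ratio_measurable])
    have [measurable]: "(\<lambda>p. R m (snd p)) \<in> borel_measurable (?PE \<Otimes>\<^sub>M ?N)"
      by (rule measurable_compose[OF measurable_snd]) simp
    show ?thesis unfolding case_prod_beta' by measurable
  qed
  have "(\<integral>\<^sup>+x. ennreal (max 0 (prod_ratio (Suc E) x - t)) \<partial>PiM {..<Suc E} (\<lambda>_. P))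
      = (\<integral>\<^sup>+x. ennreal (max 0 (prod_ratio (Suc E) x - t)) \<partial>PiM (insert E {..<E}) (\<lambda>_. P))"
    by (simp only: lessThan_Suc)
  also have "\<dots> = (\<integral>\<^sup>+x. \<integral>\<^sup>+y. ennreal (max 0 (prod_ratio (Suc E) (x(E := y)) - t)) \<partial>P \<partial>?PE)"
    using prod_ratio_measurable[of "Suc E"] by (intro product_nn_integral_insert) (auto simp: lessThan_Suc)
  also have "\<dots> = (\<integral>\<^sup>+x. \<integral>\<^sup>+y. ennreal (max 0 (prod_ratio E x * L y - t)) \<partial>P \<partial>?PE)"
  proof -
    have "prod_ratio (Suc E) (x(E := y)) = prod_ratio E x * L y" for x y
      by (simp add: mult.commute)
    then show ?thesis by simp
  qed
  also have "\<dots> \<le> (\<integral>\<^sup>+x. (\<integral>\<^sup>+z. ennreal (max 0 (prod_ratio E x * R m z - t)) \<partial>?N) + ennreal \<delta> * ennreal (prod_ratio E x) \<partial>?PE)"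
    by (intro nn_integral_mono replace prod_nonneg) (auto simp: L_nonneg)
  also have "\<dots> = (\<integral>\<^sup>+x. \<integral>\<^sup>+z. ennreal (max 0 (prod_ratio E x * R m z - t)) \<partial>?N \<partial>?PE) + ennreal \<delta>"
  proof (subst nn_integral_add)
    show "(\<lambda>x. \<integral>\<^sup>+z. ennreal (max 0 (prod_ratio E x * R m z - t)) \<partial>?N) \<in> borel_measurable ?PE"
      using gauss.borel_measurable_nn_integral[OF swap_meas] by simp
  qed (simp_all add: nn_integral_cmult nn_integral_prod_ratio)
  also have "(\<integral>\<^sup>+x. \<integral>\<^sup>+z. ennreal (max 0 (prod_ratio E x * R m z - t)) \<partial>?N \<partial>?PE)
      = (\<integral>\<^sup>+z. \<integral>\<^sup>+x. ennreal (max 0 (prod_ratio E x * R m z - t)) \<partial>?PE \<partial>?N)"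
    by (rule pair.Fubini'[OF swap_meas, symmetric])
  also have "\<dots> \<le> (\<integral>\<^sup>+z. (\<integral>\<^sup>+w. ennreal (max 0 (R m z * R b w - t)) \<partial>?N) + ennreal (E * \<delta>) * ennreal (R m z) \<partial>?N)"
    by (intro nn_integral_mono IH R_pos)
  also have "\<dots> = (\<integral>\<^sup>+z. \<integral>\<^sup>+w. ennreal (max 0 (R m z * R b w - t)) \<partial>?N \<partial>?N) + ennreal (E * \<delta>)"
  proof (subst nn_integral_add)
    have "(\<lambda>(z, w). ennreal (max 0 (R m z * R b w - t))) \<in> borel_measurable (?N \<Otimes>\<^sub>M ?N)"
      unfolding R_def by measurable
    then show "(\<lambda>z. \<integral>\<^sup>+w. ennreal (max 0 (R m z * R b w - t)) \<partial>?N) \<in> borel_measurable ?N"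
      using gauss.borel_measurable_nn_integral by fastforce
  qed (simp_all add: nn_integral_cmult R1)
  \<comment> \<open>Two Gaussian ratios multiply to one whose squared parameter is
    \<open>m^2 + b^2\<close>, here \<open>(E + 1) * m^2\<close>.\<close>
  also have "(\<integral>\<^sup>+z. \<integral>\<^sup>+w. ennreal (max 0 (R m z * R b w - t)) \<partial>?N \<partial>?N)
      = (\<integral>\<^sup>+z. \<integral>\<^sup>+w. ennreal (max 0 (exp (m * z + b * w - (m\<^sup>2 + b\<^sup>2) / 2) - t)) \<partial>?N \<partial>?N)"
    unfolding R_def by (simp add: add_divide_distrib algebra_simps flip: exp_add)
  also have "\<dots> = (\<integral>\<^sup>+z. ennreal (max 0 (exp (sqrt (m\<^sup>2 + b\<^sup>2) * z - (m\<^sup>2 + b\<^sup>2) / 2) - t)) \<partial>?N)"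
    using m by (intro nn_integral_normal_conv[where g = "\<lambda>u. ennreal (max 0 (exp (u - (m\<^sup>2 + b\<^sup>2) / 2) - t))"])
      (auto simp: b_def)
  also have "sqrt (m\<^sup>2 + b\<^sup>2) = sqrt (Suc E) * m"
  proof -
    have "m\<^sup>2 + b\<^sup>2 = real (Suc E) * m\<^sup>2" by (simp add: b_def power_mult_distrib algebra_simps)
    then show ?thesis using m by (simp add: real_sqrt_mult)
  qed
  also have "m\<^sup>2 + b\<^sup>2 = (sqrt (Suc E) * m)\<^sup>2" by (simp add: b_def power_mult_distrib algebra_simps)
  also have "(\<integral>\<^sup>+z. ennreal (max 0 (exp (sqrt (Suc E) * m * z - (sqrt (Suc E) * m)\<^sup>2 / 2) - t)) \<partial>?N)
      = ennreal (gauss.hinge (sqrt (Suc E) * m) t)"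
    by (rule gauss.nn_integral_hinge)
  finally have "(\<integral>\<^sup>+x. ennreal (max 0 (prod_ratio (Suc E) x - t)) \<partial>PiM {..<Suc E} (\<lambda>_. P))
      \<le> ennreal (gauss.hinge (sqrt (Suc E) * m) t) + ennreal (E * \<delta>) + ennreal \<delta>"
    by (simp add: add.assoc add_right_mono)
  also have "\<dots> = ennreal (gauss.hinge (sqrt (Suc E) * m) t + E * \<delta> + \<delta>)"
    by (simp only: ennreal_plus[OF gauss.hinge_nonneg E\<delta>]
        ennreal_plus[OF add_nonneg_nonneg[OF gauss.hinge_nonneg E\<delta>] \<delta>])
  also have "E * \<delta> + \<delta> = Suc E * \<delta>" by (simp add: distrib_right)
  then have "gauss.hinge (sqrt (Suc E) * m) t + E * \<delta> + \<delta> = gauss.hinge (sqrt (Suc E) * m) t + Suc E * \<delta>"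
    by linarith
  finally show ?case .
qed

lemma tradeoff_product_ge_G:
  fixes E :: nat and \<delta> :: real
  assumes m: "0 \<le> m" and \<delta>: "0 \<le> \<delta>" and le: "\<And>t. 0 \<le> t \<Longrightarrow> hinge t \<le> gauss.hinge m t + \<delta>"
    and a: "0 \<le> a" "a \<le> 1"
  shows "G (sqrt E * m) a - E * \<delta> \<le> tradeoff (PiM {..<E} (\<lambda>_. P)) (PiM {..<E} (\<lambda>_. Q)) a"
proof -
  interpret prod: likelihood_ratio "PiM {..<E} (\<lambda>_. P)" "prod_ratio E"
    by (rule likelihood_ratio_product)
  have "prod.hinge t \<le> gauss.hinge (sqrt E * m) t + E * \<delta>" if "0 \<le> t" for t
  proof -
    have "ennreal (prod.hinge t) \<le> ennreal (gauss.hinge (sqrt E * m) t + E * \<delta>)"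
      using nn_integral_prod_hinge_le[OF m \<delta> le that, of E] by (simp only: prod.nn_integral_hinge)
    moreover have "0 \<le> gauss.hinge (sqrt E * m) t + E * \<delta>"
      using gauss.hinge_nonneg \<delta> by (intro add_nonneg_nonneg) auto
    ultimately show ?thesis by (simp only: ennreal_le_iff)
  qed
  then show ?thesis
    unfolding PiM_Q using m \<delta> a by (intro prod.tradeoff_ge_G) auto
qed

end

section \<open>Asymptotics in the number of rounds\<close>

abbreviation shuffle_hinge :: "real \<Rightarrow> nat \<Rightarrow> real \<Rightarrow> real" where
  "shuffle_hinge \<tau> M \<equiv> likelihood_ratio.hinge (P0 M) (shuffle_ratio \<tau> M)"

definition mu_sh :: "real \<Rightarrow> nat \<Rightarrow> real" where
  "mu_sh \<tau> M = sqrt ((exp (\<tau>\<^sup>2) - 1) / (real M - 1))"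

text \<open>The cap keeps \<open>mu_sh - gamma_sh\<close> nonnegative for every
  \<open>M \<ge> 2\<close>, as the dual description of \<open>G\<close> requires; for large
  \<open>M\<close> it is inactive.\<close>

definition gamma_sh :: "real \<Rightarrow> nat \<Rightarrow> real" where
  "gamma_sh \<tau> M = (if M < 2 then 0 else min (mu_sh \<tau> M) (sqrt (ln M) / M))"

definition hinge_gap :: "real \<Rightarrow> nat \<Rightarrow> real \<Rightarrow> real" where
  "hinge_gap \<tau> M t = max 0 (max
     (shuffle_hinge \<tau> M t - gauss.hinge (mu_sh \<tau> M + gamma_sh \<tau> M) t)
     (gauss.hinge (mu_sh \<tau> M - gamma_sh \<tau> M) t - shuffle_hinge \<tau> M t))"

text \<open>The least error for which both hinge comparisons hold at all \<open>t \<ge> 0\<close>.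
  The gap is at most \<open>1\<close>, so the supremum is genuine.\<close>

definition delta_sh :: "real \<Rightarrow> nat \<Rightarrow> real" where
  "delta_sh \<tau> M = (if M < 2 then 0 else SUP t\<in>{0..}. hinge_gap \<tau> M t)"

lemma mu_sh_nonneg: "2 \<le> M \<Longrightarrow> 0 \<le> mu_sh \<tau> M"
  by (simp add: mu_sh_def)

lemma gamma_sh_bounds: "0 \<le> gamma_sh \<tau> M" "2 \<le> M \<Longrightarrow> gamma_sh \<tau> M \<le> mu_sh \<tau> M"
  using mu_sh_nonneg[of M \<tau>] by (auto simp: gamma_sh_def)

lemma gamma_sh_bigo: "gamma_sh \<tau> \<in> O(\<lambda>M. sqrt (ln (real M)) / real M)"
proof (rule bigoI[of _ 1])
  show "eventually (\<lambda>M. norm (gamma_sh \<tau> M) \<le> 1 * norm (sqrt (ln (real M)) / real M)) sequentially"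
    using eventually_ge_at_top[of 2]
  proof eventually_elim
    case (elim M)
    then have "gamma_sh \<tau> M \<le> sqrt (ln (real M)) / real M"
      by (simp add: gamma_sh_def)
    moreover have "0 \<le> ln (real M)" using elim by simp
    ultimately show ?case using gamma_sh_bounds(1)[of \<tau> M] by simp
  qed
qed

lemma hinge_gap_le_1:
  assumes "2 \<le> M" "0 \<le> t" shows "hinge_gap \<tau> M t \<le> 1"
proof -
  interpret likelihood_ratio "P0 M" "shuffle_ratio \<tau> M"
    by (rule shuffle_likelihood_ratio) (use assms in simp)
  note b = hinge_nonneg[of t] hinge_le_1[of t] gauss.hinge_nonneg[of _ t] gauss.hinge_le_1[of t]
  show ?thesis
    unfolding hinge_gap_def
    using b(1,2) b(3)[of "mu_sh \<tau> M + gamma_sh \<tau> M"] b(4)[of "mu_sh \<tau> M - gamma_sh \<tau> M"] assms(2)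
    by linarith
qed

lemma hinge_gap_le_delta: "2 \<le> M \<Longrightarrow> 0 \<le> t \<Longrightarrow> hinge_gap \<tau> M t \<le> delta_sh \<tau> M"
  unfolding delta_sh_def by (auto intro!: cSUP_upper bdd_aboveI2[of _ _ 1] hinge_gap_le_1)

lemma delta_sh_nonneg: "0 \<le> delta_sh \<tau> M"
proof (cases "M < 2")
  case False
  have "0 \<le> hinge_gap \<tau> M 0" by (simp add: hinge_gap_def)
  also have "\<dots> \<le> delta_sh \<tau> M" using False by (intro hinge_gap_le_delta) auto
  finally show ?thesis .
qed (simp add: delta_sh_def)

lemma shuffle_hinge_le:
  "2 \<le> M \<Longrightarrow> 0 \<le> t \<Longrightarrow> shuffle_hinge \<tau> M t \<le> gauss.hinge (mu_sh \<tau> M + gamma_sh \<tau> M) t + delta_sh \<tau> M"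
  "2 \<le> M \<Longrightarrow> 0 \<le> t \<Longrightarrow> gauss.hinge (mu_sh \<tau> M - gamma_sh \<tau> M) t \<le> shuffle_hinge \<tau> M t + delta_sh \<tau> M"
  using hinge_gap_le_delta[of M t \<tau>] unfolding hinge_gap_def by linarith+

text \<open>In the bulk (bounded \<open>x\<close>) the error \<open>O(1/M)\<close> is absorbed by the shift \<open>\<gamma> = sqrt (ln M) / M\<close>
  of the Gaussian parameter; in the tails it is already \<open>o(1/M)\<close>.\<close>

lemma error_absorbed:
  assumes "0 \<le> C" "0 < \<epsilon>"
  shows "eventually (\<lambda>M::nat. \<forall>x\<ge>0. (C / real M) / (1 + x) - sqrt (ln (real M)) / (2 * real M) * \<phi> (2 * x) \<le> \<epsilon> / real M) sequentially"
proof -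
  \<comment> \<open>For \<open>x \<ge> K\<close> the weighted error is already below
    \<open>\<epsilon>\<close>; for \<open>x < K\<close> the gain is at least its value at
    \<open>K\<close>, which outgrows \<open>C\<close> with \<open>sqrt (ln M)\<close>.\<close>
  define K where "K = C / \<epsilon>"
  have "filterlim (\<lambda>M::nat. sqrt (ln (real M))) at_top sequentially" by real_asymp
  then have "eventually (\<lambda>M::nat. 2 * C / \<phi> (2 * K) \<le> sqrt (ln (real M))) sequentially"
    by (simp add: filterlim_at_top)
  then show ?thesis
    using eventually_gt_at_top[of 0]
  proof eventually_elim
    case (elim M)
    show ?case
    proof (intro allI impI)
      fix x :: real assume x: "0 \<le> x"
      have "C / (1 + x) - sqrt (ln (real M)) / 2 * \<phi> (2 * x) \<le> \<epsilon>"
      proof (cases "K \<le> x")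
        case True
        then have "C \<le> \<epsilon> * (1 + x)" using assms by (simp add: K_def field_simps)
        then have "C / (1 + x) \<le> \<epsilon>" using x by (simp add: divide_le_eq)
        moreover have "0 \<le> sqrt (ln (real M)) / 2 * \<phi> (2 * x)" using elim by simp
        ultimately show ?thesis by linarith
      next
        case False
        have "C \<le> sqrt (ln (real M)) / 2 * \<phi> (2 * K)"
          using elim by (simp add: field_simps)
        also have "\<dots> \<le> sqrt (ln (real M)) / 2 * \<phi> (2 * x)"
          using False x elim by (intro mult_left_mono std_normal_density_antimono) auto
        finally have "C \<le> sqrt (ln (real M)) / 2 * \<phi> (2 * x)" .
        moreover have "C / (1 + x) \<le> C / 1" using assms x by (intro divide_left_mono) auto
        ultimately show ?thesis using assms by simp
      qed
      then have "(C / (1 + x) - sqrt (ln (real M)) / 2 * \<phi> (2 * x)) / real M \<le> \<epsilon> / real M"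
        by (rule divide_right_mono) simp
      then show "(C / real M) / (1 + x) - sqrt (ln (real M)) / (2 * real M) * \<phi> (2 * x) \<le> \<epsilon> / real M"
        by (simp add: diff_divide_distrib mult.commute)
    qed
  qed
qed

text \<open>With \<open>s = sqrt (v / M)\<close> and \<open>g = sqrt (ln M) / M\<close>:
  \<open>\<mu> + g\<close> is at most \<open>2 * s \<le> 1\<close>, as linearisation needs, and
  \<open>\<mu> - g\<close> is at least \<open>s / 2\<close>. Passing from \<open>M\<close> to
  \<open>M - 1\<close> in the parameter costs order \<open>M powr (-3/2)\<close>, hence at most
  \<open>g / 2\<close>.\<close>

lemma eventually_parameters:
  assumes v: "0 < v"
  shows "eventually (\<lambda>M::nat. 2 \<le> M \<and> 2 * sqrt (v / real M) \<le> 1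
    \<and> sqrt (ln (real M)) / real M \<le> sqrt (v / real M) / 2
    \<and> sqrt (v / real M) \<le> sqrt (v / (real M - 1))
    \<and> sqrt (v / (real M - 1)) \<le> 3 / 2 * sqrt (v / real M)
    \<and> sqrt (v / (real M - 1)) - sqrt (v / real M) \<le> sqrt (ln (real M)) / (2 * real M)) sequentially"
proof -
  have sv: "0 < sqrt v" using v by simp
  have split: "sqrt (v / y) = sqrt v / sqrt y" for y by (simp add: real_sqrt_divide)
  have "((\<lambda>M::nat. 1 / sqrt (real M)) \<longlonglongrightarrow> 0)" by real_asymp
  then have "eventually (\<lambda>M::nat. 1 / sqrt (real M) < 1 / (2 * sqrt v)) sequentially"
    using sv by (intro order_tendstoD) auto
  moreover have "((\<lambda>M::nat. sqrt (ln (real M)) / real M * sqrt (real M)) \<longlonglongrightarrow> 0)" by real_asymp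
  then have "eventually (\<lambda>M::nat. sqrt (ln (real M)) / real M * sqrt (real M) < sqrt v / 2) sequentially"
    using sv by (intro order_tendstoD) auto
  moreover have "eventually (\<lambda>M::nat. 1 / sqrt (real M - 1) \<le> 3 / 2 * (1 / sqrt (real M))) sequentially"
    by real_asymp
  moreover have "((\<lambda>M::nat. (1 / sqrt (real M - 1) - 1 / sqrt (real M)) * (2 * real M) / sqrt (ln (real M))) \<longlonglongrightarrow> 0)"
    by real_asymp
  then have "eventually (\<lambda>M::nat. (1 / sqrt (real M - 1) - 1 / sqrt (real M)) * (2 * real M) / sqrt (ln (real M)) < 1 / sqrt v) sequentially"
    using sv by (intro order_tendstoD) auto
  ultimately show ?thesis
    using eventually_ge_at_top[of 2]
  proof eventually_elim
    case (elim M)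
    have pos: "0 < sqrt (real M)" "0 < sqrt (ln (real M))" using elim by auto
    have "2 * sqrt (v / real M) \<le> 1"
      using elim(1) pos sv unfolding split by (simp add: field_simps)
    moreover have "sqrt (ln (real M)) / real M \<le> sqrt (v / real M) / 2"
      using elim(2) pos unfolding split by (simp add: field_simps)
    moreover have "sqrt (v / real M) \<le> sqrt (v / (real M - 1))"
      using v elim by (intro real_sqrt_le_mono divide_left_mono) auto
    moreover have "sqrt (v / (real M - 1)) \<le> 3 / 2 * sqrt (v / real M)"
      using mult_left_mono[OF elim(3), of "sqrt v"] sv unfolding split by simp
    moreover have "sqrt (v / (real M - 1)) - sqrt (v / real M) \<le> sqrt (ln (real M)) / (2 * real M)"
    proof -
      have "sqrt v * (1 / sqrt (real M - 1) - 1 / sqrt (real M)) * (2 * real M) \<le> sqrt (ln (real M))"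
        using elim(4) pos sv by (simp add: field_simps)
      then show ?thesis
        using elim(5) unfolding split by (simp add: pos_le_divide_eq right_diff_distrib)
    qed
    ultimately show ?case using elim by blast
  qed
qed

text \<open>Linearisation errors are weighted at scale \<open>m\<close>, normal approximation errors
  at scale \<open>s\<close>; this brings both to scale \<open>s\<close>.\<close>

lemma scaled_error_le:
  fixes s m x C :: real
  assumes "0 < m" "0 < k" "m \<le> k * s" "1 \<le> k" "0 < s" "0 \<le> C"
  shows "C / (1 + \<bar>u / m\<bar>) \<le> k * C / (1 + \<bar>u / s\<bar>)"
proof -
  have "\<bar>u\<bar> / s \<le> k * (\<bar>u\<bar> / m)"
    using assms mult_left_mono[OF assms(3), of "\<bar>u\<bar>"] by (simp add: field_simps)
  then have "1 + \<bar>u / s\<bar> \<le> k * (1 + \<bar>u / m\<bar>)"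
    using assms by (simp add: abs_divide distrib_left)
  then have "C * (1 + \<bar>u / s\<bar>) \<le> C * (k * (1 + \<bar>u / m\<bar>))"
    using assms by (intro mult_left_mono) auto
  then show ?thesis
    by (simp add: divide_le_eq pos_le_divide_eq add_pos_nonneg field_simps)
qed

text \<open>All hinges are compared with \<open>E (m Z - u)_+\<close>, \<open>u = t - 1\<close>: the
  shuffling one at \<open>m = s\<close>, the Gaussian ones at \<open>m = \<mu> + g\<close> and
  \<open>m = \<mu> - g\<close>. Each move away from \<open>s\<close> is at least
  \<open>g / 2\<close> and gains at least \<open>g / 2 * \<phi> (2 * x)\<close>, which by
  \<open>error_absorbed\<close> covers the approximation errors up to
  \<open>\<epsilon> / M\<close>.\<close>

lemma eventually_hinge_close:
  assumes \<tau>: "\<tau> \<noteq> 0" and \<epsilon>: "0 < \<epsilon>"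
  shows "eventually (\<lambda>M. \<forall>t. shuffle_hinge \<tau> M t \<le> gauss.hinge (mu_sh \<tau> M + gamma_sh \<tau> M) t + \<epsilon> / real M
    \<and> gauss.hinge (mu_sh \<tau> M - gamma_sh \<tau> M) t \<le> shuffle_hinge \<tau> M t + \<epsilon> / real M) sequentially"
proof -
  define v where "v = exp (\<tau>\<^sup>2) - 1"
  have v: "0 < v" using \<tau> by (simp add: v_def)
  define C1 where "C1 = stein_const * (5 * (1 + (\<integral>u. std_lognormal \<tau> u ^ 4 \<partial>normal1 0)))"
  have C1: "0 \<le> C1"
    unfolding C1_def using stein_const_nonneg
    by (intro mult_nonneg_nonneg add_nonneg_nonneg integral_nonneg_AE) auto
  \<comment> \<open>The first term is \<open>M\<close> times \<open>s * C1 / sqrt M\<close>. The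
    second is \<open>M\<close> times the linearisation error \<open>2 * 4 * m^2\<close> with
    \<open>m \<le> 2 * s\<close>.\<close>
  define C where "C = sqrt v * C1 + 32 * v"
  have C: "0 \<le> C" using C1 v by (simp add: C_def)
  show ?thesis
    using eventually_parameters[OF v] error_absorbed[OF C \<epsilon>]
  proof eventually_elim
    case (elim M)
    define s where "s = sqrt (v / real M)"
    define g where "g = sqrt (ln (real M)) / real M"
    define \<mu> where "\<mu> = sqrt (v / (real M - 1))"
    have M: "2 \<le> M" and par: "2 * s \<le> 1" "g \<le> s / 2" "s \<le> \<mu>" "\<mu> \<le> 3 / 2 * s" "\<mu> - s \<le> g / 2"
      using elim by (auto simp: s_def g_def \<mu>_def)
    have absorb: "(C / real M) / (1 + x) - g / 2 * \<phi> (2 * x) \<le> \<epsilon> / real M" if "0 \<le> x" for x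
    proof -
      have "g / 2 = sqrt (ln (real M)) / (2 * real M)" by (simp add: g_def)
      then show ?thesis using elim(2) that by (simp only:)
    qed
    have s: "0 < s" "s\<^sup>2 = v / real M" using v M by (auto simp: s_def)
    have g: "0 \<le> g" using M by (simp add: g_def)
    have mu: "mu_sh \<tau> M = \<mu>" by (simp add: mu_sh_def \<mu>_def v_def)
    have gamma: "gamma_sh \<tau> M = g"
      using M par s(1) by (simp add: gamma_sh_def mu flip: g_def)
    show ?case
    proof (intro allI conjI)
      fix t :: real
      define u where "u = t - 1"
      define x where "x = \<bar>u / s\<bar>"
      have x: "0 \<le> x" by (simp add: x_def)
      have e1: "\<bar>shuffle_hinge \<tau> M t - s * gauss_hinge (u / s)\<bar> \<le> (sqrt v * C1 / real M) / (1 + x)"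
      proof -
        have "\<bar>shuffle_hinge \<tau> M t - s * gauss_hinge (u / s)\<bar> \<le> s * (C1 / ((1 + x) * sqrt (real M)))"
          using shuffle_hinge_approx[OF \<tau>, of M t] M
          by (simp only: s_def u_def x_def C1_def v_def)
        also have "\<dots> = (sqrt v * C1 / real M) / (1 + x)"
          using M by (simp add: s_def real_sqrt_divide field_simps)
        finally show ?thesis .
      qed
      have split: "(C / real M) / (1 + x) = (sqrt v * C1 / real M) / (1 + x) + 32 * (v / real M) / (1 + x)"
        by (simp add: C_def add_divide_distrib)

      define m where "m = \<mu> + g"
      have m: "0 < m" "m \<le> 2 * s" "m \<le> 1" "s \<le> m" "g \<le> m - s"
        using par s g by (auto simp: m_def)
      have "4 * m\<^sup>2 / (1 + \<bar>u / m\<bar>) \<le> 2 * (4 * m\<^sup>2) / (1 + x)"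
        unfolding x_def using m s by (intro scaled_error_le) auto
      also have "\<dots> \<le> 32 * (v / real M) / (1 + x)"
        using power_mono[OF m(2), of 2] m x by (intro divide_right_mono) (auto simp: s(2) power_mult_distrib)
      finally have e2: "\<bar>gauss.hinge m t - m * gauss_hinge (u / m)\<bar> \<le> 32 * (v / real M) / (1 + x)"
        using gauss_hinge_approx[OF m(1,3), of t] by (simp add: u_def)
      have "\<phi> (2 * x) \<le> \<phi> (u / s)"
        by (rule std_normal_density_antimono) (simp add: x_def del: abs_divide)
      then have "g / 2 * \<phi> (2 * x) \<le> (m - s) * \<phi> (u / s)"
        using m g by (intro mult_mono) auto
      then have "s * gauss_hinge (u / s) + g / 2 * \<phi> (2 * x) \<le> m * gauss_hinge (u / m)"
        using scaled_gauss_hinge_mono[OF s(1) m(4), of u] by linarith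
      then show "shuffle_hinge \<tau> M t \<le> gauss.hinge (mu_sh \<tau> M + gamma_sh \<tau> M) t + \<epsilon> / real M"
        using e1 e2 absorb[OF x] split unfolding mu gamma m_def by linarith

      define k where "k = \<mu> - g"
      have k: "0 < k" "s \<le> 2 * k" "k \<le> s" "k \<le> 1" "g / 2 \<le> s - k"
        using par s g by (auto simp: k_def)
      have "4 * k\<^sup>2 / (1 + \<bar>u / k\<bar>) \<le> 1 * (4 * k\<^sup>2) / (1 + x)"
        unfolding x_def using k s by (intro scaled_error_le) auto
      also have "\<dots> \<le> 32 * (v / real M) / (1 + x)"
      proof (rule divide_right_mono)
        have "4 * k\<^sup>2 \<le> 32 * s\<^sup>2"
          using power_mono[OF k(3), of 2] k(1) by (intro mult_mono) auto
        then show "1 * (4 * k\<^sup>2) \<le> 32 * (v / real M)" by (simp add: s(2))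
      qed (use x in simp)
      finally have e3: "\<bar>gauss.hinge k t - k * gauss_hinge (u / k)\<bar> \<le> 32 * (v / real M) / (1 + x)"
        using gauss_hinge_approx[OF k(1,4), of t] by (simp add: u_def)
      \<comment> \<open>The gain now sits at the smaller scale \<open>k \<ge> s / 2\<close>; this is
        why the absorbed gain is stated with \<open>\<phi> (2 * x)\<close>.\<close>
      have "\<bar>u\<bar> / k \<le> 2 * (\<bar>u\<bar> / s)"
        using mult_left_mono[OF k(2), of "\<bar>u\<bar>"] k(1) s(1) by (simp add: field_simps)
      then have "g / 2 * \<phi> (2 * x) \<le> (s - k) * \<phi> (u / k)"
        using k g s(1) by (intro mult_mono std_normal_density_antimono) (auto simp: x_def abs_divide)
      then have "k * gauss_hinge (u / k) + g / 2 * \<phi> (2 * x) \<le> s * gauss_hinge (u / s)"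
        using scaled_gauss_hinge_mono[OF k(1,3), of u] by linarith
      then show "gauss.hinge (mu_sh \<tau> M - gamma_sh \<tau> M) t \<le> shuffle_hinge \<tau> M t + \<epsilon> / real M"
        using e1 e3 absorb[OF x] split unfolding mu gamma k_def by linarith
    qed
  qed
qed

lemma delta_sh_smallo:
  assumes "\<tau> \<noteq> 0" shows "delta_sh \<tau> \<in> o(\<lambda>M. 1 / real M)"
proof (rule landau_o.smallI)
  fix c :: real assume "0 < c"
  show "eventually (\<lambda>M. norm (delta_sh \<tau> M) \<le> c * norm (1 / real M)) sequentially"
    using eventually_hinge_close[OF assms \<open>0 < c\<close>] eventually_ge_at_top[of 2]
  proof eventually_elim
    case (elim M)
    have "hinge_gap \<tau> M t \<le> c / real M" for t
    proof -
      have "0 \<le> c / real M" using \<open>0 < c\<close> by simp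
      then show ?thesis using elim(1)[rule_format, of t] unfolding hinge_gap_def by linarith
    qed
    then have "delta_sh \<tau> M \<le> c / real M"
      using elim unfolding delta_sh_def by (auto intro!: cSUP_least)
    then show ?case using delta_sh_nonneg[of \<tau> M] by simp
  qed
qed

section \<open>Proof of the theorem\<close>

lemma G_mu_antimono: "m \<le> m' \<Longrightarrow> G m' a \<le> G m a"
  by (auto simp: G_def intro!: Phi_mono)

lemma G_ge_minus_dist: "G m a - \<bar>m - m'\<bar> \<le> G m' a"
  using G_mu_antimono[of m' m a] G_diff_le[of m m' a] by (cases "m \<le> m'") auto

lemma sqrt_mult_mu_sh_tendsto:
  "(\<lambda>M. sqrt (real M) * (mu_sh \<tau> M + gamma_sh \<tau> M)) \<longlonglongrightarrow> sqrt (exp (\<tau>\<^sup>2) - 1)"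
proof -
  have "(\<lambda>M::nat. sqrt (real M) / sqrt (real M - 1)) \<longlonglongrightarrow> 1" by real_asymp
  then have "(\<lambda>M::nat. sqrt (exp (\<tau>\<^sup>2) - 1) * (sqrt (real M) / sqrt (real M - 1))) \<longlonglongrightarrow> sqrt (exp (\<tau>\<^sup>2) - 1) * 1"
    by (intro tendsto_intros)
  then have mu: "(\<lambda>M. sqrt (real M) * mu_sh \<tau> M) \<longlonglongrightarrow> sqrt (exp (\<tau>\<^sup>2) - 1)"
    by (simp add: mu_sh_def real_sqrt_divide mult.commute)
  have "(\<lambda>M. sqrt (real M) * gamma_sh \<tau> M) \<longlonglongrightarrow> 0"
  proof (rule tendsto_sandwich[where f = "\<lambda>_. 0" and h = "\<lambda>M::nat. sqrt (real M) * (sqrt (ln (real M)) / real M)"])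
    show "(\<lambda>M::nat. sqrt (real M) * (sqrt (ln (real M)) / real M)) \<longlonglongrightarrow> 0" by real_asymp
    show "eventually (\<lambda>M. sqrt (real M) * gamma_sh \<tau> M \<le> sqrt (real M) * (sqrt (ln (real M)) / real M)) sequentially"
      using eventually_ge_at_top[of 2]
      by eventually_elim (intro mult_left_mono, auto simp: gamma_sh_def)
  qed (auto simp: gamma_sh_bounds)
  from tendsto_add[OF mu this] show ?thesis by (simp add: distrib_left)
qed

lemma real_mult_delta_sh_tendsto:
  assumes "\<tau> \<noteq> 0" shows "(\<lambda>M. real M * delta_sh \<tau> M) \<longlonglongrightarrow> 0"
  using smalloD_tendsto[OF delta_sh_smallo[OF assms]] by (simp add: mult.commute)

lemma f_shuffle_comp_bounds:
  assumes \<sigma>: "\<sigma> > 0" and M: "2 \<le> M" and a: "0 \<le> a" "a \<le> 1"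
  defines "\<tau> \<equiv> 1 / \<sigma>"
  shows "G (sqrt E * (mu_sh \<tau> M + gamma_sh \<tau> M)) a - E * delta_sh \<tau> M \<le> f_shuffle_comp \<sigma> M E a"
    and "f_shuffle_comp \<sigma> M E a \<le> 1 - a"
proof -
  interpret likelihood_ratio "P0 M" "shuffle_ratio \<tau> M"
    by (rule shuffle_likelihood_ratio) (use M in simp)
  have P1: "P1 \<sigma> M = Q" using P1_eq_density[of M \<sigma>] M by (simp add: \<tau>_def)
  show "G (sqrt E * (mu_sh \<tau> M + gamma_sh \<tau> M)) a - E * delta_sh \<tau> M \<le> f_shuffle_comp \<sigma> M E a"
    unfolding f_shuffle_comp_def P1
    using M a mu_sh_nonneg[OF M] gamma_sh_bounds(1)
    by (intro tradeoff_product_ge_G delta_sh_nonneg shuffle_hinge_le) auto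
  show "f_shuffle_comp \<sigma> M E a \<le> 1 - a"
    unfolding f_shuffle_comp_def P1 using a
    by (intro tradeoff_le_one_minus prob_space_PiM prob_space_axioms prob_space_Q sets_PiM_cong) auto
qed

text \<open>The total loss is the distance of the Gaussian parameters, as \<open>G\<close> is
  \<open>1\<close>-Lipschitz in its parameter, plus \<open>E M * delta_sh\<close>, which is
  \<open>(cM M)^2\<close> times the null sequence \<open>M * delta_sh\<close>. The clause
  \<open>2 \<le> M0\<close> lets the upper bound \<open>1 - a\<close> be applied from the same index
  on.\<close>

lemma f_shuffle_comp_asymptotics:
  assumes \<sigma>: "\<sigma> > 0" and c: "0 \<le> c"
    and E: "\<And>M. 2 \<le> M \<Longrightarrow> real (E M) = (cM M)\<^sup>2 * real M"
    and cM: "cM \<longlonglongrightarrow> c" and \<eta>: "0 < \<eta>"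
  shows "\<exists>M0\<ge>2. \<forall>M\<ge>M0. \<forall>a. 0 \<le> a \<and> a \<le> 1 \<longrightarrow>
    f_shuffle_comp \<sigma> M (E M) a \<ge> G (c * sqrt (exp (1 / \<sigma>\<^sup>2) - 1)) a - \<eta>"
proof -
  define \<tau> where "\<tau> = 1 / \<sigma>"
  have \<tau>: "\<tau> \<noteq> 0" "\<tau>\<^sup>2 = 1 / \<sigma>\<^sup>2" using \<sigma> by (auto simp: \<tau>_def power_one_over)
  define s where "s = sqrt (exp (\<tau>\<^sup>2) - 1)"
  define m where "m M = mu_sh \<tau> M + gamma_sh \<tau> M" for M
  have "(\<lambda>M. \<bar>c * s - \<bar>cM M\<bar> * (sqrt (real M) * m M)\<bar> + (cM M)\<^sup>2 * (real M * delta_sh \<tau> M))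
      \<longlonglongrightarrow> \<bar>c * s - \<bar>c\<bar> * s\<bar> + c\<^sup>2 * 0"
    unfolding m_def s_def
    by (intro tendsto_intros cM sqrt_mult_mu_sh_tendsto real_mult_delta_sh_tendsto \<tau>)
  then have "eventually (\<lambda>M. \<bar>c * s - \<bar>cM M\<bar> * (sqrt (real M) * m M)\<bar> + (cM M)\<^sup>2 * (real M * delta_sh \<tau> M) < \<eta>) sequentially"
    using c \<eta> by (intro order_tendstoD) auto
  then obtain M1 where M1: "\<And>M. M \<ge> M1 \<Longrightarrow>
      \<bar>c * s - \<bar>cM M\<bar> * (sqrt (real M) * m M)\<bar> + (cM M)\<^sup>2 * (real M * delta_sh \<tau> M) < \<eta>"
    by (auto simp: eventually_sequentially)
  show ?thesis
  proof (intro exI[of _ "max M1 2"] conjI allI impI)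
    fix M a assume M: "max M1 2 \<le> M" and a: "0 \<le> a \<and> a \<le> (1::real)"
    \<comment> \<open>Only the square of \<open>cM M\<close> is tied to \<open>E M\<close>, so its
      sign is free and the absolute value appears.\<close>
    have eq1: "sqrt (E M) * m M = \<bar>cM M\<bar> * (sqrt (real M) * m M)"
      using E[of M] M by (simp add: real_sqrt_mult)
    have eq2: "E M * delta_sh \<tau> M = (cM M)\<^sup>2 * (real M * delta_sh \<tau> M)"
      using E[of M] M by simp
    have "\<bar>c * s - sqrt (E M) * m M\<bar> + E M * delta_sh \<tau> M < \<eta>"
      unfolding eq1 eq2 using M1[of M] M by simp
    moreover have "G (sqrt (E M) * m M) a - E M * delta_sh \<tau> M \<le> f_shuffle_comp \<sigma> M (E M) a"
      unfolding m_def \<tau>_def using f_shuffle_comp_bounds(1)[OF \<sigma>, of M a "E M"] M a by simp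
    moreover have "G (c * s) a - \<bar>c * s - sqrt (E M) * m M\<bar> \<le> G (sqrt (E M) * m M) a"
      by (rule G_ge_minus_dist)
    ultimately have "G (c * s) a - \<eta> \<le> f_shuffle_comp \<sigma> M (E M) a"
      by linarith
    then show "G (c * sqrt (exp (1 / \<sigma>\<^sup>2) - 1)) a - \<eta> \<le> f_shuffle_comp \<sigma> M (E M) a"
      by (simp add: s_def \<tau>(2))
  qed simp
qed

theorem theorem3:
  fixes \<sigma> :: real
  assumes "\<sigma> > 0"
  shows
   "(\<exists>\<delta> \<gamma> :: nat \<Rightarrow> real.
      (\<forall>M. \<delta> M \<ge> 0) \<and> \<delta> \<in> o(\<lambda>M. 1 / real M) \<and>
      (\<forall>M. \<gamma> M \<ge> 0) \<and> \<gamma> \<in> O(\<lambda>M. sqrt (ln (real M)) / real M) \<and>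
      (\<forall>M::nat. M \<ge> 2 \<longrightarrow>
         (let \<mu> = sqrt ((exp (1 / \<sigma>\<^sup>2) - 1) / (real M - 1)) in
          (\<forall>a. \<delta> M \<le> a \<and> a \<le> 1 - \<delta> M \<longrightarrow>
             G (\<mu> + \<gamma> M) (a + \<delta> M) - \<delta> M \<le> f_shuffle \<sigma> M a \<and>
             f_shuffle \<sigma> M a \<le> G (\<mu> - \<gamma> M) (a - \<delta> M) + \<delta> M +
               (if a \<ge> 1 / 2 + \<delta> M
                then exp (2 / \<sigma>\<^sup>2) / (sqrt (8 * pi * exp 1) * (real M - 1)) else 0)) \<and>
          (let astar = (THE x. x = G (\<mu> + \<gamma> M) x);
               dhat = max (\<delta> M / astar) ((1 - G (\<mu> + \<gamma> M) (\<delta> M)) + \<delta> M) in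
           \<forall>a. 0 \<le> a \<and> a \<le> 1 \<longrightarrow> f_shuffle \<sigma> M a \<ge> G_comp_f0 (\<mu> + \<gamma> M) dhat a))))
    \<and>
    (\<forall>(c::real) (E::nat \<Rightarrow> nat) (cM::nat \<Rightarrow> real).
       c \<ge> 0 \<and> (\<forall>M\<ge>2. E M > 0 \<and> real (E M) = (cM M)\<^sup>2 * real M) \<and> cM \<longlonglongrightarrow> c \<longrightarrow>
       (\<forall>\<eta>>0. \<exists>M0. \<forall>M\<ge>M0. \<forall>a. 0 \<le> a \<and> a \<le> 1 \<longrightarrow>
          f_shuffle_comp \<sigma> M (E M) a \<ge> G (c * sqrt (exp (1 / \<sigma>\<^sup>2) - 1)) a - \<eta>) \<and>
       (c = 0 \<longrightarrow> (\<forall>\<eta>>0. \<exists>M0. \<forall>M\<ge>M0. \<forall>a. 0 \<le> a \<and> a \<le> 1 \<longrightarrow>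
          \<bar>f_shuffle_comp \<sigma> M (E M) a - (1 - a)\<bar> \<le> \<eta>)))"
proof (intro conjI)
  define \<tau> where "\<tau> = 1 / \<sigma>"
  have \<tau>: "\<tau> \<noteq> 0" "\<tau>\<^sup>2 = 1 / \<sigma>\<^sup>2" using assms by (auto simp: \<tau>_def power_one_over)
  show "\<exists>\<delta> \<gamma> :: nat \<Rightarrow> real.
      (\<forall>M. \<delta> M \<ge> 0) \<and> \<delta> \<in> o(\<lambda>M. 1 / real M) \<and>
      (\<forall>M. \<gamma> M \<ge> 0) \<and> \<gamma> \<in> O(\<lambda>M. sqrt (ln (real M)) / real M) \<and>
      (\<forall>M::nat. M \<ge> 2 \<longrightarrow>
         (let \<mu> = sqrt ((exp (1 / \<sigma>\<^sup>2) - 1) / (real M - 1)) in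
          (\<forall>a. \<delta> M \<le> a \<and> a \<le> 1 - \<delta> M \<longrightarrow>
             G (\<mu> + \<gamma> M) (a + \<delta> M) - \<delta> M \<le> f_shuffle \<sigma> M a \<and>
             f_shuffle \<sigma> M a \<le> G (\<mu> - \<gamma> M) (a - \<delta> M) + \<delta> M +
               (if a \<ge> 1 / 2 + \<delta> M
                then exp (2 / \<sigma>\<^sup>2) / (sqrt (8 * pi * exp 1) * (real M - 1)) else 0)) \<and>
          (let astar = (THE x. x = G (\<mu> + \<gamma> M) x);
               dhat = max (\<delta> M / astar) ((1 - G (\<mu> + \<gamma> M) (\<delta> M)) + \<delta> M) in
           \<forall>a. 0 \<le> a \<and> a \<le> 1 \<longrightarrow> f_shuffle \<sigma> M a \<ge> G_comp_f0 (\<mu> + \<gamma> M) dhat a)))"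
  proof (rule exI[of _ "delta_sh \<tau>"], rule exI[of _ "gamma_sh \<tau>"], intro conjI allI impI)
    show "delta_sh \<tau> M \<ge> 0" "gamma_sh \<tau> M \<ge> 0" for M
      by (rule delta_sh_nonneg gamma_sh_bounds)+
    show "delta_sh \<tau> \<in> o(\<lambda>M. 1 / real M)" using \<tau>(1) by (rule delta_sh_smallo)
    show "gamma_sh \<tau> \<in> O(\<lambda>M. sqrt (ln (real M)) / real M)" by (rule gamma_sh_bigo)
    fix M :: nat assume M: "2 \<le> M"
    define \<mu> \<delta> \<gamma> where "\<mu> = mu_sh \<tau> M" and "\<delta> = delta_sh \<tau> M" and "\<gamma> = gamma_sh \<tau> M"
    have mu: "sqrt ((exp (1 / \<sigma>\<^sup>2) - 1) / (real M - 1)) = \<mu>"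
      by (simp add: \<mu>_def mu_sh_def \<tau>(2))
    have pos: "0 \<le> \<mu>" "0 \<le> \<delta>" "0 \<le> \<gamma>" "\<gamma> \<le> \<mu>"
      using mu_sh_nonneg[OF M] delta_sh_nonneg gamma_sh_bounds M by (auto simp: \<mu>_def \<delta>_def \<gamma>_def)
    interpret likelihood_ratio "P0 M" "shuffle_ratio \<tau> M"
      by (rule shuffle_likelihood_ratio) (use M in simp)
    have f: "f_shuffle \<sigma> M = tradeoff (P0 M) Q"
      using P1_eq_density[of M \<sigma>] M by (simp add: f_shuffle_def \<tau>_def)
    have lower: "G (\<mu> + \<gamma>) a - \<delta> \<le> f_shuffle \<sigma> M a" if "0 \<le> a" "a \<le> 1" for a
      unfolding f using that pos shuffle_hinge_le(1)[OF M, of _ \<tau>]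
      by (intro tradeoff_ge_G) (auto simp: \<mu>_def \<delta>_def \<gamma>_def)
    have upper: "f_shuffle \<sigma> M a \<le> G (\<mu> - \<gamma>) a + \<delta>" if "0 \<le> a" "a \<le> 1" for a
      unfolding f using that pos shuffle_hinge_le(2)[OF M, of _ \<tau>]
      by (intro tradeoff_le_G) (auto simp: \<mu>_def \<delta>_def \<gamma>_def)
    have f_nonneg: "0 \<le> f_shuffle \<sigma> M a" if "0 \<le> a" for a
      unfolding f using that by (intro tradeoff_nonneg prob_space_Q) auto
    show "let \<mu> = sqrt ((exp (1 / \<sigma>\<^sup>2) - 1) / (real M - 1)) in
          (\<forall>a. delta_sh \<tau> M \<le> a \<and> a \<le> 1 - delta_sh \<tau> M \<longrightarrow>
             G (\<mu> + gamma_sh \<tau> M) (a + delta_sh \<tau> M) - delta_sh \<tau> M \<le> f_shuffle \<sigma> M a \<and>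
             f_shuffle \<sigma> M a \<le> G (\<mu> - gamma_sh \<tau> M) (a - delta_sh \<tau> M) + delta_sh \<tau> M +
               (if a \<ge> 1 / 2 + delta_sh \<tau> M
                then exp (2 / \<sigma>\<^sup>2) / (sqrt (8 * pi * exp 1) * (real M - 1)) else 0)) \<and>
          (let astar = (THE x. x = G (\<mu> + gamma_sh \<tau> M) x);
               dhat = max (delta_sh \<tau> M / astar) ((1 - G (\<mu> + gamma_sh \<tau> M) (delta_sh \<tau> M)) + delta_sh \<tau> M) in
           \<forall>a. 0 \<le> a \<and> a \<le> 1 \<longrightarrow> f_shuffle \<sigma> M a \<ge> G_comp_f0 (\<mu> + gamma_sh \<tau> M) dhat a)"
      unfolding mu Let_def \<delta>_def[symmetric] \<gamma>_def[symmetric]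
    proof (intro conjI allI impI)
      fix a assume a: "\<delta> \<le> a \<and> a \<le> 1 - \<delta>"
      \<comment> \<open>The bounds \<open>lower\<close> and \<open>upper\<close> hold at
        \<open>a\<close> itself; the horizontal shifts follow because \<open>G\<close> is
        nonincreasing in the level.\<close>
      have "G (\<mu> + \<gamma>) (a + \<delta>) \<le> G (\<mu> + \<gamma>) a"
        using pos by (intro G_antimono) simp
      then show "G (\<mu> + \<gamma>) (a + \<delta>) - \<delta> \<le> f_shuffle \<sigma> M a"
        using lower[of a] a pos by linarith
      have "G (\<mu> - \<gamma>) a \<le> G (\<mu> - \<gamma>) (a - \<delta>)"
        using pos by (intro G_antimono) simp
      moreover have "0 \<le> (if a \<ge> 1 / 2 + \<delta>
          then exp (2 / \<sigma>\<^sup>2) / (sqrt (8 * pi * exp 1) * (real M - 1)) else 0)"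
        using M by simp
      ultimately show "f_shuffle \<sigma> M a \<le> G (\<mu> - \<gamma>) (a - \<delta>) + \<delta> + (if a \<ge> 1 / 2 + \<delta>
          then exp (2 / \<sigma>\<^sup>2) / (sqrt (8 * pi * exp 1) * (real M - 1)) else 0)"
        using upper[of a] a pos by linarith
    next
      fix a :: real assume a: "0 \<le> a \<and> a \<le> 1"
      \<comment> \<open>The maximum dominates its second argument, which is the hypothesis
        \<open>d\<close> of \<open>G_comp_f0_le_tradeoff\<close>.\<close>
      show "G_comp_f0 (\<mu> + \<gamma>) (max (\<delta> / (THE x. x = G (\<mu> + \<gamma>) x)) ((1 - G (\<mu> + \<gamma>) \<delta>) + \<delta>)) a
          \<le> f_shuffle \<sigma> M a"
        using pos a by (intro G_comp_f0_le_tradeoff[where \<delta> = \<delta>] lower f_nonneg) auto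
    qed
  qed
next
  show "\<forall>(c::real) (E::nat \<Rightarrow> nat) (cM::nat \<Rightarrow> real).
       c \<ge> 0 \<and> (\<forall>M\<ge>2. E M > 0 \<and> real (E M) = (cM M)\<^sup>2 * real M) \<and> cM \<longlonglongrightarrow> c \<longrightarrow>
       (\<forall>\<eta>>0. \<exists>M0. \<forall>M\<ge>M0. \<forall>a. 0 \<le> a \<and> a \<le> 1 \<longrightarrow>
          f_shuffle_comp \<sigma> M (E M) a \<ge> G (c * sqrt (exp (1 / \<sigma>\<^sup>2) - 1)) a - \<eta>) \<and>
       (c = 0 \<longrightarrow> (\<forall>\<eta>>0. \<exists>M0. \<forall>M\<ge>M0. \<forall>a. 0 \<le> a \<and> a \<le> 1 \<longrightarrow>
          \<bar>f_shuffle_comp \<sigma> M (E M) a - (1 - a)\<bar> \<le> \<eta>))"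
  proof (intro allI impI)
    fix c :: real and E :: "nat \<Rightarrow> nat" and cM :: "nat \<Rightarrow> real"
    assume *: "c \<ge> 0 \<and> (\<forall>M\<ge>2. E M > 0 \<and> real (E M) = (cM M)\<^sup>2 * real M) \<and> cM \<longlonglongrightarrow> c"
    have lower: "\<exists>M0\<ge>2. \<forall>M\<ge>M0. \<forall>a. 0 \<le> a \<and> a \<le> 1 \<longrightarrow>
        f_shuffle_comp \<sigma> M (E M) a \<ge> G (c * sqrt (exp (1 / \<sigma>\<^sup>2) - 1)) a - \<eta>" if "0 < \<eta>" for \<eta>
      using * that by (intro f_shuffle_comp_asymptotics[OF assms]) auto
    show "(\<forall>\<eta>>0. \<exists>M0. \<forall>M\<ge>M0. \<forall>a. 0 \<le> a \<and> a \<le> 1 \<longrightarrow>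
          f_shuffle_comp \<sigma> M (E M) a \<ge> G (c * sqrt (exp (1 / \<sigma>\<^sup>2) - 1)) a - \<eta>) \<and>
       (c = 0 \<longrightarrow> (\<forall>\<eta>>0. \<exists>M0. \<forall>M\<ge>M0. \<forall>a. 0 \<le> a \<and> a \<le> 1 \<longrightarrow>
          \<bar>f_shuffle_comp \<sigma> M (E M) a - (1 - a)\<bar> \<le> \<eta>))"
    proof (intro conjI allI impI)
      fix \<eta> :: real assume "0 < \<eta>"
      from lower[OF this]
      show "\<exists>M0. \<forall>M\<ge>M0. \<forall>a. 0 \<le> a \<and> a \<le> 1 \<longrightarrow>
          f_shuffle_comp \<sigma> M (E M) a \<ge> G (c * sqrt (exp (1 / \<sigma>\<^sup>2) - 1)) a - \<eta>" by blast
    next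
      fix \<eta> :: real assume "c = 0" "0 < \<eta>"
      obtain M0 where M0: "2 \<le> M0" and low: "\<And>M a. M0 \<le> M \<Longrightarrow> 0 \<le> a \<Longrightarrow> a \<le> 1 \<Longrightarrow>
          f_shuffle_comp \<sigma> M (E M) a \<ge> G (c * sqrt (exp (1 / \<sigma>\<^sup>2) - 1)) a - \<eta>"
        using lower[OF \<open>0 < \<eta>\<close>] by blast
      show "\<exists>M0. \<forall>M\<ge>M0. \<forall>a. 0 \<le> a \<and> a \<le> 1 \<longrightarrow> \<bar>f_shuffle_comp \<sigma> M (E M) a - (1 - a)\<bar> \<le> \<eta>"
      proof (intro exI[of _ M0] allI impI)
        fix M a assume M: "M0 \<le> M" and a: "0 \<le> a \<and> a \<le> (1::real)"
        have "1 - a - \<eta> \<le> f_shuffle_comp \<sigma> M (E M) a"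
          using low[of M a] M a by (simp add: \<open>c = 0\<close> G_zero)
        moreover have "f_shuffle_comp \<sigma> M (E M) a \<le> 1 - a"
          using f_shuffle_comp_bounds(2)[OF assms, of M a "E M"] M M0 a by simp
        ultimately show "\<bar>f_shuffle_comp \<sigma> M (E M) a - (1 - a)\<bar> \<le> \<eta>"
          using \<open>0 < \<eta>\<close> by linarith
      qed
    qed
  qed
qed

end
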